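(* Let $T>0$, let $u_0\in H$, and let $u$ be a weak solution on $(0,T)\times\mathbb{T}^3$ to the incompressible Euler equations $$\partial_t u+(u\cdot\nabla)u+\nabla p=0,\qquad \operatorname{div}u=0,\qquad u(0,x)=u_0(x).$$ Let $s\in\mathbb{R}$ satisfy $\frac56\le s<\frac52$, and assume that $u\in L^{\frac{5}{2s}}(0,T;H^s(\mathbb{T}^3))$. Then the kinetic energy is conserved, that is, $$\|u(t)\|_{L^2(\mathbb{T}^3)}=\|u_0\|_{L^2(\mathbb{T}^3)}\qquad\text{for a.e. } t\in[0,T].$$
   Context: $\mathbb{T}^3=\mathbb{R}^3/\mathbb{Z}^3$ is the three-dimensional torus. $(\cdot,\cdot)$ is the scalar product of $L^2(\mathbb{T}^3)$ (for vector- or matrix-valued functions as appropriate). $H$ is the closure in $L^2(\mathbb{T}^3)$ of the smooth, periodic, divergence-free, zero-mean vector fields $\mathbb{T}^3\to\mathbb{R}^3$. Weak solution: given $u_0\in H$, a measurable function $u:(0,T)\times\mathbb{T}^3\to\mathbb{R}^3$ is a weak solution to the Euler equations with initial datum $u_0$ if $u\in L^\infty(0,T;H)$ and $$\int_0^T\big[(u,\partial_t\varphi)+(u\otimes u,\nabla\varphi)\big]\,dt=-(u_0,\varphi(0))$$ for all $\varphi\in\mathcal{D}_T=\{\varphi\in C_0^\infty([0,T);C^\infty(\mathbb{T}^3)):\ \nabla\cdot\varphi=0\}$ (vector-valued test functions, compactly supported in time in $[0,T)$). Sobolev spaces: $H^s(\mathbb{T}^3)=W^{s,2}(\mathbb{T}^3)$.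 For a non-negative integer $s=k$ this is the usual Sobolev space; for $s=k+\theta$ with $k\in\mathbb{N}_0$, $\theta\in(0,1)$, its norm is $\|u\|_{W^{k,2}}+\sum_{|r|=k}[\partial_r u]_{W^{\theta,2}}$, where $[v]_{W^{\theta,2}}=\Big(\int_{\mathbb{T}^3}\int_{\mathbb{T}^3}\frac{|v(x)-v(y)|^2}{|x-y|^{3+2\theta}}\,dx\,dy\Big)^{1/2}$ (with $|x-y|$ the distance on the torus), equivalently $\|(-\Delta)^{\theta/2}v\|_{L^2}$. $L^q(0,T;X)$ denotes the Bochner space of measurable functions with $\|u(\cdot)\|_X\in L^q(0,T)$. *)

theory Defs
  imports "HOL-Analysis.Analysis"
begin

text \<open>
  Functions on the torus \<open>\<real>\<^sup>3/\<int>\<^sup>3\<close> are represented by \<open>\<int>\<^sup>3\<close>-periodic functions on \<open>\<real>\<^sup>3\<close>,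
  and integrals over the torus by Lebesgue integrals over the unit cube.  Elements of \<open>L\<^sup>2\<close> and of
  its subspaces are represented by functions, not by equivalence classes.
\<close>

definition int_lattice :: "(real^3) set" where
  "int_lattice = {z. \<forall>i. z $ i \<in> \<int>}"

definition unit_cube :: "(real^3) set" where
  "unit_cube = cbox 0 1"

definition periodic :: "(real^3 \<Rightarrow> 'a) \<Rightarrow> bool" where
  "periodic f \<longleftrightarrow> (\<forall>x. \<forall>z\<in>int_lattice. f (x + z) = f x)"

definition torus_dist :: "real^3 \<Rightarrow> real^3 \<Rightarrow> real" where
  "torus_dist x y = infdist (x - y) int_lattice"


subsection \<open>Smooth functions\<close>

text \<open>
  The domain \<open>S\<close> is meant to be open, or a convex set with nonempty interior such as
  \<open>[0,T) \<times> \<real>\<^sup>3\<close>, so that derivatives within \<open>S\<close> are unique (one-sided at the boundary).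
\<close>

primrec Ck_on :: "nat \<Rightarrow> 'a::euclidean_space set \<Rightarrow> ('a \<Rightarrow> 'b::real_normed_vector) \<Rightarrow> bool" where
  "Ck_on 0 S f \<longleftrightarrow> continuous_on S f"
| "Ck_on (Suc k) S f \<longleftrightarrow> f differentiable_on S \<and>
     (\<forall>b\<in>Basis. Ck_on k S (\<lambda>x. frechet_derivative f (at x within S) b))"

definition smooth_on :: "'a::euclidean_space set \<Rightarrow> ('a \<Rightarrow> 'b::real_normed_vector) \<Rightarrow> bool" where
  "smooth_on S f \<longleftrightarrow> (\<forall>k. Ck_on k S f)"

definition divergence :: "(real^3 \<Rightarrow> real^3) \<Rightarrow> real^3 \<Rightarrow> real" where
  "divergence f x = trace (jacobian f (at x))"

definition partial :: "3 \<Rightarrow> (real^3 \<Rightarrow> 'a::real_normed_vector) \<Rightarrow> real^3 \<Rightarrow> 'a" where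
  "partial i f x = frechet_derivative f (at x) (axis i 1)"

definition mpartial :: "nat^3 \<Rightarrow> (real^3 \<Rightarrow> 'a::real_normed_vector) \<Rightarrow> real^3 \<Rightarrow> 'a" where
  "mpartial r f = (partial 1 ^^ (r $ 1)) ((partial 2 ^^ (r $ 2)) ((partial 3 ^^ (r $ 3)) f))"

definition mi_order :: "nat^3 \<Rightarrow> nat" where
  "mi_order r = (\<Sum>i\<in>UNIV. r $ i)"


subsection \<open>Square-integrable functions and the space H\<close>

definition L2_torus :: "(real^3 \<Rightarrow> 'a::euclidean_space) set" where
  "L2_torus = {v. periodic v \<and> v \<in> borel_measurable lebesgue \<and>
     integrable (lebesgue_on unit_cube) (\<lambda>x. (norm (v x))\<^sup>2)}"

definition L2_inner :: "(real^3 \<Rightarrow> 'a::euclidean_space) \<Rightarrow> (real^3 \<Rightarrow> 'a) \<Rightarrow> real" where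
  "L2_inner v w = (LINT x|lebesgue_on unit_cube. v x \<bullet> w x)"

definition L2_norm :: "(real^3 \<Rightarrow> 'a::euclidean_space) \<Rightarrow> real" where
  "L2_norm v = sqrt (L2_inner v v)"

definition smooth_solenoidal :: "(real^3 \<Rightarrow> real^3) set" where
  "smooth_solenoidal = {v. periodic v \<and> smooth_on UNIV v \<and> (\<forall>x. divergence v x = 0) \<and>
     (LINT x|lebesgue_on unit_cube. v x) = 0}"

definition H_space :: "(real^3 \<Rightarrow> real^3) set" where
  "H_space = {v \<in> L2_torus. \<forall>\<epsilon>>0. \<exists>w\<in>smooth_solenoidal. L2_norm (\<lambda>x. v x - w x) < \<epsilon>}"


subsection \<open>Sobolev spaces\<close>

definition is_weak_partial ::
    "nat^3 \<Rightarrow> (real^3 \<Rightarrow> 'a::euclidean_space) \<Rightarrow> (real^3 \<Rightarrow> 'a) \<Rightarrow> bool" where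
  "is_weak_partial r v w \<longleftrightarrow> w \<in> L2_torus \<and>
     (\<forall>\<psi> :: real^3 \<Rightarrow> real. periodic \<psi> \<and> smooth_on UNIV \<psi> \<longrightarrow>
        (LINT x|lebesgue_on unit_cube. mpartial r \<psi> x *\<^sub>R v x) =
        (-1) ^ mi_order r *\<^sub>R (LINT x|lebesgue_on unit_cube. \<psi> x *\<^sub>R w x))"

text \<open>The weak derivative is determined up to null sets; an arbitrary representative is chosen.\<close>

definition weak_partial ::
    "nat^3 \<Rightarrow> (real^3 \<Rightarrow> 'a::euclidean_space) \<Rightarrow> real^3 \<Rightarrow> 'a" where
  "weak_partial r v = (SOME w. is_weak_partial r v w)"

definition Wk2 :: "nat \<Rightarrow> (real^3 \<Rightarrow> 'a::euclidean_space) set" where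
  "Wk2 k = {v \<in> L2_torus. \<forall>r. mi_order r \<le> k \<longrightarrow> (\<exists>w. is_weak_partial r v w)}"

definition Wk2_norm :: "nat \<Rightarrow> (real^3 \<Rightarrow> 'a::euclidean_space) \<Rightarrow> real" where
  "Wk2_norm k v = sqrt (\<Sum>r | mi_order r \<le> k. (L2_norm (weak_partial r v))\<^sup>2)"

definition gagliardo_integrand ::
    "real \<Rightarrow> (real^3 \<Rightarrow> 'a::euclidean_space) \<Rightarrow> (real^3) \<times> (real^3) \<Rightarrow> real" where
  "gagliardo_integrand \<theta> v =
     (\<lambda>(x, y). (norm (v x - v y))\<^sup>2 / torus_dist x y powr (3 + 2 * \<theta>))"

definition gagliardo_seminorm :: "real \<Rightarrow> (real^3 \<Rightarrow> 'a::euclidean_space) \<Rightarrow> real" where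
  "gagliardo_seminorm \<theta> v =
     sqrt (LINT z|lebesgue_on (unit_cube \<times> unit_cube). gagliardo_integrand \<theta> v z)"

text \<open>
  \<open>H\<^sup>s\<close> for \<open>s \<ge> 0\<close>, with \<open>s = k + \<theta>\<close>, \<open>k = \<lfloor>s\<rfloor>\<close> and \<open>\<theta> = frac s\<close>; the Gagliardo part is present
  only for non-integer \<open>s\<close>.
\<close>

definition Hs :: "real \<Rightarrow> (real^3 \<Rightarrow> 'a::euclidean_space) set" where
  "Hs s = {v \<in> Wk2 (nat \<lfloor>s\<rfloor>). frac s \<noteq> 0 \<longrightarrow>
     (\<forall>r. mi_order r = nat \<lfloor>s\<rfloor> \<longrightarrow>
        integrable (lebesgue_on (unit_cube \<times> unit_cube))
          (gagliardo_integrand (frac s) (weak_partial r v)))}"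

definition Hs_norm :: "real \<Rightarrow> (real^3 \<Rightarrow> 'a::euclidean_space) \<Rightarrow> real" where
  "Hs_norm s v = Wk2_norm (nat \<lfloor>s\<rfloor>) v +
     (if frac s = 0 then 0
      else \<Sum>r | mi_order r = nat \<lfloor>s\<rfloor>. gagliardo_seminorm (frac s) (weak_partial r v))"


subsection \<open>Time-dependent vector fields\<close>

definition measurable_field :: "real \<Rightarrow> (real \<Rightarrow> real^3 \<Rightarrow> real^3) \<Rightarrow> bool" where
  "measurable_field T u \<longleftrightarrow> (\<forall>t\<in>{0<..<T}. periodic (u t)) \<and>
     (\<lambda>(t, x). u t x) \<in> borel_measurable (lebesgue_on ({0<..<T} \<times> UNIV))"

text \<open>
  The classes \<open>L\<^sup>q(0,T;X)\<close> for real \<open>q\<close>, and \<open>L\<^sup>\<infinity>(0,T;X)\<close>, of measurable fields, where \<open>X\<close> is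
  given by its set of elements and its norm.
\<close>

definition Lq_time :: "real \<Rightarrow> real \<Rightarrow> (real^3 \<Rightarrow> real^3) set \<Rightarrow> ((real^3 \<Rightarrow> real^3) \<Rightarrow> real)
    \<Rightarrow> (real \<Rightarrow> real^3 \<Rightarrow> real^3) set" where
  "Lq_time q T X nrm = {u. measurable_field T u \<and>
     (AE t in lebesgue_on {0<..<T}. u t \<in> X) \<and>
     integrable (lebesgue_on {0<..<T}) (\<lambda>t. nrm (u t) powr q)}"

definition Linf_time :: "real \<Rightarrow> (real^3 \<Rightarrow> real^3) set \<Rightarrow> ((real^3 \<Rightarrow> real^3) \<Rightarrow> real)
    \<Rightarrow> (real \<Rightarrow> real^3 \<Rightarrow> real^3) set" where
  "Linf_time T X nrm = {u. measurable_field T u \<and>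
     (AE t in lebesgue_on {0<..<T}. u t \<in> X) \<and>
     (\<exists>C. AE t in lebesgue_on {0<..<T}. nrm (u t) \<le> C)}"


subsection \<open>Weak solutions of the Euler equations\<close>

text \<open>
  Smoothness of a map from \<open>[0,T)\<close> into the space of smooth periodic fields is joint smoothness in
  \<open>(t,x)\<close>, up to and including \<open>t = 0\<close>.
\<close>

definition test_fields :: "real \<Rightarrow> (real \<Rightarrow> real^3 \<Rightarrow> real^3) set" where
  "test_fields T = {\<phi>.
     (\<forall>t\<in>{0..<T}. periodic (\<phi> t)) \<and>
     smooth_on ({0..<T} \<times> UNIV) (\<lambda>(t, x). \<phi> t x) \<and>
     (\<exists>K. compact K \<and> K \<subseteq> {0..<T} \<and> (\<forall>t\<in>{0..<T} - K. \<forall>x. \<phi> t x = 0)) \<and>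
     (\<forall>t\<in>{0..<T}. \<forall>x. divergence (\<phi> t) x = 0)}"

definition time_deriv :: "(real \<Rightarrow> real^3 \<Rightarrow> real^3) \<Rightarrow> real \<Rightarrow> real^3 \<Rightarrow> real^3" where
  "time_deriv \<phi> t x = vector_derivative (\<lambda>\<tau>. \<phi> \<tau> x) (at t)"

definition outer :: "real^3 \<Rightarrow> real^3 \<Rightarrow> real^3^3" where
  "outer a b = (\<chi> i j. a $ i * b $ j)"

text \<open>The inner product on \<open>real^3^3\<close> is the Frobenius product of matrices.\<close>

definition euler_weak_solution ::
    "real \<Rightarrow> (real^3 \<Rightarrow> real^3) \<Rightarrow> (real \<Rightarrow> real^3 \<Rightarrow> real^3) \<Rightarrow> bool" where
  "euler_weak_solution T u0 u \<longleftrightarrow> u \<in> Linf_time T H_space L2_norm \<and>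
     (\<forall>\<phi>\<in>test_fields T.
        (LINT t|lebesgue_on {0<..<T}.
            L2_inner (u t) (time_deriv \<phi> t) +
            L2_inner (\<lambda>x. outer (u t x) (u t x)) (\<lambda>x. jacobian (\<phi> t) (at x)))
        = - L2_inner u0 (\<phi> 0))"

end

theory Submission
  imports Defs
begin

text \<open>The proof follows the energy of the Fourier modes \<open>u\<^sub>k\<close>, \<open>k \<in> \<int>\<^sup>3\<close>.  Testing the equation with plane waves
  that are polarised orthogonally to \<open>k\<close> shows that \<open>|u\<^sub>k|\<^sup>2\<close> is, up to a null set of times, the primitive of
  a bounded function with initial value \<open>|u\<^sub>0\<^sub>k|\<^sup>2\<close> (\<open>mode_identity\<close>, \<open>mode_energy\<close>).  Multiplying by the cutoff
  \<open>M(k) = max 0 (1 - |k| / (N + 1))\<close> and summing, the change in time of the truncated energy is the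
  integral of \<open>4 \<pi>\<close> times the imaginary part of the flux
  \<open>\<Sum>\<^sub>k\<^sub>m M(k) (k \<bullet> u\<^sub>m) (u\<^sub>k\<^sub>-\<^sub>m \<bullet> cnj u\<^sub>k)\<close> (\<open>truncated_energy_identity\<close>).  By Parseval's identity the truncated
  energy tends to \<open>\<parallel>u(t)\<parallel>\<^sup>2\<close> as \<open>N \<rightarrow> \<infinity>\<close>, so it remains to show that the time integral of the flux
  tends to zero.

  The involution \<open>(k, m) \<mapsto> (k - m, -m)\<close> conjugates the factor of \<open>M(k)\<close>, because the coefficients of a real
  solenoidal field satisfy \<open>u\<^sub>-\<^sub>m = cnj u\<^sub>m\<close> and \<open>m \<bullet> u\<^sub>m = 0\<close>.  Hence the imaginary part only involves
  \<open>M(k) - M(k - m)\<close>.  As moreover \<open>k \<bullet> u\<^sub>m = (k - m) \<bullet> u\<^sub>m\<close>, its terms are bounded, uniformly in \<open>N\<close>, by a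
  constant times \<open>min(|m|, |k|, |k - m|) |u\<^sub>m| |u\<^sub>k| |u\<^sub>k\<^sub>-\<^sub>m|\<close>, and each term tends to zero.  The sum of these
  bounds is at most a constant times the third power of the \<open>H\<^sup>5\<^sup>/\<^sup>6\<close> norm (\<open>triad_sum_le\<close>).  Indeed, put
  \<open>b\<^sub>k = |k|\<^sup>5\<^sup>/\<^sup>6 |u\<^sub>k|\<close>.  Where \<open>m\<close> is the smallest frequency the summand is at most
  \<open>2 |k|\<^sup>-\<^sup>3\<^sup>/\<^sup>2 b\<^sub>m b\<^sub>k b\<^sub>k\<^sub>-\<^sub>m\<close>, and the Cauchy-Schwarz inequality for the factors \<open>b\<^sub>m b\<^sub>k\<^sub>-\<^sub>m\<close> and
  \<open>|k|\<^sup>-\<^sup>3\<^sup>/\<^sup>2 b\<^sub>k\<close> suffices, since there are only \<open>O(|k|\<^sup>3)\<close> lattice points \<open>m\<close> with \<open>|m| \<le> |k|\<close>; the other two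
  cases are alike.  So the flux tends to zero at almost every time and is dominated by the third power of
  the \<open>H\<^sup>5\<^sup>/\<^sup>6\<close> norm (\<open>energy_flux_bound_and_limit\<close>).

  Finally, interpolation between \<open>L\<^sup>2\<close> and \<open>H\<^sup>s\<close> bounds that third power by the \<open>L\<^sup>2\<close> norm, which is bounded in
  time, and the power \<open>5/(2s)\<close> of the \<open>H\<^sup>s\<close> norm (\<open>critical_sum_bound\<close>, \<open>critical_cubed_bound\<close>), which is
  integrable by hypothesis; dominated convergence in time concludes.  The translation of the \<open>H\<^sup>s\<close> norm
  into Fourier coefficients (\<open>Hs_fourier\<close>) rests on Bessel's inequality for the increments
  \<open>w(x + h) - w(x)\<close>.\<close>

section \<open>The torus as a measure space\<close>

text \<open>Lebesgue measure on the closed unit cube; integrals of periodic functions with respect to it are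
  integrals over the torus.\<close>

abbreviation torus :: "(real^3) measure" where
  "torus \<equiv> lebesgue_on unit_cube"

text \<open>The representative of a point in the half-open unit cube, a fundamental domain of \<open>\<int>\<^sup>3\<close>.\<close>

definition frac_part :: "real^3 \<Rightarrow> real^3" where
  "frac_part x = (\<chi> i. frac (x $ i))"

definition half_open_cube :: "(real^3) set" where
  "half_open_cube = {x. \<forall>i. 0 \<le> x $ i \<and> x $ i < 1}"

lemma int_lattice_add: "a \<in> int_lattice \<Longrightarrow> b \<in> int_lattice \<Longrightarrow> a + b \<in> int_lattice"
  and int_lattice_diff: "a \<in> int_lattice \<Longrightarrow> b \<in> int_lattice \<Longrightarrow> a - b \<in> int_lattice"
  and int_lattice_uminus: "a \<in> int_lattice \<Longrightarrow> - a \<in> int_lattice"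
  by (auto simp: int_lattice_def)

lemmas int_lattice_closed = int_lattice_add int_lattice_diff int_lattice_uminus

lemma zero_int_lattice [simp]: "0 \<in> int_lattice"
  by (simp add: int_lattice_def)

lemma periodicD: "periodic f \<Longrightarrow> z \<in> int_lattice \<Longrightarrow> f (x + z) = f x"
  by (simp add: periodic_def)

lemma frac_part_diff_lattice: "x - frac_part x \<in> int_lattice"
  by (simp add: int_lattice_def frac_part_def frac_def)

lemma periodic_frac_part: "periodic f \<Longrightarrow> f (frac_part x) = f x"
  using periodicD[of f "x - frac_part x" "frac_part x"] frac_part_diff_lattice by simp

lemma frac_part_in_cube: "frac_part x \<in> half_open_cube"
  by (simp add: half_open_cube_def frac_part_def frac_lt_1)

lemma frac_part_add_lattice: "z \<in> int_lattice \<Longrightarrow> frac_part (x + z) = frac_part x"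
  unfolding frac_part_def int_lattice_def vec_eq_iff
  by (auto simp: frac_def elim!: Ints_cases)

lemma frac_part_ident: "x \<in> half_open_cube \<Longrightarrow> frac_part x = x"
  unfolding half_open_cube_def frac_part_def vec_eq_iff
  by (auto simp: frac_eq)

lemma unique_lattice_shift:
  assumes "x + z \<in> half_open_cube" "x + z' \<in> half_open_cube" "z \<in> int_lattice" "z' \<in> int_lattice"
  shows "z = z'"
proof -
  have "x + z = frac_part x" "x + z' = frac_part x"
    using assms frac_part_ident[of "x + z"] frac_part_ident[of "x + z'"]
    by (simp_all add: frac_part_add_lattice)
  then have "x + z = x + z'" by (rule trans[OF _ sym])
  then show ?thesis by (simp only: add_left_cancel)
qed

lemma half_open_cube_subset: "half_open_cube \<subseteq> unit_cube"
  by (auto simp: half_open_cube_def unit_cube_def cbox_def Basis_vec_def inner_axis intro: less_imp_le)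

lemma half_open_cube_borel [measurable]: "half_open_cube \<in> sets borel"
  unfolding half_open_cube_def by measurable

lemma unit_cube_borel [measurable]: "unit_cube \<in> sets borel"
  by (simp add: unit_cube_def)

lemma frac_part_borel [measurable]: "frac_part \<in> borel_measurable borel"
proof -
  have "(\<lambda>x::real^3. frac (x $ i)) \<in> borel_measurable borel" for i
    unfolding frac_def by measurable
  then show ?thesis
    by (subst borel_measurable_euclidean_space) (auto simp: frac_part_def Basis_vec_def inner_axis)
qed

lemma countable_int_lattice: "countable int_lattice"
proof -
  have "int_lattice \<subseteq> range (\<lambda>f::int^3. (\<chi> i. real_of_int (f $ i)))"
  proof
    fix z assume "z \<in> int_lattice"
    then have "z = (\<chi> i. real_of_int ((\<chi> i. \<lfloor>z $ i\<rfloor>) $ i))"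
      by (auto simp: int_lattice_def vec_eq_iff)
    then show "z \<in> range (\<lambda>f::int^3. (\<chi> i. real_of_int (f $ i)))" by blast
  qed
  moreover have "countable (UNIV :: (int^3) set)"
  proof -
    have "inj (\<lambda>v::int^3. (v$1, v$2, v$3))"
      by (auto simp: inj_def vec_eq_iff forall_3)
    then show ?thesis by (metis countableI_type countable_image_inj_on subset_UNIV countable_subset)
  qed
  ultimately show ?thesis by (meson countable_image countable_subset)
qed

lemma emeasure_lborel_shift:
  fixes S :: "(real^3) set"
  assumes [measurable]: "S \<in> sets borel"
  shows "emeasure lborel {x. x + c \<in> S} = emeasure lborel S"
proof -
  have "emeasure lborel S = emeasure (distr lborel borel ((+) c)) S"
    by (metis lborel_distr_plus)
  also have "\<dots> = emeasure lborel {x. x + c \<in> S}"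
    by (subst emeasure_distr) (auto simp: vimage_def add.commute)
  finally show ?thesis by simp
qed

lemma AE_half_open_cube: "AE x in lebesgue. x \<in> unit_cube \<longrightarrow> x \<in> half_open_cube"
proof -
  have "negligible (unit_cube - half_open_cube)"
  proof (rule negligible_subset)
    have "negligible (frontier (cbox 0 (1::real^3)))"
      by (rule negligible_convex_frontier) (rule convex_box)
    moreover have "cbox 0 (1::real^3) - box 0 1 = frontier (cbox 0 1)"
      by (simp add: frontier_def interior_cbox)
    ultimately show "negligible (cbox 0 (1::real^3) - box 0 1)" by simp
    show "unit_cube - half_open_cube \<subseteq> cbox 0 1 - box 0 1"
      by (auto simp: half_open_cube_def unit_cube_def box_def cbox_def Basis_vec_def inner_axis intro: less_imp_le)
  qed
  then have "AE x in lebesgue. x \<notin> unit_cube - half_open_cube"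
    by (metis AE_not_in negligible_iff_null_sets)
  then show ?thesis by eventually_elim auto
qed

text \<open>Lebesgue measure of a periodic Borel set within a fundamental domain does not change when the
  domain is translated: both translates are cut into the same countably many pieces.\<close>

lemma emeasure_periodic_shift:
  assumes B [measurable]: "B \<in> sets borel" and per: "\<And>x z. z \<in> int_lattice \<Longrightarrow> x + z \<in> B \<longleftrightarrow> x \<in> B"
  shows "emeasure lborel {x \<in> half_open_cube. x + h \<in> B} = emeasure lborel (half_open_cube \<inter> B)"
proof -
  let ?Q = half_open_cube
  let ?X = "\<lambda>z. {x. x - h \<in> ?Q \<and> x - z \<in> ?Q \<and> x \<in> B}"
  let ?Y = "\<lambda>z. {x. x + (z - h) \<in> ?Q \<and> x \<in> ?Q \<and> x \<in> B}"
  have Qm: "{x. x + c \<in> ?Q} \<in> sets borel" for c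
    unfolding half_open_cube_def by measurable
  have X: "?X z = {x. x + (- h) \<in> ?Q} \<inter> {x. x + (- z) \<in> ?Q} \<inter> B" for z by auto
  have Xm: "?X z \<in> sets borel" for z
    unfolding X by (intro sets.Int Qm B)
  have Y: "?Y z = {x. x + (z - h) \<in> ?Q} \<inter> ?Q \<inter> B" for z by auto
  have Ym: "?Y z \<in> sets borel" for z
    unfolding Y by (intro sets.Int Qm B half_open_cube_borel)
  have Zm: "{x. x - h \<in> ?Q \<and> x \<in> B} \<in> sets borel"
    using sets.Int[OF Qm[of "- h"] B] by (simp add: Int_def)
  have "emeasure lborel {x \<in> ?Q. x + h \<in> B} = emeasure lborel {x. x + h \<in> {x. x - h \<in> ?Q \<and> x \<in> B}}"
    by simp
  also have "\<dots> = emeasure lborel {x. x - h \<in> ?Q \<and> x \<in> B}"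
    by (rule emeasure_lborel_shift[OF Zm])
  also have "{x. x - h \<in> ?Q \<and> x \<in> B} = (\<Union>z\<in>int_lattice. ?X z)"
  proof -
    have "\<exists>z\<in>int_lattice. x - z \<in> ?Q" for x
      by (rule bexI[OF _ frac_part_diff_lattice[of x]]) (simp add: frac_part_in_cube)
    then show ?thesis by blast
  qed
  also have "emeasure lborel \<dots> = (\<integral>\<^sup>+z. emeasure lborel (?X z) \<partial>count_space int_lattice)"
  proof (rule emeasure_UN_countable)
    show "disjoint_family_on ?X int_lattice"
      unfolding disjoint_family_on_def
    proof (intro ballI impI, rule ccontr)
      fix m n assume mn: "m \<in> int_lattice" "n \<in> int_lattice" "m \<noteq> n" "?X m \<inter> ?X n \<noteq> {}"
      then obtain x where "x + (-m) \<in> ?Q" "x + (-n) \<in> ?Q" by auto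
      then have "-m = -n" using mn by (intro unique_lattice_shift int_lattice_closed)
      then show False using mn by simp
    qed
  qed (use Xm in \<open>auto simp: countable_int_lattice\<close>)
  also have "\<dots> = (\<integral>\<^sup>+z. emeasure lborel (?Y z) \<partial>count_space int_lattice)"
  proof (rule nn_integral_cong)
    fix z assume "z \<in> space (count_space int_lattice)"
    then have z: "z \<in> int_lattice" by simp
    have "emeasure lborel (?X z) = emeasure lborel {x. x + z \<in> ?X z}"
      by (rule emeasure_lborel_shift[OF Xm, symmetric])
    also have "{x. x + z \<in> ?X z} = ?Y z"
      using per[OF z] by (auto simp: algebra_simps)
    finally show "emeasure lborel (?X z) = emeasure lborel (?Y z)" .
  qed
  also have "\<dots> = emeasure lborel (\<Union>z\<in>int_lattice. ?Y z)"
  proof (rule emeasure_UN_countable[symmetric])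
    show "disjoint_family_on ?Y int_lattice"
      unfolding disjoint_family_on_def
    proof (intro ballI impI, rule ccontr)
      fix m n assume mn: "m \<in> int_lattice" "n \<in> int_lattice" "m \<noteq> n" "?Y m \<inter> ?Y n \<noteq> {}"
      then obtain x where "(x - h) + m \<in> ?Q" "(x - h) + n \<in> ?Q" by (auto simp: algebra_simps)
      then have "m = n" using mn by (intro unique_lattice_shift)
      then show False using mn by simp
    qed
  qed (use Ym in \<open>auto simp: countable_int_lattice\<close>)
  also have "(\<Union>z\<in>int_lattice. ?Y z) = ?Q \<inter> B"
  proof -
    have "\<exists>z\<in>int_lattice. x + (z - h) \<in> ?Q" for x
    proof
      show "frac_part (x - h) - (x - h) \<in> int_lattice"
        using int_lattice_closed(3)[OF frac_part_diff_lattice[of "x - h"]] by simp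
      show "x + (frac_part (x - h) - (x - h) - h) \<in> ?Q"
        using frac_part_in_cube[of "x - h"] by simp
    qed
    then show ?thesis by auto
  qed
  finally show ?thesis .
qed

text \<open>The same integrals on a measure space whose measurable sets are Borel, which is what Fubini's
  theorem and the measurability of translations require.\<close>

definition torus_borel :: "(real^3) measure" where
  "torus_borel = restrict_space lborel half_open_cube"

lemma space_torus_borel: "space torus_borel = half_open_cube"
  by (simp add: torus_borel_def)

lemma borel_measurable_torus_borel [measurable_dest]:
  "f \<in> borel_measurable borel \<Longrightarrow> f \<in> borel_measurable torus_borel"
  by (simp add: torus_borel_def measurable_restrict_space1)

lemma frac_part_measurable_torus [measurable]: "(\<lambda>x. frac_part (x + h)) \<in> torus_borel \<rightarrow>\<^sub>M torus_borel"
proof -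
  have "(\<lambda>x. frac_part (x + h)) \<in> lborel \<rightarrow>\<^sub>M lborel" by simp
  then show ?thesis unfolding torus_borel_def
    by (intro measurable_restrict_space3) (auto simp: frac_part_in_cube)
qed

text \<open>Translations of the torus preserve the measure.\<close>

lemma distr_torus_shift: "distr torus_borel torus_borel (\<lambda>x. frac_part (x + h)) = torus_borel"
proof (rule measure_eqI)
  fix A assume "A \<in> sets (distr torus_borel torus_borel (\<lambda>x. frac_part (x + h)))"
  then have A: "A \<subseteq> half_open_cube" "A \<in> sets borel" "A \<in> sets torus_borel"
    by (auto simp: torus_borel_def sets_restrict_space)
  note [measurable] = A(2)
  have "emeasure (distr torus_borel torus_borel (\<lambda>x. frac_part (x + h))) A
      = emeasure torus_borel {x \<in> half_open_cube. frac_part (x + h) \<in> A}"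
    using A by (subst emeasure_distr) (auto simp: space_torus_borel vimage_def Int_def conj_commute)
  also have "\<dots> = emeasure lborel {x \<in> half_open_cube. x + h \<in> {y. frac_part y \<in> A}}"
    unfolding torus_borel_def by (subst emeasure_restrict_space) auto
  also have "\<dots> = emeasure lborel (half_open_cube \<inter> {y. frac_part y \<in> A})"
    by (rule emeasure_periodic_shift) (auto simp: frac_part_add_lattice)
  also have "half_open_cube \<inter> {y. frac_part y \<in> A} = A"
    using A(1) frac_part_ident by auto
  also have "emeasure lborel A = emeasure torus_borel A"
    unfolding torus_borel_def using A by (subst emeasure_restrict_space) auto
  finally show "emeasure (distr torus_borel torus_borel (\<lambda>x. frac_part (x + h))) A = emeasure torus_borel A" .
qed simp

lemma integral_torus_borel:
  fixes f :: "real^3 \<Rightarrow> 'b::{banach, second_countable_topology}"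
  assumes [measurable]: "f \<in> borel_measurable borel"
  shows "(LINT x|torus. f x) = (LINT x|torus_borel. f x)"
    and "integrable torus f \<longleftrightarrow> integrable torus_borel f"
proof -
  have ae: "AE x in lebesgue. indicator unit_cube x *\<^sub>R f x = indicator half_open_cube x *\<^sub>R f x"
    using AE_half_open_cube by eventually_elim (use half_open_cube_subset in \<open>auto simp: indicator_def\<close>)
  have m: "(\<lambda>x. indicator S x *\<^sub>R f x) \<in> borel_measurable lborel" if [measurable]: "S \<in> sets borel" for S
    by measurable
  have "(LINT x|torus. f x) = (LINT x|lebesgue. indicator unit_cube x *\<^sub>R f x)"
    by (subst integral_restrict_space) auto
  also have "\<dots> = (LINT x|lebesgue. indicator half_open_cube x *\<^sub>R f x)"
    using ae m by (intro integral_cong_AE measurable_completion) auto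
  also have "\<dots> = (LINT x|lborel. indicator half_open_cube x *\<^sub>R f x)"
    by (rule integral_completion) (use m in auto)
  also have "\<dots> = (LINT x|torus_borel. f x)"
    unfolding torus_borel_def by (subst integral_restrict_space) auto
  finally show "(LINT x|torus. f x) = (LINT x|torus_borel. f x)" .
  have "integrable torus f \<longleftrightarrow> integrable lebesgue (\<lambda>x. indicator unit_cube x *\<^sub>R f x)"
    by (subst integrable_restrict_space) auto
  also have "\<dots> \<longleftrightarrow> integrable lebesgue (\<lambda>x. indicator half_open_cube x *\<^sub>R f x)"
    using ae m by (intro integrable_cong_AE measurable_completion) auto
  also have "\<dots> \<longleftrightarrow> integrable lborel (\<lambda>x. indicator half_open_cube x *\<^sub>R f x)"
    by (rule integrable_completion) (use m in auto)
  also have "\<dots> \<longleftrightarrow> integrable torus_borel f"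
    unfolding torus_borel_def by (subst integrable_restrict_space) auto
  finally show "integrable torus f \<longleftrightarrow> integrable torus_borel f" .
qed

lemma nn_integral_torus_borel:
  "(\<integral>\<^sup>+x. f x \<partial>torus) = (\<integral>\<^sup>+x. f x \<partial>torus_borel)"
proof -
  have "(\<integral>\<^sup>+x. f x \<partial>torus) = (\<integral>\<^sup>+x. f x * indicator unit_cube x \<partial>lebesgue)"
    by (subst nn_integral_restrict_space) auto
  also have "\<dots> = (\<integral>\<^sup>+x. f x * indicator half_open_cube x \<partial>lebesgue)"
  proof (rule nn_integral_cong_AE)
    show "AE x in lebesgue. f x * indicator unit_cube x = f x * indicator half_open_cube x"
      using AE_half_open_cube
      by eventually_elim (use half_open_cube_subset in \<open>auto simp: indicator_def\<close>)
  qed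
  also have "\<dots> = (\<integral>\<^sup>+x. f x * indicator half_open_cube x \<partial>lborel)"
    by (rule nn_integral_completion)
  also have "\<dots> = (\<integral>\<^sup>+x. f x \<partial>torus_borel)"
    unfolding torus_borel_def by (subst nn_integral_restrict_space) auto
  finally show ?thesis .
qed

lemma nn_integral_torus_shift:
  assumes [measurable]: "f \<in> borel_measurable borel" and "periodic f"
  shows "(\<integral>\<^sup>+x. f (x + h) \<partial>torus_borel) = (\<integral>\<^sup>+x. f x \<partial>torus_borel)"
proof -
  have "(\<integral>\<^sup>+x. f x \<partial>torus_borel) = (\<integral>\<^sup>+x. f x \<partial>distr torus_borel torus_borel (\<lambda>x. frac_part (x + h)))"
    by (simp add: distr_torus_shift)
  also have "\<dots> = (\<integral>\<^sup>+x. f (frac_part (x + h)) \<partial>torus_borel)"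
    by (rule nn_integral_distr) auto
  finally show ?thesis using assms(2) by (simp add: periodic_frac_part)
qed

lemma integral_torus_shift:
  fixes f :: "real^3 \<Rightarrow> 'b::{banach, second_countable_topology}"
  assumes [measurable]: "f \<in> borel_measurable borel" and "periodic f"
  shows "(LINT x|torus. f (x + h)) = (LINT x|torus. f x)"
proof -
  have "(LINT x|torus_borel. f x) = (LINT x|distr torus_borel torus_borel (\<lambda>x. frac_part (x + h)). f x)"
    by (simp add: distr_torus_shift)
  also have "\<dots> = (LINT x|torus_borel. f (frac_part (x + h)))"
    by (rule integral_distr) auto
  finally show ?thesis using assms(2) by (simp add: periodic_frac_part integral_torus_borel)
qed

lemma emeasure_torus: "emeasure torus unit_cube = 1"
proof -
  have "(\<Prod>b\<in>Basis. (1::real^3) \<bullet> b) = 1"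
    by (rule prod.neutral) (auto simp: Basis_vec_def inner_axis)
  then have "emeasure lborel unit_cube = 1"
    unfolding unit_cube_def
    by (subst emeasure_lborel_cbox_eq) (auto simp: Basis_vec_def inner_axis)
  then show ?thesis by (simp add: emeasure_restrict_space)
qed

interpretation torus: finite_measure torus
  by standard (simp add: emeasure_torus)

lemma measure_torus [simp]: "measure torus unit_cube = 1"
  by (simp add: measure_def emeasure_torus)

section \<open>Trigonometric polynomials\<close>

text \<open>The character \<open>x \<mapsto> exp(2 \<pi> i k \<bullet> x)\<close>; it is periodic for \<open>k\<close> in the lattice.  Frequencies are vectors in
  \<open>real^3\<close>, restricted to the lattice where necessary.\<close>

definition character :: "real^3 \<Rightarrow> real^3 \<Rightarrow> complex" where
  "character k x = cis (2 * pi * (k \<bullet> x))"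

lemma inner_int_lattice: "k \<in> int_lattice \<Longrightarrow> z \<in> int_lattice \<Longrightarrow> k \<bullet> z \<in> \<int>"
  unfolding int_lattice_def inner_vec_def by (auto intro!: Ints_sum Ints_mult)

lemma cis_2pi_Ints: "n \<in> \<int> \<Longrightarrow> cis (2 * pi * n) = 1"
  by (simp add: cis_multiple_2pi)

lemma character_add: "character k (x + y) = character k x * character k y"
  by (simp add: character_def inner_add_right cis_mult distrib_left)

lemma character_mult: "character k x * character l x = character (k + l) x"
  by (simp add: character_def inner_add_left cis_mult distrib_left)

lemma cnj_character: "cnj (character k x) = character (- k) x"
  by (simp add: character_def cis_cnj)

lemma norm_character [simp]: "norm (character k x) = 1"
  by (simp add: character_def)

lemma character_0 [simp]: "character 0 x = 1"
  by (simp add: character_def)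

lemma periodic_character: "k \<in> int_lattice \<Longrightarrow> periodic (character k)"
  unfolding periodic_def character_add
  by (simp add: character_def cis_2pi_Ints inner_int_lattice)

lemma continuous_character: "continuous_on S (character k)"
  unfolding character_def by (intro continuous_intros)

lemma borel_character [measurable]: "character k \<in> borel_measurable borel"
  by (intro borel_measurable_continuous_onI continuous_character)

lemma lebesgue_on_borelI: "f \<in> borel_measurable borel \<Longrightarrow> f \<in> borel_measurable (lebesgue_on S)"
  by (intro measurable_restrict_space1 measurable_completion) simp

text \<open>Translation by \<open>k / (2 |k|\<^sup>2)\<close> changes the sign of the character with frequency \<open>k\<close>, while the
  integral over the torus is translation invariant.\<close>

lemma integral_character:
  assumes "k \<in> int_lattice"
  shows "(LINT x|torus. character k x) = (if k = 0 then 1 else 0)"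
proof (cases "k = 0")
  case False
  let ?h = "(1 / (2 * (k \<bullet> k))) *\<^sub>R k"
  have kk: "k \<bullet> k \<noteq> 0" using False by simp
  have "k \<bullet> ?h = 1 / 2"
  proof -
    have "1 / (2 * a) * a = 1 / 2" if "a \<noteq> 0" for a :: real using that by simp
    from this[OF kk] show ?thesis unfolding inner_scaleR_right .
  qed
  then have h: "character k ?h = -1" unfolding character_def by (simp only:) (simp add: cis_pi)
  have "(LINT x|torus. character k x) = (LINT x|torus. character k (x + ?h))"
    by (rule integral_torus_shift[symmetric]) (auto intro: periodic_character assms)
  also have "\<dots> = - (LINT x|torus. character k x)"
    by (simp add: character_add h)
  finally show ?thesis using False by simp
qed simp

text \<open>Trigonometric polynomials with complex coefficients.\<close>

inductive_set trig_poly :: "(real^3 \<Rightarrow> complex) set" where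
  character: "k \<in> int_lattice \<Longrightarrow> (\<lambda>x. c * character k x) \<in> trig_poly"
| add: "f \<in> trig_poly \<Longrightarrow> g \<in> trig_poly \<Longrightarrow> (\<lambda>x. f x + g x) \<in> trig_poly"

lemma trig_poly_const: "(\<lambda>x. c) \<in> trig_poly"
  using trig_poly.character[of 0 c] by simp

lemma trig_poly_mult_character:
  assumes "k \<in> int_lattice" "g \<in> trig_poly"
  shows "(\<lambda>x. (c * character k x) * g x) \<in> trig_poly"
  using assms(2)
proof induction
  case (character l d)
  have "(\<lambda>x. (c * character k x) * (d * character l x)) = (\<lambda>x. (c * d) * character (k + l) x)"
    by (simp add: character_mult[symmetric] mult_ac)
  then show ?case
    using trig_poly.character[OF int_lattice_closed(1)[OF assms(1) character]] by metis
next
  case (add f g)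
  then show ?case by (simp add: distrib_left trig_poly.add)
qed

lemma trig_poly_mult:
  assumes "f \<in> trig_poly" "g \<in> trig_poly"
  shows "(\<lambda>x. f x * g x) \<in> trig_poly"
  using assms
proof induction
  case (character k c)
  then show ?case by (rule trig_poly_mult_character)
next
  case (add f1 f2)
  then show ?case by (simp add: distrib_right trig_poly.add)
qed

lemma trig_poly_expansion:
  assumes "f \<in> trig_poly"
  shows "\<exists>K c. finite K \<and> K \<subseteq> int_lattice \<and> (\<forall>x. f x = (\<Sum>k\<in>K. c k * character k x))"
  using assms
proof induction
  case (character k c)
  then show ?case by (intro exI[of _ "{k}"] exI[of _ "\<lambda>_. c"]) simp
next
  case (add f g)
  then obtain K c L d where K: "finite K" "K \<subseteq> int_lattice" "\<forall>x. f x = (\<Sum>k\<in>K. c k * character k x)"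
    and L: "finite L" "L \<subseteq> int_lattice" "\<forall>x. g x = (\<Sum>k\<in>L. d k * character k x)" by blast
  have ext: "(\<Sum>k\<in>K. c k * character k x) = (\<Sum>k\<in>K\<union>L. (if k \<in> K then c k else 0) * character k x)"
    "(\<Sum>k\<in>L. d k * character k x) = (\<Sum>k\<in>K\<union>L. (if k \<in> L then d k else 0) * character k x)" for x
    using K(1) L(1) by (intro sum.mono_neutral_cong_left; force)+
  show ?case
  proof (intro exI conjI allI)
    show "finite (K \<union> L)" "K \<union> L \<subseteq> int_lattice" using K L by auto
    show "f x + g x = (\<Sum>k\<in>K\<union>L. ((if k \<in> K then c k else 0) + (if k \<in> L then d k else 0)) * character k x)" for x
      unfolding distrib_right sum.distrib using K(3) L(3) ext[of x] by simp
  qed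
qed

text \<open>The torus as a compact subset of \<open>\<complex>\<^sup>3\<close>; two points have the same image exactly if they differ by a
  lattice vector.\<close>

definition torus_embedding :: "real^3 \<Rightarrow> complex^3" where
  "torus_embedding x = (\<chi> i. cis (2 * pi * (x $ i)))"

lemma continuous_torus_embedding: "continuous_on S torus_embedding"
  unfolding torus_embedding_def by (intro continuous_intros)

lemma cis_eq_imp_diff_Ints:
  assumes "cis (2 * pi * a) = cis (2 * pi * b)"
  shows "a - b \<in> \<int>"
proof -
  have "cis (2 * pi * a - 2 * pi * b) = 1"
    using assms by (simp add: cis_divide[symmetric])
  then have "cos (2 * pi * (a - b)) = 1"
    by (metis cis.simps(1) one_complex.simps(1) right_diff_distrib)
  then obtain n :: int where "2 * pi * (a - b) = of_int n * 2 * pi"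
    unfolding cos_one_2pi_int by auto
  then have "a - b = of_int n" by simp
  then show ?thesis by simp
qed

lemma torus_embedding_eq_iff: "torus_embedding x = torus_embedding y \<longleftrightarrow> x - y \<in> int_lattice"
proof
  assume "torus_embedding x = torus_embedding y"
  then show "x - y \<in> int_lattice"
    by (auto simp: torus_embedding_def vec_eq_iff int_lattice_def intro: cis_eq_imp_diff_Ints)
next
  assume xy: "x - y \<in> int_lattice"
  have "cis (2 * pi * (x $ i)) = cis (2 * pi * (y $ i)) * cis (2 * pi * (x $ i - y $ i))" for i
    by (simp add: cis_mult distrib_left[symmetric])
  moreover have "cis (2 * pi * (x $ i - y $ i)) = 1" for i
    using xy by (intro cis_2pi_Ints) (auto simp: int_lattice_def)
  ultimately show "torus_embedding x = torus_embedding y"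
    by (simp add: torus_embedding_def vec_eq_iff)
qed

lemma compact_torus_image: "compact (range torus_embedding)"
proof -
  have "range torus_embedding = torus_embedding ` unit_cube"
  proof -
    have "torus_embedding x \<in> torus_embedding ` unit_cube" for x
    proof (rule image_eqI)
      show "torus_embedding x = torus_embedding (frac_part x)"
        by (simp add: torus_embedding_eq_iff frac_part_diff_lattice)
      show "frac_part x \<in> unit_cube" using frac_part_in_cube half_open_cube_subset by blast
    qed
    then show ?thesis by auto
  qed
  then show ?thesis
    by (simp add: compact_continuous_image continuous_torus_embedding unit_cube_def)
qed

text \<open>A continuous periodic function is a continuous function on the image of the embedding, where the
  trigonometric polynomials separate points.\<close>

lemma trig_poly_dense:
  fixes g :: "real^3 \<Rightarrow> real"
  assumes per: "periodic g" and cont: "continuous_on UNIV g" and "e > 0"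
  shows "\<exists>P\<in>trig_poly. \<forall>x. norm (of_real (g x) - P x) < e"
proof -
  let ?S = "range torus_embedding"
  define G where "G y = g (SOME x. torus_embedding x = y)" for y
  have G: "G (torus_embedding x) = g x" for x
  proof -
    have "torus_embedding (SOME x'. torus_embedding x' = torus_embedding x) = torus_embedding x"
      by (rule someI[of _ x]) simp
    then have "(SOME x'. torus_embedding x' = torus_embedding x) - x \<in> int_lattice"
      by (simp add: torus_embedding_eq_iff)
    from periodicD[OF per this, of x] show ?thesis by (simp add: G_def)
  qed
  have contG: "continuous_on ?S G"
  proof (subst continuous_on_closed_vimage)
    show "closed ?S" using compact_torus_image by (rule compact_imp_closed)
    show "\<forall>B. closed B \<longrightarrow> closed (G -` B \<inter> ?S)"
    proof (intro allI impI)
      fix B :: "real set" assume "closed B"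
      then have "closed (g -` B)" using cont by (simp add: continuous_on_closed_vimage)
      then have "compact (unit_cube \<inter> g -` B)" by (simp add: unit_cube_def compact_Int_closed)
      then have "compact (torus_embedding ` (unit_cube \<inter> g -` B))"
        by (rule compact_continuous_image[OF continuous_torus_embedding])
      moreover have "G -` B \<inter> ?S = torus_embedding ` (unit_cube \<inter> g -` B)"
      proof (intro equalityI subsetI)
        fix y assume "y \<in> G -` B \<inter> ?S"
        then obtain x where x: "y = torus_embedding x" "g x \<in> B" by (auto simp: G)
        have "frac_part x \<in> unit_cube \<inter> g -` B"
          using x per half_open_cube_subset frac_part_in_cube by (auto simp: periodic_frac_part)
        moreover have "y = torus_embedding (frac_part x)"
          by (simp add: x torus_embedding_eq_iff frac_part_diff_lattice)
        ultimately show "y \<in> torus_embedding ` (unit_cube \<inter> g -` B)" by blast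
      qed (auto simp: G)
      ultimately show "closed (G -` B \<inter> ?S)" by (simp add: compact_imp_closed)
    qed
  qed
  define R where "R = {F. continuous_on ?S F \<and> (\<exists>P\<in>trig_poly. \<forall>x. of_real (F (torus_embedding x)) = P x)}"
  have coord: "(\<lambda>y. Re (y $ i)) \<in> R" "(\<lambda>y. Im (y $ i)) \<in> R" for i
  proof -
    have l: "axis i 1 \<in> int_lattice" "- axis i 1 \<in> int_lattice" for i :: 3
      by (auto simp: int_lattice_def axis_def)
    have ch: "character (axis i 1) x = cis (2 * pi * (x $ i))" "character (- axis i 1) x = cis (- (2 * pi * (x $ i)))" for x
      by (simp_all add: character_def inner_axis')
    have c: "(\<lambda>x. a * character (axis i 1) x + b * character (- axis i 1) x) \<in> trig_poly" for a b
      by (intro trig_poly.intros l)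
    have "of_real (Re (torus_embedding x $ i)) = (1/2) * character (axis i 1) x + (1/2) * character (- axis i 1) x"
      "of_real (Im (torus_embedding x $ i)) = (-\<i>/2) * character (axis i 1) x + (\<i>/2) * character (- axis i 1) x" for x
      unfolding ch by (simp_all add: torus_embedding_def complex_eq_iff)
    then have "\<exists>P\<in>trig_poly. \<forall>x. of_real (Re (torus_embedding x $ i)) = P x"
      "\<exists>P\<in>trig_poly. \<forall>x. of_real (Im (torus_embedding x $ i)) = P x"
      by - (rule bexI[OF _ c[of "1/2" "1/2"]], simp, rule bexI[OF _ c[of "-\<i>/2" "\<i>/2"]], simp)
    then show "(\<lambda>y. Re (y $ i)) \<in> R" "(\<lambda>y. Im (y $ i)) \<in> R"
      unfolding R_def by (auto intro!: continuous_intros)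
  qed
  have ring: "function_ring_on R ?S"
  proof
    show "compact ?S" by (rule compact_torus_image)
    fix f assume f: "f \<in> R"
    then show "continuous_on ?S f" by (simp add: R_def)
    fix h assume h: "h \<in> R"
    show "(\<lambda>x. f x + h x) \<in> R"
    proof -
      from f h obtain P Q where "P \<in> trig_poly" "\<forall>x. of_real (f (torus_embedding x)) = P x"
        "Q \<in> trig_poly" "\<forall>x. of_real (h (torus_embedding x)) = Q x" unfolding R_def by blast
      then show ?thesis using f h unfolding R_def
        by (auto intro!: continuous_intros bexI[of _ "\<lambda>x. P x + Q x"] trig_poly.add)
    qed
    show "(\<lambda>x. f x * h x) \<in> R"
    proof -
      from f h obtain P Q where "P \<in> trig_poly" "\<forall>x. of_real (f (torus_embedding x)) = P x"
        "Q \<in> trig_poly" "\<forall>x. of_real (h (torus_embedding x)) = Q x" unfolding R_def by blast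
      then show ?thesis using f h unfolding R_def
        by (auto intro!: continuous_intros bexI[of _ "\<lambda>x. P x * Q x"] trig_poly_mult)
    qed
  next
    fix c :: real show "(\<lambda>_. c) \<in> R"
      unfolding R_def using trig_poly_const[of "of_real c"] by auto
  next
    fix x y :: "complex^3" assume "x \<noteq> y"
    then obtain i where "Re (x $ i) \<noteq> Re (y $ i) \<or> Im (x $ i) \<noteq> Im (y $ i)"
      by (auto simp: vec_eq_iff complex_eq_iff)
    then show "\<exists>f\<in>R. f x \<noteq> f y"
      by (elim disjE) (rule bexI[OF _ coord(1)[of i]], assumption, rule bexI[OF _ coord(2)[of i]], assumption)
  qed
  have "\<exists>F\<in>R. \<forall>y\<in>?S. \<bar>G y - F y\<bar> < e"
    by (rule function_ring_on.Stone_Weierstrass_basic[OF ring contG \<open>e > 0\<close>])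
  then obtain F where F: "F \<in> R" "\<forall>y\<in>?S. \<bar>G y - F y\<bar> < e" ..
  then obtain P where P: "P \<in> trig_poly" "\<forall>x. of_real (F (torus_embedding x)) = P x"
    using F(1) unfolding R_def by blast
  have "norm (of_real (g x) - P x) < e" for x
  proof -
    have "of_real (g x) - P x = of_real (G (torus_embedding x) - F (torus_embedding x))"
      using P(2) by (simp add: G)
    then show ?thesis using F(2) by (auto simp: norm_of_real simp del: of_real_diff)
  qed
  then show ?thesis using P by blast
qed

section \<open>Fourier coefficients and Parseval's identity\<close>

text \<open>Square integrability on the torus for complex functions, without periodicity.\<close>

definition sq_integrable :: "(real^3 \<Rightarrow> complex) \<Rightarrow> bool" where
  "sq_integrable f \<longleftrightarrow> f \<in> borel_measurable torus \<and> integrable torus (\<lambda>x. (norm (f x))\<^sup>2)"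

text \<open>The square of the \<open>L\<^sup>2\<close> norm.\<close>

definition l2sq :: "(real^3 \<Rightarrow> complex) \<Rightarrow> real" where
  "l2sq f = (LINT x|torus. (norm (f x))\<^sup>2)"

text \<open>The Fourier coefficient with frequency \<open>k\<close>.\<close>

definition fourier :: "(real^3 \<Rightarrow> complex) \<Rightarrow> real^3 \<Rightarrow> complex" where
  "fourier f k = (LINT x|torus. f x * character (- k) x)"

lemma borel_character_torus [measurable]: "character k \<in> borel_measurable torus"
  by (intro lebesgue_on_borelI borel_character)

lemma sq_integrable_bounded:
  assumes "f \<in> borel_measurable torus" "\<And>x. norm (f x) \<le> B"
  shows "sq_integrable f"
  unfolding sq_integrable_def
proof
  show "integrable torus (\<lambda>x. (norm (f x))\<^sup>2)"
    using assms by (intro torus.integrable_const_bound[where B = "B\<^sup>2"]) (auto intro!: power_mono)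
qed (rule assms)

lemma integrable_mult_sq:
  assumes f: "sq_integrable f" and g: "sq_integrable g"
  shows "integrable torus (\<lambda>x. f x * g x)"
proof (rule Bochner_Integration.integrable_bound)
  show "integrable torus (\<lambda>x. (norm (f x))\<^sup>2 + (norm (g x))\<^sup>2)"
    using f g by (auto simp: sq_integrable_def)
  have [measurable]: "f \<in> borel_measurable torus" "g \<in> borel_measurable torus"
    using f g by (auto simp: sq_integrable_def)
  show "(\<lambda>x. f x * g x) \<in> borel_measurable torus" by measurable
  have "norm (f x * g x) \<le> norm ((norm (f x))\<^sup>2 + (norm (g x))\<^sup>2)" for x
  proof -
    have "2 * (norm (f x) * norm (g x)) \<le> (norm (f x))\<^sup>2 + (norm (g x))\<^sup>2"
      using sum_squares_bound[of "norm (f x)" "norm (g x)"] by (simp only: mult.assoc)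
    moreover have "0 \<le> norm (f x) * norm (g x)" by simp
    ultimately have "norm (f x) * norm (g x) \<le> (norm (f x))\<^sup>2 + (norm (g x))\<^sup>2" by linarith
    then show ?thesis by (simp add: norm_mult)
  qed
  then show "AE x in torus. norm (f x * g x) \<le> norm ((norm (f x))\<^sup>2 + (norm (g x))\<^sup>2)" by simp
qed

lemma power2_norm_add_le:
  fixes a b :: "'a::real_normed_vector"
  shows "(norm (a + b))\<^sup>2 \<le> 2 * (norm a)\<^sup>2 + 2 * (norm b)\<^sup>2"
proof -
  have "(norm (a + b))\<^sup>2 \<le> (norm a + norm b)\<^sup>2"
    by (intro power_mono norm_triangle_ineq) simp
  also have "\<dots> \<le> 2 * (norm a)\<^sup>2 + 2 * (norm b)\<^sup>2"
    using sum_squares_bound[of "norm a" "norm b"] by (simp add: power2_sum)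
  finally show ?thesis .
qed

lemma sq_integrable_add:
  assumes "sq_integrable f" "sq_integrable g"
  shows "sq_integrable (\<lambda>x. f x + g x)"
  unfolding sq_integrable_def
proof
  have [measurable]: "f \<in> borel_measurable torus" "g \<in> borel_measurable torus"
    using assms by (auto simp: sq_integrable_def)
  show "(\<lambda>x. f x + g x) \<in> borel_measurable torus" by measurable
  show "integrable torus (\<lambda>x. (norm (f x + g x))\<^sup>2)"
  proof (rule Bochner_Integration.integrable_bound)
    show "integrable torus (\<lambda>x. 2 * (norm (f x))\<^sup>2 + 2 * (norm (g x))\<^sup>2)"
      using assms by (auto simp: sq_integrable_def)
    show "AE x in torus. norm ((norm (f x + g x))\<^sup>2) \<le> norm (2 * (norm (f x))\<^sup>2 + 2 * (norm (g x))\<^sup>2)"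
      by (simp add: power2_norm_add_le)
  qed measurable
qed

lemma sq_integrable_mult_character:
  assumes "sq_integrable f" shows "sq_integrable (\<lambda>x. f x * character k x)"
  using assms unfolding sq_integrable_def by (auto simp: norm_mult)

lemma sq_integrable_cmult:
  assumes "sq_integrable f" shows "sq_integrable (\<lambda>x. c * f x)"
  using assms unfolding sq_integrable_def by (auto simp: norm_mult power_mult_distrib)

lemma sq_integrable_cnj:
  assumes "sq_integrable f" shows "sq_integrable (\<lambda>x. cnj (f x))"
proof -
  have [measurable]: "f \<in> borel_measurable torus" using assms by (auto simp: sq_integrable_def)
  have "cnj \<in> borel_measurable borel"
    by (intro borel_measurable_continuous_onI continuous_intros)
  from measurable_compose[OF _ this, of f torus]
  have "(\<lambda>x. cnj (f x)) \<in> borel_measurable torus" by simp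
  then show ?thesis using assms unfolding sq_integrable_def by simp
qed

lemma sq_integrable_character: "sq_integrable (character k)"
  by (rule sq_integrable_bounded[where B = 1]) auto

lemma sq_integrable_sum:
  assumes "finite K" "\<And>k. k \<in> K \<Longrightarrow> sq_integrable (f k)"
  shows "sq_integrable (\<lambda>x. \<Sum>k\<in>K. f k x)"
  using assms
proof induction
  case empty
  show ?case by (simp add: sq_integrable_def)
next
  case (insert k K)
  then show ?case by (simp add: sq_integrable_add)
qed

lemma sq_integrable_diff:
  assumes "sq_integrable f" "sq_integrable g"
  shows "sq_integrable (\<lambda>x. f x - g x)"
  using sq_integrable_add[OF assms(1) sq_integrable_cmult[OF assms(2), of "-1"]] by simp

lemma sq_integrable_trig_poly:
  assumes "P \<in> trig_poly" shows "sq_integrable P"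
  using assms
proof induction
  case (character k c)
  show ?case by (intro sq_integrable_cmult sq_integrable_character)
next
  case (add f g)
  then show ?case by (intro sq_integrable_add)
qed

lemma l2sq_nonneg: "l2sq f \<ge> 0"
  by (simp add: l2sq_def)

lemma l2sq_eq_inner:
  assumes "sq_integrable f"
  shows "complex_of_real (l2sq f) = (LINT x|torus. f x * cnj (f x))"
proof -
  have "complex_of_real (l2sq f) = (LINT x|torus. complex_of_real ((norm (f x))\<^sup>2))"
    unfolding l2sq_def by (rule integral_complex_of_real[symmetric])
  then show ?thesis by (simp add: complex_norm_square del: of_real_power)
qed

text \<open>The Cauchy-Schwarz inequality, with the weight \<open>t\<close> left to be chosen.\<close>

lemma norm_inner_le:
  assumes f: "sq_integrable f" and g: "sq_integrable g" and "t > 0"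
  shows "norm (LINT x|torus. f x * cnj (g x)) \<le> (t * l2sq f + l2sq g / t) / 2"
proof -
  have "norm (LINT x|torus. f x * cnj (g x)) \<le> (LINT x|torus. norm (f x * cnj (g x)))"
    by (rule integral_norm_bound)
  also have "\<dots> \<le> (LINT x|torus. (t * (norm (f x))\<^sup>2 + (norm (g x))\<^sup>2 / t) / 2)"
  proof (rule integral_mono)
    show "integrable torus (\<lambda>x. norm (f x * cnj (g x)))"
      by (intro integrable_norm integrable_mult_sq f sq_integrable_cnj g)
    show "integrable torus (\<lambda>x. (t * (norm (f x))\<^sup>2 + (norm (g x))\<^sup>2 / t) / 2)"
      using f g by (auto simp: sq_integrable_def)
    fix x
    have "2 * (sqrt t * norm (f x)) * (norm (g x) / sqrt t) \<le> (sqrt t * norm (f x))\<^sup>2 + (norm (g x) / sqrt t)\<^sup>2"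
      by (rule sum_squares_bound)
    then show "norm (f x * cnj (g x)) \<le> (t * (norm (f x))\<^sup>2 + (norm (g x))\<^sup>2 / t) / 2"
      using \<open>t > 0\<close> by (simp add: norm_mult power_mult_distrib power_divide)
  qed
  also have "\<dots> = (t * l2sq f + l2sq g / t) / 2"
    using f g by (simp add: l2sq_def sq_integrable_def)
  finally show ?thesis .
qed

lemma integral_mult_character:
  assumes "k \<in> int_lattice" "l \<in> int_lattice"
  shows "(LINT x|torus. character k x * cnj (character l x)) = (if k = l then 1 else 0)"
  using integral_character[OF int_lattice_diff[OF assms]]
  by (simp add: cnj_character character_mult)

lemma fourier_eq: "fourier f k = (LINT x|torus. f x * cnj (character k x))"
  by (simp add: fourier_def cnj_character)

lemma inner_trig_sum:
  assumes "sq_integrable f" "finite K"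
  shows "(LINT x|torus. f x * cnj (\<Sum>k\<in>K. c k * character k x)) = (\<Sum>k\<in>K. fourier f k * cnj (c k))"
proof -
  have int: "integrable torus (\<lambda>x. f x * cnj (character k x))" for k
    by (intro integrable_mult_sq sq_integrable_cnj sq_integrable_character assms)
  have "(LINT x|torus. f x * cnj (\<Sum>k\<in>K. c k * character k x))
      = (LINT x|torus. (\<Sum>k\<in>K. (f x * cnj (character k x)) * cnj (c k)))"
    by (simp add: sum_distrib_left mult_ac)
  also have "\<dots> = (\<Sum>k\<in>K. (LINT x|torus. (f x * cnj (character k x)) * cnj (c k)))"
    by (rule Bochner_Integration.integral_sum) (intro integrable_mult_left int)
  finally show ?thesis by (simp add: fourier_eq)
qed

lemma trig_sum_inner:
  assumes "sq_integrable f" "finite K"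
  shows "(LINT x|torus. (\<Sum>k\<in>K. c k * character k x) * cnj (f x)) = (\<Sum>k\<in>K. c k * cnj (fourier f k))"
proof -
  have "(LINT x|torus. (\<Sum>k\<in>K. c k * character k x) * cnj (f x))
     = (LINT x|torus. cnj (f x * cnj (\<Sum>k\<in>K. c k * character k x)))"
    by (simp add: mult.commute)
  also have "\<dots> = cnj (LINT x|torus. f x * cnj (\<Sum>k\<in>K. c k * character k x))"
    by (rule Bochner_Integration.integral_cnj)
  finally show ?thesis by (subst (asm) inner_trig_sum[OF assms]) (simp add: mult.commute)
qed

lemma fourier_trig_sum:
  assumes "finite K" "K \<subseteq> int_lattice" "l \<in> K"
  shows "fourier (\<lambda>x. \<Sum>k\<in>K. c k * character k x) l = c l"
proof -
  have "fourier (\<lambda>x. \<Sum>k\<in>K. c k * character k x) l = (\<Sum>k\<in>K. c k * cnj (fourier (character l) k))"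
    unfolding fourier_eq[of _ l] by (rule trig_sum_inner) (use assms sq_integrable_character in auto)
  also have "\<dots> = (\<Sum>k\<in>K. if k = l then c k else 0)"
    using assms by (intro sum.cong) (auto simp: fourier_eq integral_mult_character subset_iff)
  finally show ?thesis using assms by simp
qed

text \<open>Expansion of the square of the distance to a trigonometric polynomial; Bessel's inequality and the
  optimality of the partial Fourier sums are read off from it.\<close>

lemma l2sq_diff_trig_sum:
  assumes f: "sq_integrable f" and K: "finite K" "K \<subseteq> int_lattice"
  shows "l2sq (\<lambda>x. f x - (\<Sum>k\<in>K. c k * character k x))
     = l2sq f - (\<Sum>k\<in>K. (norm (fourier f k))\<^sup>2) + (\<Sum>k\<in>K. (norm (c k - fourier f k))\<^sup>2)"
proof -
  let ?P = "\<lambda>x. \<Sum>k\<in>K. c k * character k x"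
  have P: "sq_integrable ?P"
    by (intro sq_integrable_sum K sq_integrable_cmult sq_integrable_character)
  have "complex_of_real (l2sq (\<lambda>x. f x - ?P x)) = (LINT x|torus. (f x - ?P x) * cnj (f x - ?P x))"
    by (intro l2sq_eq_inner sq_integrable_diff f P)
  also have "\<dots> = (LINT x|torus. (f x * cnj (f x) - f x * cnj (?P x)) - (?P x * cnj (f x) - ?P x * cnj (?P x)))"
    by (intro Bochner_Integration.integral_cong refl) (simp add: algebra_simps)
  also have "\<dots> = (LINT x|torus. f x * cnj (f x)) - (LINT x|torus. f x * cnj (?P x))
      - ((LINT x|torus. ?P x * cnj (f x)) - (LINT x|torus. ?P x * cnj (?P x)))"
    using integrable_mult_sq[OF f sq_integrable_cnj[OF f]] integrable_mult_sq[OF f sq_integrable_cnj[OF P]]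
      integrable_mult_sq[OF P sq_integrable_cnj[OF f]] integrable_mult_sq[OF P sq_integrable_cnj[OF P]]
    by (simp only: Bochner_Integration.integral_diff Bochner_Integration.integrable_diff)
  also have "\<dots> = complex_of_real (l2sq f) - (\<Sum>k\<in>K. fourier f k * cnj (c k))
      - ((\<Sum>k\<in>K. c k * cnj (fourier f k)) - (\<Sum>k\<in>K. c k * cnj (c k)))"
    using K fourier_trig_sum[OF K]
    by (simp only: l2sq_eq_inner[OF f] inner_trig_sum[OF f] trig_sum_inner[OF f] trig_sum_inner[OF P] cong: sum.cong)
  also have "\<dots> = complex_of_real (l2sq f) - (\<Sum>k\<in>K. fourier f k * cnj (fourier f k))
      + (\<Sum>k\<in>K. (c k - fourier f k) * cnj (c k - fourier f k))"
    by (simp add: algebra_simps sum.distrib sum_subtractf)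
  also have "\<dots> = complex_of_real (l2sq f - (\<Sum>k\<in>K. (norm (fourier f k))\<^sup>2) + (\<Sum>k\<in>K. (norm (c k - fourier f k))\<^sup>2))"
    by (simp add: complex_norm_square del: of_real_power)
  finally show ?thesis unfolding of_real_eq_iff .
qed

lemma bessel:
  assumes f: "sq_integrable f" and K: "finite K" "K \<subseteq> int_lattice"
  shows "(\<Sum>k\<in>K. (norm (fourier f k))\<^sup>2) \<le> l2sq f"
  using l2sq_diff_trig_sum[OF assms, of "fourier f"] l2sq_nonneg[of "\<lambda>x. f x - (\<Sum>k\<in>K. fourier f k * character k x)"]
  by simp

text \<open>Membership in the \<open>L\<^sup>2\<close> closure of the trigonometric polynomials.  Every square integrable function has this
  property, but it is only needed for the components of fields in \<open>H_space\<close>, where it follows from the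
  approximation by smooth fields.\<close>

definition trig_approximable :: "(real^3 \<Rightarrow> complex) \<Rightarrow> bool" where
  "trig_approximable f \<longleftrightarrow> sq_integrable f \<and> (\<forall>e>0. \<exists>P\<in>trig_poly. l2sq (\<lambda>x. f x - P x) < e)"

text \<open>Parseval's identity in polarised form; only one of the two functions needs to be approximable.\<close>

lemma parseval_inner:
  assumes app: "trig_approximable f" and g: "sq_integrable g"
  shows "((\<lambda>k. fourier f k * cnj (fourier g k)) has_sum (LINT x|torus. f x * cnj (g x))) int_lattice"
  unfolding has_sum_def tendsto_iff eventually_finite_subsets_at_top
proof (intro allI impI)
  have f: "sq_integrable f" using app by (simp add: trig_approximable_def)
  fix e :: real assume "e > 0"
\<comment> \<open>this weight makes the term with \<open>g\<close> at most \<open>e\<close>; the other one becomes small for large \<open>K\<close>\<close>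
  define t where "t = (l2sq g + 1) / e"
  have t: "t > 0" using \<open>e > 0\<close> l2sq_nonneg[of g] by (simp add: t_def)
  obtain P where P: "P \<in> trig_poly" "l2sq (\<lambda>x. f x - P x) < e / t"
    using app t \<open>e > 0\<close> unfolding trig_approximable_def by (meson divide_pos_pos)
  obtain K0 c where K0: "finite K0" "K0 \<subseteq> int_lattice" "\<forall>x. P x = (\<Sum>k\<in>K0. c k * character k x)"
    using trig_poly_expansion[OF P(1)] by blast
  show "\<exists>X. finite X \<and> X \<subseteq> int_lattice \<and> (\<forall>Y. finite Y \<and> X \<subseteq> Y \<and> Y \<subseteq> int_lattice \<longrightarrow>
      dist (\<Sum>k\<in>Y. fourier f k * cnj (fourier g k)) (LINT x|torus. f x * cnj (g x)) < e)"
  proof (intro exI[of _ K0] conjI allI impI)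
    fix K assume "finite K \<and> K0 \<subseteq> K \<and> K \<subseteq> int_lattice"
    then have K: "finite K" "K0 \<subseteq> K" "K \<subseteq> int_lattice" by auto
    let ?S = "\<lambda>x. \<Sum>k\<in>K. fourier f k * character k x"
    have S: "sq_integrable ?S"
      by (intro sq_integrable_sum K sq_integrable_cmult sq_integrable_character)
    have "l2sq (\<lambda>x. f x - ?S x) = l2sq f - (\<Sum>k\<in>K. (norm (fourier f k))\<^sup>2)"
      using l2sq_diff_trig_sum[OF f K(1,3), of "fourier f"] by simp
    also have "\<dots> \<le> l2sq f - (\<Sum>k\<in>K0. (norm (fourier f k))\<^sup>2)"
      using K by (simp add: sum_mono2)
    also have "\<dots> \<le> l2sq (\<lambda>x. f x - (\<Sum>k\<in>K0. c k * character k x))"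
      using l2sq_diff_trig_sum[OF f K0(1,2), of c] by (simp add: sum_nonneg)
    also have "\<dots> < e / t" using P(2) K0(3) by simp
    finally have le: "l2sq (\<lambda>x. f x - ?S x) < e / t" .
    have "(LINT x|torus. (f x - ?S x) * cnj (g x)) = (LINT x|torus. f x * cnj (g x) - ?S x * cnj (g x))"
      by (simp add: left_diff_distrib)
    also have "\<dots> = (LINT x|torus. f x * cnj (g x)) - (LINT x|torus. ?S x * cnj (g x))"
      by (intro Bochner_Integration.integral_diff integrable_mult_sq sq_integrable_cnj f g S)
    also have "\<dots> = (LINT x|torus. f x * cnj (g x)) - (\<Sum>k\<in>K. fourier f k * cnj (fourier g k))"
      by (simp add: trig_sum_inner[OF g K(1)])
    finally have "dist (\<Sum>k\<in>K. fourier f k * cnj (fourier g k)) (LINT x|torus. f x * cnj (g x))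
        = norm (LINT x|torus. (f x - ?S x) * cnj (g x))"
      by (simp add: dist_norm norm_minus_commute)
    also have "\<dots> \<le> (t * l2sq (\<lambda>x. f x - ?S x) + l2sq g / t) / 2"
      by (intro norm_inner_le sq_integrable_diff f g S t)
    also have "\<dots> < e"
    proof -
      have "t * l2sq (\<lambda>x. f x - ?S x) < e" using le t by (simp add: field_simps)
      moreover have "l2sq g / t \<le> e"
        using \<open>e > 0\<close> l2sq_nonneg[of g] by (simp add: t_def field_simps)
      ultimately show ?thesis by simp
    qed
    finally show "dist (\<Sum>k\<in>K. fourier f k * cnj (fourier g k)) (LINT x|torus. f x * cnj (g x)) < e" .
  qed (use K0 in auto)
qed

lemma parseval:
  assumes "trig_approximable f"
  shows "((\<lambda>k. (norm (fourier f k))\<^sup>2) has_sum l2sq f) int_lattice"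
proof -
  have f: "sq_integrable f" using assms by (simp add: trig_approximable_def)
  have "((\<lambda>k. complex_of_real ((norm (fourier f k))\<^sup>2)) has_sum complex_of_real (l2sq f)) int_lattice"
    using parseval_inner[OF assms f] by (simp add: complex_norm_square l2sq_eq_inner[OF f] del: of_real_power)
  then show ?thesis by (simp only: has_sum_of_real_iff)
qed

lemma fourier_cnj: "fourier (\<lambda>x. cnj (f x)) k = cnj (fourier f (- k))"
proof -
  have "fourier (\<lambda>x. cnj (f x)) k = (LINT x|torus. cnj (f x * character k x))"
    by (simp add: fourier_def cnj_character)
  also have "\<dots> = cnj (LINT x|torus. f x * character k x)"
    by (rule Bochner_Integration.integral_cnj)
  finally show ?thesis by (simp add: fourier_def)
qed

lemma fourier_of_real_minus:
  "fourier (\<lambda>x. complex_of_real (f x)) (- k) = cnj (fourier (\<lambda>x. complex_of_real (f x)) k)"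
  using fourier_cnj[of "\<lambda>x. complex_of_real (f x)" "- k"] by simp

lemma fourier_mult_character: "fourier (\<lambda>x. f x * character l x) k = fourier f (k - l)"
  by (simp add: fourier_def character_mult mult.assoc add.commute)

text \<open>The Fourier coefficients of a product are the convolution of the Fourier coefficients.\<close>

lemma fourier_mult_of_real:
  fixes f g :: "real^3 \<Rightarrow> real"
  assumes "trig_approximable (\<lambda>x. of_real (f x))" "sq_integrable (\<lambda>x. of_real (g x))"
  shows "((\<lambda>m. fourier (\<lambda>x. of_real (f x)) m * fourier (\<lambda>x. of_real (g x)) (k - m))
     has_sum fourier (\<lambda>x. of_real (f x * g x)) k) int_lattice"
proof -
  have "((\<lambda>m. fourier (\<lambda>x. of_real (f x)) m * cnj (fourier (\<lambda>x. of_real (g x) * character k x) m))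
     has_sum (LINT x|torus. of_real (f x) * cnj (of_real (g x) * character k x))) int_lattice"
    by (intro parseval_inner assms sq_integrable_mult_character)
  moreover have "cnj (fourier (\<lambda>x. of_real (g x) * character k x) m) = fourier (\<lambda>x. of_real (g x)) (k - m)" for m
    using fourier_of_real_minus[of g "m - k"] by (simp add: fourier_mult_character)
  ultimately show ?thesis by (simp add: fourier_eq mult.assoc)
qed

section \<open>Fourier coefficients of solenoidal fields\<close>

lemma periodic_continuous_bounded:
  fixes f :: "real^3 \<Rightarrow> 'b::real_normed_vector"
  assumes "periodic f" "continuous_on UNIV f"
  obtains B where "B > 0" "\<And>x. norm (f x) \<le> B"
proof -
  have "compact (f ` unit_cube)"
    by (intro compact_continuous_image continuous_on_subset[OF assms(2)]) (auto simp: unit_cube_def)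
  then obtain B where B: "B > 0" "\<And>y. y \<in> f ` unit_cube \<Longrightarrow> norm y \<le> B"
    by (meson bounded_pos compact_imp_bounded)
  have "norm (f x) \<le> B" for x
  proof -
    have "frac_part x \<in> unit_cube" using frac_part_in_cube half_open_cube_subset by blast
    from B(2)[OF imageI[OF this]] show ?thesis by (simp add: periodic_frac_part[OF assms(1)])
  qed
  with B(1) show ?thesis by (rule that)
qed

interpretation torus_borel: finite_measure torus_borel
proof
  have "emeasure lborel half_open_cube \<le> emeasure lborel unit_cube"
    by (intro emeasure_mono half_open_cube_subset) simp
  also have "\<dots> < \<infinity>" unfolding unit_cube_def by (rule emeasure_lborel_cbox_finite)
  finally show "emeasure torus_borel (space torus_borel) \<noteq> \<infinity>"
    by (simp add: torus_borel_def emeasure_restrict_space space_restrict_space)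
qed

lemma measurable_ident_torus_borel [measurable]: "(\<lambda>x. x) \<in> torus_borel \<rightarrow>\<^sub>M borel"
  by (intro borel_measurable_torus_borel) simp

text \<open>The integral of \<open>d(x + t e)\<close> over \<open>t \<in> [0,1]\<close> telescopes to \<open>f(x + e) - f(x) = 0\<close>; averaging over
  \<open>x\<close> and exchanging the integrals gives the mean of \<open>d\<close>.\<close>

lemma integral_directional_derivative_zero:
  fixes f d :: "real^3 \<Rightarrow> 'b::euclidean_space"
  assumes per: "periodic f" and e: "e \<in> int_lattice"
    and d: "periodic d" "continuous_on UNIV d"
    and der: "\<And>x. ((\<lambda>t. f (x + t *\<^sub>R e)) has_vector_derivative d x) (at 0)"
  shows "(LINT x|torus. d x) = 0"
proof -
  have [measurable]: "d \<in> borel_measurable borel"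
    using d(2) by (rule borel_measurable_continuous_onI)
  obtain B where B: "B > 0" "\<And>x. norm (d x) \<le> B"
    using periodic_continuous_bounded[OF d] by blast
  have der': "((\<lambda>t. f (x + t *\<^sub>R e)) has_vector_derivative d (x + t *\<^sub>R e)) (at t)" for x t
  proof -
    have shift: "((\<lambda>s. s - t) has_vector_derivative 1) (at t)"
      by (auto intro!: derivative_eq_intros)
    have "((\<lambda>s. f ((x + t *\<^sub>R e) + (s - t) *\<^sub>R e)) has_vector_derivative (1 *\<^sub>R d (x + t *\<^sub>R e))) (at t)"
      using vector_diff_chain_at[OF shift, of "\<lambda>s. f ((x + t *\<^sub>R e) + s *\<^sub>R e)" "d (x + t *\<^sub>R e)"]
        der[of "x + t *\<^sub>R e"]
      by (simp add: o_def)
    moreover have "x + t *\<^sub>R e + (s - t) *\<^sub>R e = x + s *\<^sub>R e" for s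
      by (simp add: scaleR_diff_left)
    ultimately show ?thesis by simp
  qed
  let ?g = "\<lambda>(x, t). indicator {0..1::real} t *\<^sub>R d (x + t *\<^sub>R e)"
  interpret P: pair_sigma_finite torus_borel "lborel :: real measure" ..
  have zero: "(LINT t|lborel. ?g (x, t)) = 0" for x
  proof -
    have "(LINT t|lborel. indicator {0..1} t *\<^sub>R d (x + t *\<^sub>R e)) = f (x + 1 *\<^sub>R e) - f (x + 0 *\<^sub>R e)"
      by (rule integral_FTC_Icc)
        (auto intro!: continuous_intros continuous_on_compose2[OF d(2)] has_vector_derivative_at_within der')
    then show ?thesis using periodicD[OF per e, of x] by simp
  qed
  have fst: "fst \<in> borel_measurable (torus_borel \<Otimes>\<^sub>M (lborel :: real measure))"
    by (rule measurable_compose[OF measurable_fst measurable_ident_torus_borel])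
  have snd: "snd \<in> borel_measurable (torus_borel \<Otimes>\<^sub>M (lborel :: real measure))"
    using measurable_snd by (simp add: measurable_lborel1)
  have "(\<lambda>p. d (fst p + snd p *\<^sub>R e)) \<in> borel_measurable (torus_borel \<Otimes>\<^sub>M (lborel :: real measure))"
    by (rule measurable_compose[OF _ borel_measurable_continuous_onI[OF d(2)]])
      (intro borel_measurable_add borel_measurable_scaleR fst snd borel_measurable_const)
  moreover have "(\<lambda>p. indicator {0..1} (snd p) :: real) \<in> borel_measurable (torus_borel \<Otimes>\<^sub>M (lborel :: real measure))"
    by (rule measurable_compose[OF snd]) simp
  ultimately have gm: "?g \<in> borel_measurable (torus_borel \<Otimes>\<^sub>M lborel)"
    unfolding case_prod_beta by (intro borel_measurable_scaleR)
  have int: "integrable (torus_borel \<Otimes>\<^sub>M lborel) ?g"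
  proof (rule Bochner_Integration.integrable_bound)
    let ?S = "half_open_cube \<times> {0..1::real}"
    have "emeasure (torus_borel \<Otimes>\<^sub>M lborel) (half_open_cube \<times> {0..1::real}) = emeasure torus_borel half_open_cube * emeasure lborel {0..1::real}"
      by (intro lborel.emeasure_pair_measure_Times) (auto simp: torus_borel_def sets_restrict_space_iff)
    also have "\<dots> < \<infinity>"
      using torus_borel.emeasure_finite[of half_open_cube] by (simp add: ennreal_mult_less_top less_top[symmetric])
    finally show "integrable (torus_borel \<Otimes>\<^sub>M lborel) (\<lambda>p. indicator ?S p *\<^sub>R B)"
      by (intro integrable_scaleR_left integrable_real_indicator)
        (auto simp: torus_borel_def sets_restrict_space_iff)
    show "AE p in torus_borel \<Otimes>\<^sub>M lborel. norm (?g p) \<le> norm (indicator ?S p *\<^sub>R B)"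
      using B by (intro AE_I2) (auto simp: space_pair_measure space_torus_borel indicator_def split: prod.splits)
  qed (rule gm)
  have "0 = (LINT x|torus_borel. (LINT t|lborel. ?g (x, t)))" unfolding zero by simp
  also have "\<dots> = (LINT t|lborel. (LINT x|torus_borel. ?g (x, t)))"
    using P.Fubini_integral[OF int[unfolded case_prod_eta]] by simp
  also have "\<dots> = (LINT t|lborel. indicator {0..1::real} t *\<^sub>R (LINT x|torus. d x))"
  proof (rule Bochner_Integration.integral_cong[OF refl])
    fix t :: real
    have "(LINT x|torus_borel. ?g (x, t)) = indicator {0..1} t *\<^sub>R (LINT x|torus_borel. d (x + t *\<^sub>R e))"
      by simp
    also have "(LINT x|torus_borel. d (x + t *\<^sub>R e)) = (LINT x|torus. d (x + t *\<^sub>R e))"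
      by (rule integral_torus_borel(1)[symmetric]) measurable
    also have "\<dots> = (LINT x|torus. d x)"
      by (rule integral_torus_shift) (use d in auto)
    finally show "(LINT x|torus_borel. ?g (x, t)) = indicator {0..1::real} t *\<^sub>R (LINT x|torus. d x)" .
  qed
  also have "\<dots> = (LINT x|torus. d x)" by simp
  finally show ?thesis by simp
qed

text \<open>The vector of Fourier coefficients of the components.\<close>

definition vfourier :: "(real^3 \<Rightarrow> real^3) \<Rightarrow> real^3 \<Rightarrow> complex^3" where
  "vfourier v k = (\<chi> i. fourier (\<lambda>x. complex_of_real (v x $ i)) k)"

lemma vfourier_nth: "vfourier v k $ i = fourier (\<lambda>x. complex_of_real (v x $ i)) k"
  by (simp add: vfourier_def)

lemma vfourier_minus: "vfourier v (- k) $ i = cnj (vfourier v k $ i)"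
  by (simp add: vfourier_nth fourier_of_real_minus)

lemma norm_vec_sq: "(norm (z :: 'a::real_normed_vector ^ 'n))\<^sup>2 = (\<Sum>i\<in>UNIV. (norm (z $ i))\<^sup>2)"
  by (simp add: norm_vec_def L2_set_def sum_nonneg)

lemma sq_integrable_component:
  assumes "v \<in> L2_torus"
  shows "sq_integrable (\<lambda>x. complex_of_real (v x $ i))"
  unfolding sq_integrable_def
proof
  have v: "v \<in> borel_measurable torus" "integrable torus (\<lambda>x. (norm (v x))\<^sup>2)"
    using assms by (auto simp: L2_torus_def intro: measurable_restrict_space1)
  have [measurable]: "(\<lambda>x. v x $ i) \<in> borel_measurable torus"
    by (rule measurable_compose[OF v(1)]) (intro borel_measurable_continuous_onI continuous_intros)
  then show "(\<lambda>x. complex_of_real (v x $ i)) \<in> borel_measurable torus" by measurable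
  have "integrable torus (\<lambda>x. (v x $ i)\<^sup>2)"
  proof (rule Bochner_Integration.integrable_bound[OF v(2)])
    show "AE x in torus. norm ((v x $ i)\<^sup>2) \<le> norm ((norm (v x))\<^sup>2)"
      using component_le_norm_cart[of "v _" i] by (intro AE_I2) (simp add: abs_le_square_iff[symmetric])
  qed measurable
  then show "integrable torus (\<lambda>x. (norm (complex_of_real (v x $ i)))\<^sup>2)" by simp
qed

lemma L2_norm_sq:
  assumes "v \<in> L2_torus"
  shows "(L2_norm v)\<^sup>2 = (\<Sum>i\<in>UNIV. l2sq (\<lambda>x. complex_of_real (v x $ i)))"
proof -
  have "L2_inner v v = (LINT x|torus. (\<Sum>i\<in>UNIV. (norm (complex_of_real (v x $ i)))\<^sup>2))"
    unfolding L2_inner_def by (simp add: inner_vec_def power2_eq_square)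
  also have "\<dots> = (\<Sum>i\<in>UNIV. l2sq (\<lambda>x. complex_of_real (v x $ i)))"
    unfolding l2sq_def
    by (rule Bochner_Integration.integral_sum) (use sq_integrable_component[OF assms] in \<open>auto simp: sq_integrable_def\<close>)
  moreover have "0 \<le> (\<Sum>i\<in>UNIV. l2sq (\<lambda>x. complex_of_real (v x $ i)))"
    by (intro sum_nonneg l2sq_nonneg)
  ultimately show ?thesis by (simp add: L2_norm_def)
qed

lemma L2_norm_nonneg: "v \<in> L2_torus \<Longrightarrow> 0 \<le> L2_norm v"
  by (simp add: L2_norm_def L2_inner_def)

lemma L2_torus_diff:
  assumes "v \<in> L2_torus" "w \<in> L2_torus"
  shows "(\<lambda>x. v x - w x) \<in> L2_torus"
proof -
  have [measurable]: "v \<in> borel_measurable lebesgue" "w \<in> borel_measurable lebesgue"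
    using assms by (auto simp: L2_torus_def)
  have "integrable torus (\<lambda>x. (norm (v x - w x))\<^sup>2)"
  proof (rule Bochner_Integration.integrable_bound)
    show "integrable torus (\<lambda>x. 2 * (norm (v x))\<^sup>2 + 2 * (norm (w x))\<^sup>2)"
      using assms by (auto simp: L2_torus_def)
    have "(norm (v x - w x))\<^sup>2 \<le> 2 * (norm (v x))\<^sup>2 + 2 * (norm (w x))\<^sup>2" for x
      using power2_norm_add_le[of "v x" "- w x"] by simp
    then show "AE x in torus. norm ((norm (v x - w x))\<^sup>2) \<le> norm (2 * (norm (v x))\<^sup>2 + 2 * (norm (w x))\<^sup>2)"
      by simp
    show "(\<lambda>x. (norm (v x - w x))\<^sup>2) \<in> borel_measurable torus"
      by (rule measurable_restrict_space1) measurable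
  qed
  then show ?thesis using assms by (auto simp: L2_torus_def periodic_def)
qed

lemma continuous_L2_torus:
  fixes w :: "real^3 \<Rightarrow> 'a::euclidean_space"
  assumes "periodic w" "continuous_on UNIV w"
  shows "w \<in> L2_torus"
proof -
  obtain B where B: "B > 0" "\<And>x. norm (w x) \<le> B"
    using periodic_continuous_bounded[OF assms] by blast
  have [measurable]: "w \<in> borel_measurable borel"
    using assms(2) by (rule borel_measurable_continuous_onI)
  have "integrable torus (\<lambda>x. (norm (w x))\<^sup>2)"
    using B by (intro torus.integrable_const_bound[where B = "B\<^sup>2"] lebesgue_on_borelI)
      (auto intro!: power_mono)
  then show ?thesis using assms unfolding L2_torus_def
    by (auto intro: measurable_completion)
qed

lemma smooth_on_UNIV_C1:
  assumes "smooth_on UNIV w"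
  shows "continuous_on UNIV w"
    and "(w has_derivative frechet_derivative w (at x)) (at x)"
    and "b \<in> Basis \<Longrightarrow> continuous_on UNIV (\<lambda>x. frechet_derivative w (at x) b)"
proof -
  have "Ck_on 0 UNIV w" "Ck_on (Suc 0) UNIV w" using assms unfolding smooth_on_def by blast+
  then show "continuous_on UNIV w"
    and "(w has_derivative frechet_derivative w (at x)) (at x)"
    and "b \<in> Basis \<Longrightarrow> continuous_on UNIV (\<lambda>x. frechet_derivative w (at x) b)"
    by (auto simp: differentiable_on_def frechet_derivative_works[symmetric])
qed

lemma divergence_eq: "divergence w x = (\<Sum>i\<in>UNIV. frechet_derivative w (at x) (axis i 1) $ i)"
  by (simp add: divergence_def trace_def jacobian_def matrix_def)

lemma axis_int_lattice: "axis i 1 \<in> int_lattice"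
  by (auto simp: int_lattice_def axis_def)

lemma periodic_frechet_derivative:
  assumes "periodic w" "z \<in> int_lattice" "(w has_derivative D) (at x)"
  shows "(w has_derivative D) (at (x + z))"
proof -
  have "((\<lambda>y. y - z) has_derivative (\<lambda>h. h)) (at (x + z))"
    by (auto intro!: derivative_eq_intros)
  moreover have "(w has_derivative D) (at ((x + z) - z))" using assms(3) by simp
  ultimately have "((\<lambda>y. w (y - z)) has_derivative (\<lambda>h. D h)) (at (x + z))"
    by (rule has_derivative_compose)
  moreover have "(\<lambda>y. w (y - z)) = w"
    using periodicD[OF assms(1) int_lattice_uminus[OF assms(2)]] by (auto simp: fun_eq_iff)
  ultimately show ?thesis by simp
qed

lemma smooth_solenoidal_fourier:
  assumes w: "w \<in> smooth_solenoidal" and k: "k \<in> int_lattice"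
  shows "(\<Sum>j\<in>UNIV. complex_of_real (k $ j) * vfourier w k $ j) = 0"
proof -
  have per: "periodic w" and sm: "smooth_on UNIV w" and div: "\<And>x. divergence w x = 0"
    using w by (auto simp: smooth_solenoidal_def)
  let ?D = "\<lambda>x :: real^3. frechet_derivative w (at x)"
  let ?c = "character (- k)"
  define d where "d j x = complex_of_real (?D x (axis j 1) $ j) * ?c x
     + complex_of_real (w x $ j) * (- (2 * pi * k $ j) * \<i> * ?c x)" for j x
  have cD: "continuous_on UNIV (\<lambda>x. ?D x (axis j 1))" for j
    by (rule smooth_on_UNIV_C1(3)[OF sm]) (simp add: axis_in_Basis_iff)
  have perD: "periodic ?D"
    unfolding periodic_def
  proof (intro allI ballI)
    fix x z assume "z \<in> int_lattice"
    then have "(w has_derivative ?D x) (at (x + z))"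
      using periodic_frechet_derivative[OF per _ smooth_on_UNIV_C1(2)[OF sm]] by blast
    then show "?D (x + z) = ?D x" by (rule frechet_derivative_at[symmetric])
  qed
  have perc: "periodic ?c" using k by (intro periodic_character int_lattice_uminus)
  have cd: "continuous_on UNIV (d j)" for j
    unfolding d_def
    by (intro continuous_intros cD continuous_character smooth_on_UNIV_C1(1)[OF sm])
  have pd: "periodic (d j)" for j
    using perD perc per unfolding d_def periodic_def by simp
  have "(LINT x|torus. d j x) = 0" for j
  proof (rule integral_directional_derivative_zero[OF _ axis_int_lattice[of j] pd cd])
    show "periodic (\<lambda>x. complex_of_real (w x $ j) * ?c x)"
      using perc per by (simp add: periodic_def)
    fix x :: "real^3"
    have "((\<lambda>t::real. x + t *\<^sub>R axis j 1) has_derivative (\<lambda>h. h *\<^sub>R axis j 1)) (at 0)"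
      by (auto intro!: derivative_eq_intros)
    moreover have "(w has_derivative ?D x) (at (x + 0 *\<^sub>R axis j 1))"
      using smooth_on_UNIV_C1(2)[OF sm] by simp
    ultimately have "((\<lambda>t. w (x + t *\<^sub>R axis j 1)) has_derivative (\<lambda>h. ?D x (h *\<^sub>R axis j 1))) (at 0)"
      by (rule has_derivative_compose)
    moreover have "?D x (h *\<^sub>R axis j 1) = h *\<^sub>R ?D x (axis j 1)" for h
      using smooth_on_UNIV_C1(2)[OF sm, of x] by (simp add: has_derivative_def linear_simps)
    ultimately have "((\<lambda>t. w (x + t *\<^sub>R axis j 1)) has_vector_derivative ?D x (axis j 1)) (at 0)"
      by (simp add: has_vector_derivative_def)
    then have "((\<lambda>t. w (x + t *\<^sub>R axis j 1) $ j) has_vector_derivative ?D x (axis j 1) $ j) (at 0)"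
      by (rule bounded_linear.has_vector_derivative[OF bounded_linear_vec_nth])
    then have 1: "((\<lambda>t. complex_of_real (w (x + t *\<^sub>R axis j 1) $ j)) has_vector_derivative complex_of_real (?D x (axis j 1) $ j)) (at 0)"
      by (rule bounded_linear.has_vector_derivative[OF bounded_linear_of_real])
    have 2: "((\<lambda>t. ?c (x + t *\<^sub>R axis j 1)) has_vector_derivative - (2 * pi * k $ j) * \<i> * ?c x) (at 0)"
    proof -
      have e: "?c (x + t *\<^sub>R axis j 1) = exp (of_real t * (- (2 * pi * k $ j) * \<i>)) * ?c x" for t
        unfolding character_add by (simp add: character_def inner_axis cis_conv_exp mult_ac)
      have "((\<lambda>z. exp (z * (- (2 * pi * k $ j) * \<i>)) * ?c x) has_field_derivative - (2 * pi * k $ j) * \<i> * ?c x) (at (of_real 0))"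
        by (auto intro!: derivative_eq_intros)
      then show ?thesis unfolding e by (rule has_vector_derivative_real_field)
    qed
    show "((\<lambda>t. complex_of_real (w (x + t *\<^sub>R axis j 1) $ j) * ?c (x + t *\<^sub>R axis j 1)) has_vector_derivative d j x) (at 0)"
      using has_vector_derivative_mult[OF 1 2] by (simp add: d_def add.commute)
  qed
  then have "0 = (\<Sum>j\<in>UNIV. (LINT x|torus. d j x))" by simp
  also have "\<dots> = (LINT x|torus. (\<Sum>j\<in>UNIV. d j x))"
  proof (rule Bochner_Integration.integral_sum[symmetric])
    fix j
    obtain B where "B > 0" "\<And>x. norm (d j x) \<le> B" using periodic_continuous_bounded[OF pd cd] by blast
    moreover have "d j \<in> borel_measurable borel" by (rule borel_measurable_continuous_onI[OF cd])
    ultimately show "integrable torus (d j)"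
      by (intro torus.integrable_const_bound[where B = B] lebesgue_on_borelI) auto
  qed
  also have "\<dots> = (LINT x|torus. (\<Sum>j\<in>UNIV. (- 2 * pi * \<i> * k $ j) * (complex_of_real (w x $ j) * ?c x)))"
  proof (intro Bochner_Integration.integral_cong refl)
    fix x
    have "(\<Sum>j\<in>UNIV. complex_of_real (?D x (axis j 1) $ j) * ?c x) = complex_of_real (divergence w x) * ?c x"
      by (simp add: divergence_eq sum_distrib_right)
    moreover have "(\<Sum>j\<in>UNIV. d j x) = (\<Sum>j\<in>UNIV. complex_of_real (?D x (axis j 1) $ j) * ?c x)
        + (\<Sum>j\<in>UNIV. (- 2 * pi * \<i> * k $ j) * (complex_of_real (w x $ j) * ?c x))"
      unfolding sum.distrib[symmetric] d_def by (intro sum.cong refl) (simp add: mult_ac)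
    ultimately show "(\<Sum>j\<in>UNIV. d j x) = (\<Sum>j\<in>UNIV. (- 2 * pi * \<i> * k $ j) * (complex_of_real (w x $ j) * ?c x))"
      by (simp add: div)
  qed
  also have "\<dots> = (\<Sum>j\<in>UNIV. (- 2 * pi * \<i> * k $ j) * vfourier w k $ j)"
  proof -
    have "w \<in> L2_torus" by (intro continuous_L2_torus per smooth_on_UNIV_C1(1)[OF sm])
    then have "integrable torus (\<lambda>x. complex_of_real (w x $ j) * ?c x)" for j
      by (intro integrable_mult_sq sq_integrable_component sq_integrable_character)
    then show ?thesis by (simp add: vfourier_nth fourier_def)
  qed
  also have "\<dots> = (- 2 * pi * \<i>) * (\<Sum>j\<in>UNIV. complex_of_real (k $ j) * vfourier w k $ j)"
    by (simp add: sum_distrib_left mult_ac)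
  finally show ?thesis by simp
qed

lemma smooth_solenoidal_fourier_0:
  assumes w: "w \<in> smooth_solenoidal" shows "vfourier w 0 = 0"
proof -
  have per: "periodic w" and sm: "smooth_on UNIV w" and z: "(LINT x|torus. w x) = 0"
    using w by (auto simp: smooth_solenoidal_def)
  obtain B where B: "B > 0" "\<And>x. norm (w x) \<le> B"
    using periodic_continuous_bounded[OF per smooth_on_UNIV_C1(1)[OF sm]] by blast
  have "w \<in> borel_measurable borel"
    by (rule borel_measurable_continuous_onI[OF smooth_on_UNIV_C1(1)[OF sm]])
  then have int: "integrable torus w"
    using B by (intro torus.integrable_const_bound[where B = B] lebesgue_on_borelI) auto
  have "(LINT x|torus. w x $ i) = 0" for i
    using integral_bounded_linear[OF bounded_linear_vec_nth int, of i] z by simp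
  then show ?thesis by (simp add: vec_eq_iff vfourier_nth fourier_def)
qed

lemma fourier_le_l2sq:
  assumes "sq_integrable f" "k \<in> int_lattice"
  shows "(norm (fourier f k))\<^sup>2 \<le> l2sq f"
  using bessel[OF assms(1), of "{k}"] assms(2) by simp

lemma fourier_diff:
  assumes "sq_integrable f" "sq_integrable g"
  shows "fourier (\<lambda>x. f x - g x) k = fourier f k - fourier g k"
  unfolding fourier_def
  by (simp add: left_diff_distrib integrable_mult_sq assms sq_integrable_character)

lemma H_space_approx:
  assumes "v \<in> H_space" "e > 0"
  obtains w where "w \<in> smooth_solenoidal" "w \<in> L2_torus"
    "\<And>i. l2sq (\<lambda>x. complex_of_real (v x $ i) - complex_of_real (w x $ i)) < e"
proof -
  have v: "v \<in> L2_torus" using assms by (simp add: H_space_def)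
  have "sqrt e > 0" using \<open>e > 0\<close> by simp
  with assms(1) obtain w where w: "w \<in> smooth_solenoidal" "L2_norm (\<lambda>x. v x - w x) < sqrt e"
    unfolding H_space_def by blast
  have wL: "w \<in> L2_torus"
    using w(1) by (intro continuous_L2_torus smooth_on_UNIV_C1(1)) (auto simp: smooth_solenoidal_def)
  have vw: "(\<lambda>x. v x - w x) \<in> L2_torus" by (rule L2_torus_diff[OF v wL])
  have "l2sq (\<lambda>x. complex_of_real (v x $ i) - complex_of_real (w x $ i)) < e" for i
  proof -
    have "l2sq (\<lambda>x. complex_of_real ((v x - w x) $ i)) \<le> (L2_norm (\<lambda>x. v x - w x))\<^sup>2"
      unfolding L2_norm_sq[OF vw] by (rule member_le_sum) (auto simp: l2sq_nonneg)
    also have "\<dots> < (sqrt e)\<^sup>2"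
      by (rule power_strict_mono[OF w(2) L2_norm_nonneg[OF vw]]) simp
    finally show ?thesis using \<open>e > 0\<close> by simp
  qed
  then show ?thesis using that[OF w(1) wL] by blast
qed

lemma H_space_trig_approximable:
  assumes v: "v \<in> H_space"
  shows "trig_approximable (\<lambda>x. complex_of_real (v x $ i))"
  unfolding trig_approximable_def
proof (intro conjI allI impI)
  have vL: "v \<in> L2_torus" using v by (simp add: H_space_def)
  show sv: "sq_integrable (\<lambda>x. complex_of_real (v x $ i))"
    by (rule sq_integrable_component[OF vL])
  fix e :: real assume "e > 0"
  then have "e / 4 > 0" by simp
  from H_space_approx[OF v this] obtain w where w: "w \<in> smooth_solenoidal" "w \<in> L2_torus"
    "\<And>i. l2sq (\<lambda>x. complex_of_real (v x $ i) - complex_of_real (w x $ i)) < e / 4" by blast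
  have per: "periodic (\<lambda>x. w x $ i)" and cont: "continuous_on UNIV (\<lambda>x. w x $ i)"
    using w(1) smooth_on_UNIV_C1(1)[of w] by (auto simp: smooth_solenoidal_def periodic_def intro!: continuous_intros)
  obtain P where P: "P \<in> trig_poly" "\<And>x. norm (of_real (w x $ i) - P x) < sqrt (e / 4)"
    using trig_poly_dense[OF per cont, of "sqrt (e / 4)"] \<open>e > 0\<close> by auto
  have sw: "sq_integrable (\<lambda>x. complex_of_real (w x $ i))" by (rule sq_integrable_component[OF w(2)])
  have sP: "sq_integrable P" by (rule sq_integrable_trig_poly[OF P(1)])
  note s1 = sq_integrable_diff[OF sv sw] and s2 = sq_integrable_diff[OF sw sP] and s3 = sq_integrable_diff[OF sv sP]
  have "l2sq (\<lambda>x. of_real (w x $ i) - P x) \<le> (LINT x|torus. e / 4)"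
    unfolding l2sq_def
  proof (rule integral_mono)
    fix x
    have "(norm (of_real (w x $ i) - P x))\<^sup>2 \<le> (sqrt (e / 4))\<^sup>2"
      by (intro power_mono less_imp_le[OF P(2)]) simp
    then show "(norm (of_real (w x $ i) - P x))\<^sup>2 \<le> e / 4" using \<open>e > 0\<close> by simp
  qed (use s2 in \<open>auto simp: sq_integrable_def\<close>)
  then have le: "l2sq (\<lambda>x. of_real (w x $ i) - P x) \<le> e / 4" by simp
  have "l2sq (\<lambda>x. of_real (v x $ i) - P x) \<le>
    (LINT x|torus. 2 * (norm (complex_of_real (v x $ i) - complex_of_real (w x $ i)))\<^sup>2 + 2 * (norm (of_real (w x $ i) - P x))\<^sup>2)"
    unfolding l2sq_def
  proof (rule integral_mono)
    fix x
    let ?a = "complex_of_real (v x $ i) - complex_of_real (w x $ i)" and ?b = "of_real (w x $ i) - P x"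
    have "(norm (of_real (v x $ i) - P x))\<^sup>2 = (norm (?a + ?b))\<^sup>2" by simp
    also have "\<dots> \<le> 2 * (norm ?a)\<^sup>2 + 2 * (norm ?b)\<^sup>2" by (rule power2_norm_add_le)
    finally show "(norm (of_real (v x $ i) - P x))\<^sup>2 \<le> 2 * (norm ?a)\<^sup>2 + 2 * (norm ?b)\<^sup>2" .
  qed (use s1 s2 s3 in \<open>auto simp: sq_integrable_def simp del: of_real_diff\<close>)
  also have "\<dots> = 2 * l2sq (\<lambda>x. complex_of_real (v x $ i) - complex_of_real (w x $ i)) + 2 * l2sq (\<lambda>x. of_real (w x $ i) - P x)"
    unfolding l2sq_def using s1 s2 by (simp add: sq_integrable_def del: of_real_diff)
  also have "\<dots> < e" using w(3)[of i] le by simp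
  finally show "\<exists>P\<in>trig_poly. l2sq (\<lambda>x. of_real (v x $ i) - P x) < e" using P(1) by blast
qed

text \<open>Fields in \<open>H_space\<close> have coefficients orthogonal to the frequency and mean value zero: both properties pass to
  the \<open>L\<^sup>2\<close> limit of smooth solenoidal fields.\<close>

lemma H_space_fourier:
  assumes v: "v \<in> H_space" and k: "k \<in> int_lattice"
  shows "(\<Sum>j\<in>UNIV. complex_of_real (k $ j) * vfourier v k $ j) = 0"
    and "vfourier v 0 = 0"
proof -
  have vL: "v \<in> L2_torus" using v by (simp add: H_space_def)
  have close: "\<exists>w\<in>smooth_solenoidal. \<forall>l\<in>int_lattice. \<forall>i. norm (vfourier v l $ i - vfourier w l $ i) \<le> e" if "e > 0" for e
  proof -
    have "e\<^sup>2 > 0" using that by simp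
    from H_space_approx[OF v this] obtain w where w: "w \<in> smooth_solenoidal" "w \<in> L2_torus"
      "\<And>i. l2sq (\<lambda>x. complex_of_real (v x $ i) - complex_of_real (w x $ i)) < e\<^sup>2" by blast
    have "norm (vfourier v l $ i - vfourier w l $ i) \<le> e" if l: "l \<in> int_lattice" for l i
    proof -
      note s = sq_integrable_component[OF vL, of i] sq_integrable_component[OF w(2), of i]
      have "(norm (vfourier v l $ i - vfourier w l $ i))\<^sup>2 \<le> e\<^sup>2"
        using fourier_le_l2sq[OF sq_integrable_diff[OF s] l] w(3)[of i]
        by (simp only: vfourier_nth fourier_diff[OF s, symmetric])
      then show ?thesis using \<open>e > 0\<close> by (simp add: abs_le_square_iff[symmetric])
    qed
    then show ?thesis using w(1) by blast
  qed
  show "(\<Sum>j\<in>UNIV. complex_of_real (k $ j) * vfourier v k $ j) = 0" (is "?s = 0")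
  proof -
    have "norm ?s \<le> (\<Sum>j\<in>UNIV. \<bar>k $ j\<bar>) * e" if "e > 0" for e
    proof -
      obtain w where w: "w \<in> smooth_solenoidal" "\<And>l i. l \<in> int_lattice \<Longrightarrow> norm (vfourier v l $ i - vfourier w l $ i) \<le> e"
        using close[OF \<open>e > 0\<close>] by blast
      have "?s = (\<Sum>j\<in>UNIV. complex_of_real (k $ j) * (vfourier v k $ j - vfourier w k $ j))"
        using smooth_solenoidal_fourier[OF w(1) k] by (simp add: right_diff_distrib sum_subtractf)
      also have "norm \<dots> \<le> (\<Sum>j\<in>UNIV. \<bar>k $ j\<bar> * e)"
        by (intro sum_norm_le) (auto simp: norm_mult intro!: mult_left_mono w k)
      finally show ?thesis by (simp add: sum_distrib_right)
    qed
    then have "norm ?s \<le> e" if "e > 0" for e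
    proof -
      let ?c = "(\<Sum>j\<in>UNIV. \<bar>k $ j\<bar>)"
      have c: "?c \<ge> 0" by (simp add: sum_nonneg)
      have "norm ?s \<le> ?c * (e / (?c + 1))" using \<open>\<And>e. e > 0 \<Longrightarrow> norm ?s \<le> ?c * e\<close>[of "e / (?c + 1)"] c that by simp
      also have "\<dots> = e * (?c / (?c + 1))" by simp
      also have "\<dots> \<le> e * 1"
        using c that divide_le_eq_1_pos[of "?c + 1" ?c] by (intro mult_left_mono) linarith+
      also have "\<dots> = e" by simp
      finally show ?thesis .
    qed
    then have "norm ?s \<le> 0" by (rule field_le_epsilon[of _ 0, simplified])
    then show ?thesis by simp
  qed
  show "vfourier v 0 = 0"
  proof -
    have "norm (vfourier v 0 $ i) \<le> e" if "e > 0" for i e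
    proof -
      obtain w where w: "w \<in> smooth_solenoidal" "\<And>l i. l \<in> int_lattice \<Longrightarrow> norm (vfourier v l $ i - vfourier w l $ i) \<le> e"
        using close[OF \<open>e > 0\<close>] by blast
      show ?thesis using w(2)[of 0 i] smooth_solenoidal_fourier_0[OF w(1)] by simp
    qed
    then have "norm (vfourier v 0 $ i) \<le> 0" for i by (rule field_le_epsilon[of _ 0, simplified])
    then show ?thesis by (simp add: vec_eq_iff)
  qed
qed

lemma has_sum_finite_sum:
  fixes f :: "'i \<Rightarrow> 'a \<Rightarrow> 'b::topological_comm_monoid_add"
  assumes "finite I" "\<And>i. i \<in> I \<Longrightarrow> (f i has_sum s i) A"
  shows "((\<lambda>x. \<Sum>i\<in>I. f i x) has_sum (\<Sum>i\<in>I. s i)) A"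
  using assms by induction (auto intro!: has_sum_add)

lemma H_space_parseval:
  assumes v: "v \<in> H_space"
  shows "((\<lambda>k. (norm (vfourier v k))\<^sup>2) has_sum (L2_norm v)\<^sup>2) int_lattice"
proof -
  have "v \<in> L2_torus" using v by (simp add: H_space_def)
  then show ?thesis unfolding norm_vec_sq vfourier_nth L2_norm_sq[OF \<open>v \<in> L2_torus\<close>]
    by (intro has_sum_finite_sum finite parseval H_space_trig_approximable v)
qed

section \<open>Plane waves and weak derivatives\<close>

text \<open>Real plane waves with a phase: a quarter period of phase turns the cosine into minus the sine, so
  that differentiation stays within the family.\<close>

definition wave :: "real^3 \<Rightarrow> real \<Rightarrow> real^3 \<Rightarrow> real" where
  "wave k \<alpha> x = cos (2 * pi * (k \<bullet> x) + \<alpha>)"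

text \<open>The real Fourier coefficient belonging to a plane wave.\<close>

definition wave_coeff :: "real^3 \<Rightarrow> real \<Rightarrow> (real^3 \<Rightarrow> real) \<Rightarrow> real" where
  "wave_coeff k \<alpha> f = (LINT x|torus. wave k \<alpha> x * f x)"

lemma wave_eq_Re: "wave k \<alpha> x = Re (cis \<alpha> * character k x)"
  by (simp add: wave_def character_def cos_add mult.commute)

lemma periodic_wave: "k \<in> int_lattice \<Longrightarrow> periodic (wave k \<alpha>)"
  using periodic_character[of k] by (simp add: periodic_def wave_eq_Re[abs_def])

lemma continuous_wave: "continuous_on S (wave k \<alpha>)"
  unfolding wave_def by (intro continuous_intros)

lemma borel_wave [measurable]: "wave k \<alpha> \<in> borel_measurable borel"
  by (intro borel_measurable_continuous_onI continuous_wave)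

lemma abs_wave_le: "\<bar>wave k \<alpha> x\<bar> \<le> 1"
  by (simp add: wave_def)

lemma wave_add_phase: "wave k (\<alpha> + \<beta>) x = cos \<beta> * wave k \<alpha> x + sin \<beta> * wave k (\<alpha> + pi / 2) x"
proof -
  have "cos (y + \<beta>) = cos \<beta> * cos y + sin \<beta> * cos (y + pi / 2)" for y
    by (simp add: cos_add)
  then show ?thesis unfolding wave_def by (simp only: add.assoc[symmetric])
qed

lemma character_uminus_wave: "character (- k) x = Complex (wave k 0 x) (wave k (pi / 2) x)"
  by (simp add: character_def wave_def complex_eq_iff cos_add)

lemma has_derivative_wave:
  "((\<lambda>x. c * wave k \<alpha> x) has_derivative (\<lambda>h. (2 * pi * (k \<bullet> h) * c) * wave k (\<alpha> + pi / 2) x)) (at x within S)"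
proof -
  have "wave k (\<alpha> + pi / 2) x = - sin (2 * pi * (k \<bullet> x) + \<alpha>)"
    by (simp add: wave_def add.assoc[symmetric] cos_add)
  then show ?thesis unfolding wave_def[of k \<alpha>]
    by (auto intro!: derivative_eq_intros simp: mult_ac)
qed

lemma frechet_derivative_wave:
  "frechet_derivative (\<lambda>x. c * wave k \<alpha> x) (at x) = (\<lambda>h. (2 * pi * (k \<bullet> h) * c) * wave k (\<alpha> + pi / 2) x)"
  by (rule frechet_derivative_at[OF has_derivative_wave, symmetric])

lemma partial_wave: "partial i (\<lambda>x. c * wave k \<alpha> x) = (\<lambda>x. (2 * pi * k $ i * c) * wave k (\<alpha> + pi / 2) x)"
  by (simp add: partial_def fun_eq_iff frechet_derivative_wave inner_axis)

lemma partial_funpow_wave: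
  "(partial i ^^ n) (\<lambda>x. c * wave k \<alpha> x) = (\<lambda>x. ((2 * pi * k $ i) ^ n * c) * wave k (\<alpha> + n * (pi / 2)) x)"
proof (induction n)
  case (Suc n)
  have "(partial i ^^ Suc n) (\<lambda>x. c * wave k \<alpha> x) = partial i ((partial i ^^ n) (\<lambda>x. c * wave k \<alpha> x))"
    by simp
  also have "\<dots> = (\<lambda>x. (2 * pi * k $ i * ((2 * pi * k $ i) ^ n * c)) * wave k (\<alpha> + n * (pi / 2) + pi / 2) x)"
    unfolding Suc by (rule partial_wave)
  finally show ?case by (simp add: algebra_simps add_divide_distrib)
qed simp

lemma Ck_on_wave: "Ck_on m UNIV (\<lambda>x. c * wave k \<alpha> x)"
proof (induction m arbitrary: c \<alpha>)
  case 0
  show ?case by (auto intro!: continuous_intros continuous_wave)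
next
  case (Suc m)
  have "(\<lambda>x. c * wave k \<alpha> x) differentiable_on UNIV"
    unfolding differentiable_on_def differentiable_def using has_derivative_wave by blast
  then show ?case using Suc by (simp add: frechet_derivative_wave)
qed

lemma smooth_on_wave: "smooth_on UNIV (wave k \<alpha>)"
  using Ck_on_wave[of _ 1 k \<alpha>] by (simp add: smooth_on_def)

text \<open>The multi-index of \<open>n\<close> derivatives in direction \<open>i\<close>.\<close>

definition axis_index :: "3 \<Rightarrow> nat \<Rightarrow> nat^3" where
  "axis_index i n = (\<chi> j. if j = i then n else 0)"

lemma mi_order_axis_index [simp]: "mi_order (axis_index i n) = n"
  by (simp add: mi_order_def axis_index_def)

lemma mpartial_axis_index: "mpartial (axis_index i n) f = (partial i ^^ n) f"
  using exhaust_3[of i] by (auto simp: mpartial_def axis_index_def)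

lemma wave_coeff_add_phase:
  assumes "sq_integrable (\<lambda>x. complex_of_real (f x))"
  shows "wave_coeff k (\<alpha> + \<beta>) f = cos \<beta> * wave_coeff k \<alpha> f + sin \<beta> * wave_coeff k (\<alpha> + pi / 2) f"
  and "integrable torus (\<lambda>x. wave k \<alpha> x * f x)"
proof -
  have int: "integrable torus (\<lambda>x. wave k \<alpha> x * f x)" for \<alpha>
  proof -
    have "sq_integrable (\<lambda>x. complex_of_real (wave k \<alpha> x))"
      by (rule sq_integrable_bounded[where B = 1]) (auto intro!: lebesgue_on_borelI simp: abs_wave_le)
    from integrable_mult_sq[OF this assms]
    have "integrable torus (\<lambda>x. complex_of_real (wave k \<alpha> x * f x))" by simp
    from integrable_Re[OF this] show ?thesis by simp
  qed
  show "integrable torus (\<lambda>x. wave k \<alpha> x * f x)" by (rule int)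
  have "wave_coeff k (\<alpha> + \<beta>) f = (LINT x|torus. cos \<beta> * (wave k \<alpha> x * f x) + sin \<beta> * (wave k (\<alpha> + pi / 2) x * f x))"
    unfolding wave_coeff_def wave_add_phase[of k \<alpha> \<beta>] by (simp only: distrib_right mult.assoc)
  also have "\<dots> = cos \<beta> * wave_coeff k \<alpha> f + sin \<beta> * wave_coeff k (\<alpha> + pi / 2) f"
    unfolding wave_coeff_def
    using int[of \<alpha>] int[of "\<alpha> + pi / 2"] by simp
  finally show "wave_coeff k (\<alpha> + \<beta>) f = cos \<beta> * wave_coeff k \<alpha> f + sin \<beta> * wave_coeff k (\<alpha> + pi / 2) f" .
qed

lemma fourier_wave_coeff:
  assumes "sq_integrable (\<lambda>x. complex_of_real (f x))"
  shows "fourier (\<lambda>x. complex_of_real (f x)) k = Complex (wave_coeff k 0 f) (wave_coeff k (pi / 2) f)"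
proof -
  have int: "integrable torus (\<lambda>x. complex_of_real (f x) * character (- k) x)"
    by (intro integrable_mult_sq assms sq_integrable_character)
  show ?thesis
    unfolding complex_eq_iff fourier_def wave_coeff_def
    using integral_Re[OF int] integral_Im[OF int] by (simp add: character_uminus_wave mult.commute)
qed

lemma norm_fourier_wave_coeff:
  assumes "sq_integrable (\<lambda>x. complex_of_real (f x))"
  shows "(norm (fourier (\<lambda>x. complex_of_real (f x)) k))\<^sup>2 = (wave_coeff k \<alpha> f)\<^sup>2 + (wave_coeff k (\<alpha> + pi / 2) f)\<^sup>2"
proof -
  let ?a = "wave_coeff k 0 f" and ?b = "wave_coeff k (pi / 2) f"
  have h: "wave_coeff k \<alpha> f = cos \<alpha> * ?a + sin \<alpha> * ?b"
    "wave_coeff k (\<alpha> + pi / 2) f = - sin \<alpha> * ?a + cos \<alpha> * ?b"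
    using wave_coeff_add_phase(1)[OF assms, of k 0 \<alpha>] wave_coeff_add_phase(1)[OF assms, of k 0 "\<alpha> + pi / 2"]
    by (simp_all add: cos_add sin_add)
  then have "(wave_coeff k \<alpha> f)\<^sup>2 + (wave_coeff k (\<alpha> + pi / 2) f)\<^sup>2 = ((cos \<alpha>)\<^sup>2 + (sin \<alpha>)\<^sup>2) * (?a\<^sup>2 + ?b\<^sup>2)"
  proof -
    have "(c * A + s * B)\<^sup>2 + (- s * A + c * B)\<^sup>2 = (c\<^sup>2 + s\<^sup>2) * (A\<^sup>2 + B\<^sup>2)" for c s A B :: real
      by (simp add: power2_eq_square algebra_simps)
    then show ?thesis by (simp only: h)
  qed
  then show ?thesis by (simp add: fourier_wave_coeff[OF assms] cmod_power2)
qed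

text \<open>A weak derivative multiplies the Fourier coefficients by powers of the frequency, up to a factor of modulus
  one that the norms do not see.\<close>

lemma weak_partial_fourier:
  assumes v: "v \<in> L2_torus" and w: "is_weak_partial (axis_index i n) v w" and k: "k \<in> int_lattice"
  shows "(norm (vfourier w k))\<^sup>2 = ((2 * pi * k $ i) ^ n)\<^sup>2 * (norm (vfourier v k))\<^sup>2"
proof -
  have wL: "w \<in> L2_torus" using w by (simp add: is_weak_partial_def)
  have integrable: "integrable torus (\<lambda>x. wave k \<alpha> x *\<^sub>R z x)" if "z \<in> L2_torus" for \<alpha> and z :: "real^3 \<Rightarrow> real^3"
  proof -
    have "integrable torus (\<lambda>x. \<Sum>l\<in>UNIV. (wave k \<alpha> x * z x $ l) *\<^sub>R (axis l 1 :: real^3))"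
      by (intro Bochner_Integration.integrable_sum integrable_scaleR_left
          wave_coeff_add_phase(2) sq_integrable_component that)
    moreover have "(\<Sum>l\<in>UNIV. (wave k \<alpha> x * z x $ l) *\<^sub>R (axis l 1 :: real^3)) = wave k \<alpha> x *\<^sub>R z x" for x
      by (simp add: vec_eq_iff axis_def if_distrib cong: if_cong)
    ultimately show ?thesis by simp
  qed
  have component: "(LINT x|torus. wave k \<alpha> x *\<^sub>R z x) $ l = wave_coeff k \<alpha> (\<lambda>x. z x $ l)" if "z \<in> L2_torus" for \<alpha> and l :: 3 and z :: "real^3 \<Rightarrow> real^3"
    using integral_bounded_linear[OF bounded_linear_vec_nth[of l] integrable[OF that, of \<alpha>]]
    by (simp add: wave_coeff_def)
  let ?b = "(2 * pi * k $ i) ^ n"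
  have eq: "?b * wave_coeff k (\<alpha> + n * (pi / 2)) (\<lambda>x. v x $ l) = (-1) ^ n * wave_coeff k \<alpha> (\<lambda>x. w x $ l)" for \<alpha> l
  proof -
    have "(LINT x|torus. mpartial (axis_index i n) (wave k \<alpha>) x *\<^sub>R v x) = (-1) ^ n *\<^sub>R (LINT x|torus. wave k \<alpha> x *\<^sub>R w x)"
      using w periodic_wave[OF k, of \<alpha>] smooth_on_wave[of k \<alpha>] by (simp add: is_weak_partial_def)
    moreover have "mpartial (axis_index i n) (wave k \<alpha>) = (\<lambda>x. ?b * wave k (\<alpha> + n * (pi / 2)) x)"
      using partial_funpow_wave[of n i 1 k \<alpha>] by (simp only: mpartial_axis_index mult_1_left mult_1_right)
    ultimately have "?b *\<^sub>R (LINT x|torus. wave k (\<alpha> + n * (pi / 2)) x *\<^sub>R v x) = (-1) ^ n *\<^sub>R (LINT x|torus. wave k \<alpha> x *\<^sub>R w x)"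
      by (simp only: scaleR_scaleR[symmetric] integral_scaleR_right)
    then have "(?b *\<^sub>R (LINT x|torus. wave k (\<alpha> + n * (pi / 2)) x *\<^sub>R v x)) $ l = ((-1) ^ n *\<^sub>R (LINT x|torus. wave k \<alpha> x *\<^sub>R w x)) $ l"
      by simp
    then show ?thesis by (simp only: vector_scaleR_component component[OF v] component[OF wL] real_scaleR_def)
  qed
  have sq: "(wave_coeff k \<alpha> (\<lambda>x. w x $ l))\<^sup>2 = ?b\<^sup>2 * (wave_coeff k (\<alpha> + n * (pi / 2)) (\<lambda>x. v x $ l))\<^sup>2" for \<alpha> l
  proof -
    have "(?b * wave_coeff k (\<alpha> + n * (pi / 2)) (\<lambda>x. v x $ l))\<^sup>2 = ((-1) ^ n)\<^sup>2 * (wave_coeff k \<alpha> (\<lambda>x. w x $ l))\<^sup>2"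
      unfolding eq by (rule power_mult_distrib)
    moreover have "((-1) ^ n)\<^sup>2 = (1 :: real)" by (simp flip: power_mult)
    ultimately show ?thesis by (simp only: power_mult_distrib mult_1_left)
  qed
  have "(norm (vfourier w k $ l))\<^sup>2 = ?b\<^sup>2 * (norm (vfourier v k $ l))\<^sup>2" for l
  proof -
    have "(norm (vfourier w k $ l))\<^sup>2 = (wave_coeff k 0 (\<lambda>x. w x $ l))\<^sup>2 + (wave_coeff k (0 + pi / 2) (\<lambda>x. w x $ l))\<^sup>2"
      unfolding vfourier_nth by (rule norm_fourier_wave_coeff[OF sq_integrable_component[OF wL]])
    also have "\<dots> = ?b\<^sup>2 * ((wave_coeff k (n * (pi / 2)) (\<lambda>x. v x $ l))\<^sup>2 + (wave_coeff k (n * (pi / 2) + pi / 2) (\<lambda>x. v x $ l))\<^sup>2)"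
      by (simp only: sq distrib_left add.commute add_0)
    also have "\<dots> = ?b\<^sup>2 * (norm (vfourier v k $ l))\<^sup>2"
      unfolding vfourier_nth
      by (simp only: norm_fourier_wave_coeff[OF sq_integrable_component[OF v], of l k "n * (pi / 2)"])
    finally show ?thesis .
  qed
  then show ?thesis unfolding norm_vec_sq sum_distrib_left by (intro sum.cong refl)
qed

section \<open>Fractional Sobolev norms in terms of Fourier coefficients\<close>

lemma null_sets_torus_periodic:
  assumes "N \<in> null_sets lborel"
  shows "AE x in lborel. frac_part x \<notin> N"
proof -
  have Nb: "N \<in> sets borel" using assms by auto
  have "(\<Union>z\<in>int_lattice. {x. x + z \<in> N}) \<in> null_sets lborel"
  proof (intro null_sets_UN' countable_int_lattice)
    fix z :: "real^3"
    have "(\<lambda>x. x + z) -` N \<inter> space borel \<in> sets borel"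
      by (rule measurable_sets[OF _ Nb]) simp
    then have "{x. x + z \<in> N} \<in> sets borel" by (simp add: vimage_def)
    then show "{x. x + z \<in> N} \<in> null_sets lborel"
      using assms emeasure_lborel_shift[OF Nb, of z] by (auto simp: null_sets_def)
  qed
  moreover have "{x. frac_part x \<in> N} \<subseteq> (\<Union>z\<in>int_lattice. {x. x + z \<in> N})"
  proof
    fix x assume "x \<in> {x. frac_part x \<in> N}"
    then have "x + - (x - frac_part x) \<in> N" by simp
    then show "x \<in> (\<Union>z\<in>int_lattice. {x. x + z \<in> N})"
      using int_lattice_uminus[OF frac_part_diff_lattice[of x]] by blast
  qed
  ultimately show ?thesis
    by (intro AE_I'[of "\<Union>z\<in>int_lattice. {x. x + z \<in> N}"]) auto
qed

text \<open>A Lebesgue measurable periodic field agrees almost everywhere with a Borel measurable one that is exactly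
  periodic: a Borel representative on the fundamental domain is extended periodically.\<close>

lemma periodic_borel_representative:
  fixes w :: "real^3 \<Rightarrow> real^3"
  assumes "periodic w" "w \<in> borel_measurable lebesgue"
  obtains w' where "periodic w'" "w' \<in> borel_measurable borel" "AE x in lborel. w x = w' x"
proof -
  have "\<exists>g. g \<in> borel_measurable lborel \<and> (AE x in lborel. w x $ i = g x)" for i
  proof -
    have "(\<lambda>x. w x $ i) \<in> borel_measurable lebesgue"
      by (rule measurable_compose[OF assms(2)]) (intro borel_measurable_continuous_onI continuous_intros)
    then show ?thesis using completion_ex_borel_measurable_real[of "\<lambda>x. w x $ i" lborel] by blast
  qed
  then obtain g where g: "\<And>i. g i \<in> borel_measurable lborel" "\<And>i. AE x in lborel. w x $ i = g i x"
    by metis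
  define w' where "w' x = (\<chi> i. g i (frac_part x))" for x
  have "AE x in lborel. \<forall>i. w x $ i = g i x"
  proof -
    have "AE x in lborel. \<forall>i\<in>UNIV. w x $ i = g i x"
      by (subst AE_finite_all) (use g(2) in auto)
    then show ?thesis by simp
  qed
  then obtain N where N: "\<And>x. x \<in> space lborel - N \<Longrightarrow> \<forall>i. w x $ i = g i x" "N \<in> null_sets lborel"
    using AE_E3 by blast
  have "AE x in lborel. w x = w' x"
    using null_sets_torus_periodic[OF N(2)]
  proof eventually_elim
    case (elim x)
    then have "w (frac_part x) $ i = g i (frac_part x)" for i using N(1) by simp
    then show ?case by (simp add: vec_eq_iff w'_def periodic_frac_part[OF assms(1)])
  qed
  moreover have "periodic w'"
    by (simp add: periodic_def w'_def frac_part_add_lattice)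
  moreover have "w' \<in> borel_measurable borel"
  proof (subst borel_measurable_euclidean_space, intro ballI)
    fix b :: "real^3" assume "b \<in> Basis"
    then obtain i where "b = axis i 1" by (auto simp: Basis_vec_def)
    then have "(\<lambda>x. w' x \<bullet> b) = (\<lambda>x. g i (frac_part x))" by (simp add: w'_def inner_axis)
    moreover have "(\<lambda>x. g i (frac_part x)) \<in> borel_measurable borel"
      using g(1)[of i] by (intro measurable_compose[OF frac_part_borel]) simp
    ultimately show "(\<lambda>x. w' x \<bullet> b) \<in> borel_measurable borel" by simp
  qed
  ultimately show ?thesis by (intro that)
qed

text \<open>An integral over \<open>[0,1]\<^sup>3 \<times> [0,1]\<^sup>3\<close> for the completed product measure as an iterated integral, for an
  integrand \<open>G\<close> that agrees with a Borel function \<open>F\<close> off a null set of either variable.\<close>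

lemma nn_integral_torus_square:
  assumes F: "F \<in> borel_measurable borel"
    and G: "AE x in lborel. P x"
      "\<And>x y. P x \<Longrightarrow> P y \<Longrightarrow> G (x, y) = F (x, y)"
  shows "(\<integral>\<^sup>+z. G z \<partial>lebesgue_on (unit_cube \<times> unit_cube)) = (\<integral>\<^sup>+x. \<integral>\<^sup>+y. F (x, y) \<partial>torus_borel \<partial>torus_borel)"
proof -
  have ae: "AE x in lborel. P x \<and> (x \<in> unit_cube \<longrightarrow> x \<in> half_open_cube)"
    using G(1) AE_half_open_cube unfolding AE_completion_iff by eventually_elim auto
  obtain N where N': "\<And>x. x \<in> space lborel - N \<Longrightarrow> P x \<and> (x \<in> unit_cube \<longrightarrow> x \<in> half_open_cube)"
    and N: "N \<in> null_sets lborel"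
    using AE_E3[OF ae] by blast
  have "N \<times> UNIV \<in> null_sets (lborel \<Otimes>\<^sub>M lborel)" "UNIV \<times> N \<in> null_sets (lborel \<Otimes>\<^sub>M lborel)"
    using N by (auto simp: null_sets_def lborel.emeasure_pair_measure_Times)
  then have null: "N \<times> UNIV \<union> UNIV \<times> N \<in> null_sets (lborel :: ((real^3) \<times> (real^3)) measure)"
    unfolding lborel_prod by (rule null_sets.Un)
  have ae2: "AE z in lborel. G z * indicator (unit_cube \<times> unit_cube) z = F z * indicator (half_open_cube \<times> half_open_cube) z"
  proof (rule AE_I'[OF null], rule subsetI, rule ccontr)
    fix z assume z: "z \<in> {z \<in> space lborel. G z * indicator (unit_cube \<times> unit_cube) z \<noteq> F z * indicator (half_open_cube \<times> half_open_cube) z}"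
      "z \<notin> N \<times> UNIV \<union> UNIV \<times> N"
    obtain x y where xy: "z = (x, y)" by force
    have x: "P x \<and> (x \<in> unit_cube \<longrightarrow> x \<in> half_open_cube)" "P y \<and> (y \<in> unit_cube \<longrightarrow> y \<in> half_open_cube)"
      using z(2) N'[of x] N'[of y] unfolding xy by auto
    have "indicator (unit_cube \<times> unit_cube) z = (indicator (half_open_cube \<times> half_open_cube) z :: ennreal)"
      using x half_open_cube_subset unfolding xy by (auto simp: indicator_def)
    then show False using z(1) G(2)[of x y] x unfolding xy by simp
  qed
  have S: "unit_cube \<times> unit_cube \<in> sets (borel :: ((real^3) \<times> (real^3)) measure)"
    by (intro borel_closed closed_Times) (auto simp: unit_cube_def)
  have "(\<integral>\<^sup>+z. G z \<partial>lebesgue_on (unit_cube \<times> unit_cube)) = (\<integral>\<^sup>+z. G z * indicator (unit_cube \<times> unit_cube) z \<partial>lebesgue)"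
    using S by (subst nn_integral_restrict_space) auto
  also have "\<dots> = (\<integral>\<^sup>+z. G z * indicator (unit_cube \<times> unit_cube) z \<partial>lborel)"
    by (rule nn_integral_completion)
  also have "\<dots> = (\<integral>\<^sup>+z. F z * indicator (half_open_cube \<times> half_open_cube) z \<partial>lborel)"
    by (rule nn_integral_cong_AE[OF ae2])
  also have "\<dots> = (\<integral>\<^sup>+z. F z * indicator (half_open_cube \<times> half_open_cube) z \<partial>(lborel \<Otimes>\<^sub>M lborel))"
    by (simp only: lborel_prod)
  also have "\<dots> = (\<integral>\<^sup>+x. \<integral>\<^sup>+y. F (x, y) * indicator (half_open_cube \<times> half_open_cube) (x, y) \<partial>lborel \<partial>lborel)"
  proof (rule lborel.nn_integral_fst[symmetric])
    have "half_open_cube \<times> half_open_cube \<in> sets (lborel \<Otimes>\<^sub>M lborel :: ((real^3) \<times> (real^3)) measure)"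
      by (intro pair_measureI) auto
    then have [measurable]: "half_open_cube \<times> half_open_cube \<in> sets (borel :: ((real^3) \<times> (real^3)) measure)"
      unfolding lborel_prod sets_lborel .
    show "(\<lambda>z. F z * indicator (half_open_cube \<times> half_open_cube) z) \<in> borel_measurable (lborel \<Otimes>\<^sub>M lborel)"
      unfolding lborel_prod using F by simp
  qed
  also have "\<dots> = (\<integral>\<^sup>+x. (\<integral>\<^sup>+y. F (x, y) \<partial>torus_borel) * indicator half_open_cube x \<partial>lborel)"
  proof (rule nn_integral_cong)
    fix x :: "real^3"
    have "(\<integral>\<^sup>+y. F (x, y) * indicator (half_open_cube \<times> half_open_cube) (x, y) \<partial>lborel)
       = (\<integral>\<^sup>+y. (F (x, y) * indicator half_open_cube y) * indicator half_open_cube x \<partial>lborel)"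
      by (intro nn_integral_cong) (simp add: indicator_times mult_ac)
    also have "\<dots> = (\<integral>\<^sup>+y. F (x, y) * indicator half_open_cube y \<partial>lborel) * indicator half_open_cube x"
    proof (rule nn_integral_multc)
      have "(\<lambda>y. (x, y)) \<in> borel_measurable borel"
        by (intro borel_measurable_continuous_onI continuous_intros)
      from measurable_compose[OF this F]
      show "(\<lambda>y. F (x, y) * indicator half_open_cube y) \<in> borel_measurable lborel" by simp
    qed
    also have "(\<integral>\<^sup>+y. F (x, y) * indicator half_open_cube y \<partial>lborel) = (\<integral>\<^sup>+y. F (x, y) \<partial>torus_borel)"
      unfolding torus_borel_def by (subst nn_integral_restrict_space) auto
    finally show "(\<integral>\<^sup>+y. F (x, y) * indicator (half_open_cube \<times> half_open_cube) (x, y) \<partial>lborel)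
       = (\<integral>\<^sup>+y. F (x, y) \<partial>torus_borel) * indicator half_open_cube x" .
  qed
  also have "\<dots> = (\<integral>\<^sup>+x. \<integral>\<^sup>+y. F (x, y) \<partial>torus_borel \<partial>torus_borel)"
    unfolding torus_borel_def by (subst (2) nn_integral_restrict_space) auto
  finally show ?thesis .
qed

text \<open>Near \<open>k / (2 |k|\<^sup>2)\<close> the character with frequency \<open>k\<close> has nonpositive real part, and the points there have
  positive distance at most \<open>1 / |k|\<close> from the lattice.  Positivity matters because the quotient is zero at
  distance zero by convention.\<close>

lemma gagliardo_kernel_lower:
  assumes k: "k \<in> int_lattice" "k \<noteq> 0" and p: "p > 0"
    and h: "\<And>i. \<bar>h $ i - k $ i / (2 * (norm k)\<^sup>2)\<bar> \<le> 1 / (16 * norm k)"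
  shows "norm k powr p \<le> (norm (character k h - 1))\<^sup>2 / infdist h int_lattice powr p"
proof -
  let ?h0 = "(1 / (2 * (norm k)\<^sup>2)) *\<^sub>R k"
  have nk: "norm k > 0" using k(2) by simp
  have "norm (h - ?h0) \<le> (\<Sum>i\<in>UNIV. \<bar>(h - ?h0) $ i\<bar>)" by (rule norm_le_l1_cart)
  also have "\<dots> \<le> (\<Sum>i\<in>(UNIV::3 set). 1 / (16 * norm k))"
    using h by (intro sum_mono) simp
  finally have d: "norm (h - ?h0) \<le> 3 / (16 * norm k)" by simp
  have "norm ?h0 = 1 / (2 * norm k)" using nk by (simp add: power2_eq_square)
  then have nh: "norm h \<le> 1 / norm k"
    using norm_triangle_sub[of h ?h0] d nk by (simp add: field_simps)
  have kh0: "k \<bullet> ?h0 = 1 / 2" using nk by (simp add: power2_norm_eq_inner)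
  have "\<bar>k \<bullet> (h - ?h0)\<bar> \<le> norm k * norm (h - ?h0)" by (rule Cauchy_Schwarz_ineq2)
  also have "\<dots> \<le> norm k * (3 / (16 * norm k))" by (intro mult_left_mono d) simp
  also have "\<dots> = 3 / 16" using nk by simp
  finally have kh: "\<bar>k \<bullet> h - 1 / 2\<bar> \<le> 3 / 16" by (simp only: inner_diff_right kh0)
  have "cos (2 * pi * (k \<bullet> h) - pi) \<ge> 0"
  proof (rule cos_ge_zero)
    have "- (1 / 2) \<le> 2 * (k \<bullet> h) - 1" "2 * (k \<bullet> h) - 1 \<le> 1 / 2" using kh by linarith+
    then have "pi * - (1 / 2) \<le> pi * (2 * (k \<bullet> h) - 1)" "pi * (2 * (k \<bullet> h) - 1) \<le> pi * (1 / 2)"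
      by (intro mult_left_mono; simp)+
    then show "- (pi / 2) \<le> 2 * pi * (k \<bullet> h) - pi" "2 * pi * (k \<bullet> h) - pi \<le> pi / 2"
      by (simp_all add: algebra_simps)
  qed
  then have "Re (character k h) \<le> 0" by (simp add: character_def cos_diff)
  then have "1 \<le> \<bar>Re (character k h - 1)\<bar>" by simp
  also have "\<dots> \<le> norm (character k h - 1)" by (rule abs_Re_le_cmod)
  finally have c: "1 \<le> (norm (character k h - 1))\<^sup>2" by simp
  have "infdist h int_lattice \<le> dist h 0" by (rule infdist_le) simp
  then have up: "infdist h int_lattice \<le> 1 / norm k" using nh by simp
  have "5 / (16 * norm k) \<le> dist h z" if z: "z \<in> int_lattice" for z
  proof -
    obtain n :: int where n: "k \<bullet> z = of_int n" using inner_int_lattice[OF k(1) z] by (auto elim: Ints_cases)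
    have "\<bar>1 / 2 - real_of_int n\<bar> \<ge> 1 / 2"
    proof (cases "n \<le> 0")
      case True then have "real_of_int n \<le> 0" by simp then show ?thesis by simp
    next
      case False then have "real_of_int n \<ge> 1" by simp then show ?thesis by simp
    qed
    then have "5 / 16 \<le> \<bar>k \<bullet> (h - z)\<bar>" using kh unfolding inner_diff_right n by linarith
    also have "\<dots> \<le> norm k * norm (h - z)" by (rule Cauchy_Schwarz_ineq2)
    finally show ?thesis using nk by (simp add: field_simps dist_norm)
  qed
  then have "5 / (16 * norm k) \<le> infdist h int_lattice"
  proof -
    have ne: "int_lattice \<noteq> {}" using zero_int_lattice by blast
    show ?thesis using ne \<open>\<And>z. z \<in> int_lattice \<Longrightarrow> 5 / (16 * norm k) \<le> dist h z\<close>
      by (simp add: infdist_def cINF_greatest)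
  qed
  moreover have "5 / (16 * norm k) > 0" using nk by simp
  ultimately have pos: "infdist h int_lattice > 0" by linarith
  have "infdist h int_lattice powr p \<le> (1 / norm k) powr p"
    using up p pos by (intro powr_mono2) auto
  also have "\<dots> = 1 / norm k powr p" using nk by (simp add: powr_divide)
  finally have "infdist h int_lattice powr p * norm k powr p \<le> 1" using nk by (simp add: field_simps)
  then have "norm k powr p \<le> 1 / infdist h int_lattice powr p" using pos by (simp add: field_simps)
  also have "\<dots> \<le> (norm (character k h - 1))\<^sup>2 / infdist h int_lattice powr p"
    using c by (intro divide_right_mono) auto
  finally show ?thesis .
qed

lemma infdist_int_lattice_periodic:
  assumes "z \<in> int_lattice"
  shows "infdist (x + z) int_lattice = infdist x int_lattice"
proof -
  have "dist (x + z) ` int_lattice = dist x ` int_lattice"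
  proof (intro equalityI subsetI)
    fix r assume "r \<in> dist (x + z) ` int_lattice"
    then obtain y where "y \<in> int_lattice" "r = dist (x + z) y" by auto
    then show "r \<in> dist x ` int_lattice"
      using int_lattice_diff[of y z] assms by (intro image_eqI[of _ _ "y - z"]) (auto simp: dist_norm algebra_simps)
  next
    fix r assume "r \<in> dist x ` int_lattice"
    then obtain y where "y \<in> int_lattice" "r = dist x y" by auto
    then show "r \<in> dist (x + z) ` int_lattice"
      using int_lattice_add[of y z] assms by (intro image_eqI[of _ _ "y + z"]) (auto simp: dist_norm algebra_simps)
  qed
  then show ?thesis by (simp add: infdist_def image_image)
qed

lemma infdist_int_lattice_uminus: "infdist (- x) int_lattice = infdist x int_lattice"
proof -
  have "dist (- x) ` int_lattice = dist x ` int_lattice" for x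
  proof -
    have "dist (- x) ` int_lattice \<subseteq> dist x ` int_lattice" for x :: "real^3"
    proof
      fix r assume "r \<in> dist (- x) ` int_lattice"
      then obtain y where "y \<in> int_lattice" "r = dist (- x) y" by auto
      moreover have "dist (- x) y = dist x (- y)"
        by (metis dist_minus minus_minus)
      ultimately show "r \<in> dist x ` int_lattice"
        using int_lattice_uminus[of y] by blast
    qed
    from this[of x] this[of "- x"] show ?thesis by simp
  qed
  from this[of x] show ?thesis by (simp add: infdist_def)
qed

lemma norm_int_lattice_ge_1:
  assumes "k \<in> int_lattice" "k \<noteq> 0" shows "1 \<le> norm k"
proof -
  obtain i where "k $ i \<noteq> 0" using assms(2) by (auto simp: vec_eq_iff)
  moreover have "k $ i \<in> \<int>" using assms(1) by (simp add: int_lattice_def)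
  ultimately have "1 \<le> \<bar>k $ i\<bar>" by (metis Ints_nonzero_abs_ge1)
  then show ?thesis using component_le_norm_cart[of k i] by linarith
qed

text \<open>Integrating the previous bound over a cube of side \<open>1 / (8 |k|)\<close>.  The cube need not lie in the
  fundamental domain, but a translate of it does.\<close>

lemma gagliardo_multiplier_lower:
  assumes k: "k \<in> int_lattice" "k \<noteq> 0" and p: "p > 0"
  shows "ennreal (norm k powr p / (8 * norm k) ^ 3)
    \<le> (\<integral>\<^sup>+h. ennreal ((norm (character k h - 1))\<^sup>2 / infdist h int_lattice powr p) \<partial>torus_borel)"
proof -
  let ?F = "\<lambda>h. ennreal ((norm (character k h - 1))\<^sup>2 / infdist h int_lattice powr p)"
  let ?h0 = "(1 / (2 * (norm k)\<^sup>2)) *\<^sub>R k" and ?r = "1 / (16 * norm k)"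
  let ?c = "?h0 - (\<chi> i. 1/2)" and ?B = "cbox (?h0 - (\<chi> i. ?r)) (?h0 + (\<chi> i. ?r))"
  have nk: "norm k \<ge> 1" by (rule norm_int_lattice_ge_1[OF k])
  have [measurable]: "(\<lambda>h. infdist h int_lattice) \<in> borel_measurable borel"
    by (intro borel_measurable_continuous_onI continuous_intros)
  have [measurable]: "?F \<in> borel_measurable borel"
    by measurable
  have perF: "periodic ?F"
    using periodic_character[OF k(1)] by (simp add: periodic_def infdist_int_lattice_periodic)
  have B: "h \<in> ?B \<longleftrightarrow> (\<forall>i. \<bar>h $ i - k $ i / (2 * (norm k)\<^sup>2)\<bar> \<le> ?r)" for h
  proof -
    have "(?h0 - (\<chi> i. ?r)) $ i \<le> h $ i \<and> h $ i \<le> (?h0 + (\<chi> i. ?r)) $ i \<longleftrightarrow> \<bar>h $ i - k $ i / (2 * (norm k)\<^sup>2)\<bar> \<le> ?r" for i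
      unfolding vector_minus_component vector_add_component vector_scaleR_component vec_lambda_beta real_scaleR_def
      by (simp only: abs_le_iff times_divide_eq_left mult_1_left) linarith
    then show ?thesis by (simp only: mem_box_cart)
  qed
  have sub: "{h. h + ?c \<in> ?B} \<subseteq> half_open_cube"
  proof
    fix h assume "h \<in> {h. h + ?c \<in> ?B}"
    then have "\<bar>h $ i - 1 / 2\<bar> \<le> ?r" for i unfolding mem_Collect_eq B by (simp add: algebra_simps)
    moreover have "?r \<le> 1 / 16" using nk by (intro frac_le) auto
    ultimately have "\<bar>h $ i - 1 / 2\<bar> \<le> 1 / 16" for i by (meson order_trans)
    then have "0 \<le> h $ i \<and> h $ i < 1" for i
    proof -
      from \<open>\<And>i. \<bar>h $ i - 1 / 2\<bar> \<le> 1 / 16\<close>[of i] show ?thesis by linarith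
    qed
    then show "h \<in> half_open_cube" by (simp add: half_open_cube_def)
  qed
  have vol: "emeasure lborel ?B = ennreal (1 / (8 * norm k) ^ 3)"
  proof -
    have "emeasure lborel ?B = ennreal (\<Prod>b\<in>Basis. ((?h0 + (\<chi> i. ?r)) - (?h0 - (\<chi> i. ?r))) \<bullet> b)"
      using nk by (intro emeasure_lborel_cbox) (auto simp: Basis_vec_def inner_axis)
    also have "(\<Prod>b\<in>Basis. ((?h0 + (\<chi> i. ?r)) - (?h0 - (\<chi> i. ?r))) \<bullet> b) = (\<Prod>b\<in>(Basis :: (real^3) set). 1 / (8 * norm k))"
      by (intro prod.cong refl) (auto simp: Basis_vec_def inner_axis)
    also have "\<dots> = 1 / (8 * norm k) ^ 3"
      by (simp add: power_divide power_mult_distrib)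
    finally show ?thesis .
  qed
  have Bb: "?B \<in> sets borel" by simp
  have "ennreal (norm k powr p / (8 * norm k) ^ 3) = ennreal (norm k powr p) * emeasure lborel {h. h + ?c \<in> ?B}"
    unfolding emeasure_lborel_shift[OF Bb] vol by (simp add: ennreal_mult[symmetric])
  also have "\<dots> = (\<integral>\<^sup>+h. ennreal (norm k powr p) * indicator {h. h + ?c \<in> ?B} h \<partial>lborel)"
  proof (rule nn_integral_cmult_indicator[symmetric])
    have "(\<lambda>h. h + ?c) -` ?B \<inter> space borel \<in> sets borel" by (rule measurable_sets[OF _ Bb]) simp
    then show "{h. h + ?c \<in> ?B} \<in> sets lborel" by (simp add: vimage_def)
  qed
  also have "\<dots> \<le> (\<integral>\<^sup>+h. ?F (h + ?c) * indicator half_open_cube h \<partial>lborel)"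
  proof (rule nn_integral_mono)
    fix h
    show "ennreal (norm k powr p) * indicator {h. h + ?c \<in> ?B} h \<le> ?F (h + ?c) * indicator half_open_cube h"
    proof (cases "h + ?c \<in> ?B")
      case True
      then have "norm k powr p \<le> (norm (character k (h + ?c) - 1))\<^sup>2 / infdist (h + ?c) int_lattice powr p"
        using gagliardo_kernel_lower[OF k p, of "h + ?c"] B[of "h + ?c"] by blast
      moreover have "h \<in> half_open_cube" using sub True by blast
      ultimately show ?thesis using True by (simp add: ennreal_leI)
    qed (simp del: mem_box_cart)
  qed
  also have "\<dots> = (\<integral>\<^sup>+h. ?F (h + ?c) \<partial>torus_borel)"
    unfolding torus_borel_def by (subst nn_integral_restrict_space) auto
  also have "\<dots> = (\<integral>\<^sup>+h. ?F h \<partial>torus_borel)"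
    by (rule nn_integral_torus_shift[OF _ perF]) measurable
  finally show ?thesis .
qed

lemma AE_torusI: "AE x in lborel. P x \<Longrightarrow> AE x in torus. P x"
  by (subst AE_restrict_space_iff) (auto intro: AE_completion)

lemma vfourier_cong_AE:
  assumes "v \<in> L2_torus" "w \<in> L2_torus" "AE x in lborel. v x = w x"
  shows "vfourier v k = vfourier w k"
proof -
  have "vfourier v k $ i = vfourier w k $ i" for i
    unfolding vfourier_nth fourier_def
  proof (rule Bochner_Integration.integral_cong_AE)
    show "AE x in torus. complex_of_real (v x $ i) * character (- k) x = complex_of_real (w x $ i) * character (- k) x"
      using AE_torusI[OF assms(3)] by eventually_elim simp
  qed (use integrable_mult_sq[OF sq_integrable_component sq_integrable_character] assms in \<open>auto dest!: borel_measurable_integrable\<close>)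
  then show ?thesis by (simp add: vec_eq_iff)
qed

lemma nn_integral_L2_torus:
  assumes "v \<in> L2_torus"
  shows "(\<integral>\<^sup>+x. ennreal ((norm (v x))\<^sup>2) \<partial>torus) = ennreal ((L2_norm v)\<^sup>2)"
proof -
  have "L2_inner v v = (LINT x|torus. (norm (v x))\<^sup>2)"
    by (simp add: L2_inner_def power2_norm_eq_inner)
  moreover have "0 \<le> (LINT x|torus. (norm (v x))\<^sup>2)" by simp
  ultimately have "(L2_norm v)\<^sup>2 = (LINT x|torus. (norm (v x))\<^sup>2)" by (simp add: L2_norm_def)
  then show ?thesis using assms by (simp add: L2_torus_def nn_integral_eq_integral)
qed

lemma vbessel:
  assumes v: "v \<in> L2_torus" and K: "finite K" "K \<subseteq> int_lattice"
  shows "(\<Sum>k\<in>K. (norm (vfourier v k))\<^sup>2) \<le> (L2_norm v)\<^sup>2"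
proof -
  have "(\<Sum>k\<in>K. (norm (vfourier v k))\<^sup>2) = (\<Sum>i\<in>UNIV. \<Sum>k\<in>K. (norm (fourier (\<lambda>x. complex_of_real (v x $ i)) k))\<^sup>2)"
    unfolding norm_vec_sq vfourier_nth by (rule sum.swap)
  also have "\<dots> \<le> (L2_norm v)\<^sup>2"
    unfolding L2_norm_sq[OF v] by (intro sum_mono bessel sq_integrable_component v K)
  finally show ?thesis .
qed

lemma L2_torus_shift:
  fixes v :: "real^3 \<Rightarrow> real^3"
  assumes v: "v \<in> L2_torus" and b: "v \<in> borel_measurable borel"
  shows "(\<lambda>x. v (x + h)) \<in> L2_torus"
proof -
  have per: "periodic v" using v by (simp add: L2_torus_def)
  have b': "(\<lambda>x. v (x + h)) \<in> borel_measurable borel"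
    by (rule measurable_compose[OF _ b]) simp
  have nb: "(\<lambda>x. ennreal ((norm (v x))\<^sup>2)) \<in> borel_measurable borel" using b by simp
  have np: "periodic (\<lambda>x. ennreal ((norm (v x))\<^sup>2))" using per by (simp add: periodic_def)
  have "(\<integral>\<^sup>+x. ennreal ((norm (v (x + h)))\<^sup>2) \<partial>torus) = (\<integral>\<^sup>+x. ennreal ((norm (v x))\<^sup>2) \<partial>torus)"
    unfolding nn_integral_torus_borel by (rule nn_integral_torus_shift[OF nb np])
  also have "\<dots> < \<infinity>" unfolding nn_integral_L2_torus[OF v] by simp
  finally have "integrable torus (\<lambda>x. (norm (v (x + h)))\<^sup>2)"
    by (intro integrableI_bounded lebesgue_on_borelI) (use b' in auto)
  moreover have "periodic (\<lambda>x. v (x + h))"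
    unfolding periodic_def
  proof (intro allI ballI)
    fix x z :: "real^3" assume "z \<in> int_lattice"
    then show "v (x + z + h) = v (x + h)"
      using periodicD[OF per, of z "x + h"] by (simp add: add_ac)
  qed
  ultimately show ?thesis
    using b' by (auto simp: L2_torus_def intro: measurable_completion)
qed

lemma vfourier_shift:
  fixes v :: "real^3 \<Rightarrow> real^3"
  assumes v: "v \<in> L2_torus" and b: "v \<in> borel_measurable borel" and k: "k \<in> int_lattice"
  shows "vfourier (\<lambda>x. v (x + h)) k $ i = character k h * vfourier v k $ i"
proof -
  have per: "periodic v" using v by (simp add: L2_torus_def)
  let ?f = "\<lambda>x. complex_of_real (v x $ i) * character (- k) x"
  have vi: "(\<lambda>x. v x $ i) \<in> borel_measurable borel"
    by (rule measurable_compose[OF b]) (intro borel_measurable_continuous_onI continuous_intros)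
  have e: "character (- k) x = character k h * character (- k) (x + h)" for x
  proof -
    have "character k h * character (- k) h = 1" by (simp add: character_mult)
    then show ?thesis by (simp add: character_add mult_ac)
  qed
  have "vfourier (\<lambda>x. v (x + h)) k $ i = (LINT x|torus. character k h * ?f (x + h))"
    unfolding vfourier_nth fourier_def
  proof (rule Bochner_Integration.integral_cong[OF refl])
    fix x
    show "complex_of_real (v (x + h) $ i) * character (- k) x = character k h * ?f (x + h)"
      unfolding e[of x] by (rule mult.left_commute)
  qed
  also have "\<dots> = character k h * (LINT x|torus. ?f (x + h))" by simp
  also have "(LINT x|torus. ?f (x + h)) = (LINT x|torus. ?f x)"
  proof (rule integral_torus_shift)
    show "?f \<in> borel_measurable borel" using vi by measurable
    show "periodic ?f" using per periodic_character[OF int_lattice_uminus[OF k]] by (simp add: periodic_def)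
  qed
  finally show ?thesis by (simp add: vfourier_nth fourier_def)
qed

text \<open>Bessel's inequality for \<open>w(x + h) - w(x)\<close>, whose coefficients are \<open>(e\<^sub>k(h) - 1) w\<^sub>k\<close>, integrated
  against the Gagliardo kernel in \<open>h\<close>.\<close>

lemma gagliardo_fourier:
  fixes w :: "real^3 \<Rightarrow> real^3"
  assumes w: "w \<in> L2_torus" and \<theta>: "\<theta> > 0"
    and int: "integrable (lebesgue_on (unit_cube \<times> unit_cube)) (gagliardo_integrand \<theta> w)"
    and K: "finite K" "K \<subseteq> int_lattice"
  shows "(\<Sum>k\<in>K. norm k powr (2 * \<theta>) * (norm (vfourier w k))\<^sup>2) \<le> 512 * (gagliardo_seminorm \<theta> w)\<^sup>2"
proof -
  define p where "p = 3 + 2 * \<theta>"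
  have p: "p > 0" using \<theta> by (simp add: p_def)
  obtain w' where w': "periodic w'" "w' \<in> borel_measurable borel" "AE x in lborel. w x = w' x"
    using periodic_borel_representative[of w] w unfolding L2_torus_def by blast
  have w'L: "w' \<in> L2_torus"
  proof -
    have "integrable torus (\<lambda>x. (norm (w' x))\<^sup>2)"
    proof (rule integrable_cong_AE_imp)
      show "integrable torus (\<lambda>x. (norm (w x))\<^sup>2)" using w by (simp add: L2_torus_def)
      show "AE x in torus. (norm (w x))\<^sup>2 = (norm (w' x))\<^sup>2"
        using AE_torusI[OF w'(3)] by eventually_elim simp
      show "(\<lambda>x. (norm (w' x))\<^sup>2) \<in> borel_measurable torus"
        using w'(2) by (intro lebesgue_on_borelI) simp
    qed
    then show ?thesis using w' by (auto simp: L2_torus_def intro: measurable_completion)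
  qed
  have coeff: "vfourier w k = vfourier w' k" for k
    by (rule vfourier_cong_AE[OF w w'L w'(3)])
  define om where "om h = 1 / infdist h int_lattice powr p" for h
  have om0: "om h \<ge> 0" for h by (simp add: om_def)
  have [measurable]: "(\<lambda>h. infdist h int_lattice) \<in> borel_measurable borel"
    by (intro borel_measurable_continuous_onI continuous_intros)
  have omb [measurable]: "om \<in> borel_measurable borel" unfolding om_def by measurable
  define F where "F = (\<lambda>z :: (real^3) \<times> (real^3). ennreal ((norm (w' (fst z) - w' (snd z)))\<^sup>2 * om (fst z - snd z)))"
  have gF: "ennreal (gagliardo_integrand \<theta> w' (x, y)) = F (x, y)" for x y
    by (simp add: F_def gagliardo_integrand_def om_def torus_dist_def p_def)
  have Fb: "F \<in> borel_measurable borel"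
  proof -
    have f: "(fst :: (real^3) \<times> (real^3) \<Rightarrow> _) \<in> borel_measurable borel" "(snd :: (real^3) \<times> (real^3) \<Rightarrow> _) \<in> borel_measurable borel"
      by (intro borel_measurable_continuous_onI continuous_intros)+
    have "(\<lambda>z :: (real^3) \<times> (real^3). w' (fst z)) \<in> borel_measurable borel" "(\<lambda>z :: (real^3) \<times> (real^3). w' (snd z)) \<in> borel_measurable borel"
      "(\<lambda>z :: (real^3) \<times> (real^3). om (fst z - snd z)) \<in> borel_measurable borel"
      by (rule measurable_compose[OF f(1) w'(2)], rule measurable_compose[OF f(2) w'(2)],
          rule measurable_compose[OF borel_measurable_diff[OF f] omb])
    then show ?thesis unfolding F_def by simp
  qed
  have g0: "gagliardo_integrand \<theta> w z \<ge> 0" for z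
    by (auto simp: gagliardo_integrand_def split: prod.splits)
  have "ennreal ((gagliardo_seminorm \<theta> w)\<^sup>2) = ennreal (LINT z|lebesgue_on (unit_cube \<times> unit_cube). gagliardo_integrand \<theta> w z)"
    unfolding gagliardo_seminorm_def by (simp add: g0)
  also have "\<dots> = (\<integral>\<^sup>+z. ennreal (gagliardo_integrand \<theta> w z) \<partial>lebesgue_on (unit_cube \<times> unit_cube))"
    using int g0 by (intro nn_integral_eq_integral[symmetric]) auto
  also have "\<dots> = (\<integral>\<^sup>+x. \<integral>\<^sup>+y. F (x, y) \<partial>torus_borel \<partial>torus_borel)"
  proof (rule nn_integral_torus_square[OF Fb w'(3)])
    fix x y assume "w x = w' x" "w y = w' y"
    then show "ennreal (gagliardo_integrand \<theta> w (x, y)) = F (x, y)"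
      unfolding gF[symmetric] by (simp add: gagliardo_integrand_def)
  qed
  also have "\<dots> = (\<integral>\<^sup>+x. \<integral>\<^sup>+h. F (x, h + x) \<partial>torus_borel \<partial>torus_borel)"
  proof (rule nn_integral_cong)
    fix x :: "real^3"
    have "(\<lambda>y. (x, y)) \<in> borel_measurable borel"
      by (intro borel_measurable_continuous_onI continuous_intros)
    from measurable_compose[OF this Fb] have "(\<lambda>y. F (x, y)) \<in> borel_measurable borel" .
    moreover have "periodic (\<lambda>y. F (x, y))"
      unfolding periodic_def
    proof (intro allI ballI)
      fix y z :: "real^3" assume z: "z \<in> int_lattice"
      have "om (x - (y + z)) = om (x - y)"
        using infdist_int_lattice_periodic[OF int_lattice_uminus[OF z], of "x - y"]
        by (simp add: om_def algebra_simps)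
      then show "F (x, y + z) = F (x, y)" by (simp add: F_def periodicD[OF w'(1) z])
    qed
    ultimately show "(\<integral>\<^sup>+y. F (x, y) \<partial>torus_borel) = (\<integral>\<^sup>+h. F (x, h + x) \<partial>torus_borel)"
      by (rule nn_integral_torus_shift[symmetric])
  qed
  also have "\<dots> = (\<integral>\<^sup>+h. \<integral>\<^sup>+x. F (x, h + x) \<partial>torus_borel \<partial>torus_borel)"
  proof -
    interpret P: pair_sigma_finite torus_borel torus_borel ..
    have f: "fst \<in> borel_measurable (torus_borel \<Otimes>\<^sub>M torus_borel)" "snd \<in> borel_measurable (torus_borel \<Otimes>\<^sub>M torus_borel)"
      by (rule measurable_compose[OF measurable_fst measurable_ident_torus_borel],
          rule measurable_compose[OF measurable_snd measurable_ident_torus_borel])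
    have "(\<lambda>z. F (fst z, snd z + fst z)) \<in> borel_measurable (torus_borel \<Otimes>\<^sub>M torus_borel)"
      by (rule measurable_compose[OF _ Fb]) (intro borel_measurable_Pair borel_measurable_add f)
    then have "(\<lambda>(x, h). F (x, h + x)) \<in> borel_measurable (torus_borel \<Otimes>\<^sub>M torus_borel)"
      by (simp add: case_prod_beta)
    from P.Fubini'[OF this] show ?thesis by simp
  qed
  finally have S: "ennreal ((gagliardo_seminorm \<theta> w)\<^sup>2) = (\<integral>\<^sup>+h. \<integral>\<^sup>+x. F (x, h + x) \<partial>torus_borel \<partial>torus_borel)" .
  have "(\<Sum>k\<in>K. ennreal (norm k powr (2 * \<theta>) * (norm (vfourier w' k))\<^sup>2 / 512))
    \<le> (\<Sum>k\<in>K. ennreal ((norm (vfourier w' k))\<^sup>2) * (\<integral>\<^sup>+h. ennreal ((norm (character k h - 1))\<^sup>2 * om h) \<partial>torus_borel))"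
  proof (rule sum_mono)
    fix k assume k: "k \<in> K"
    show "ennreal (norm k powr (2 * \<theta>) * (norm (vfourier w' k))\<^sup>2 / 512)
      \<le> ennreal ((norm (vfourier w' k))\<^sup>2) * (\<integral>\<^sup>+h. ennreal ((norm (character k h - 1))\<^sup>2 * om h) \<partial>torus_borel)"
    proof (cases "k = 0")
      case False
      have eq: "norm k powr p / (8 * norm k) ^ 3 = norm k powr (2 * \<theta>) / 512"
        using False by (simp add: p_def powr_add power_mult_distrib)
      have "k \<in> int_lattice" using k K by blast
      from gagliardo_multiplier_lower[OF this False p]
      have "ennreal (norm k powr (2 * \<theta>) / 512) \<le> (\<integral>\<^sup>+h. ennreal ((norm (character k h - 1))\<^sup>2 * om h) \<partial>torus_borel)"
        unfolding eq om_def times_divide_eq_right mult_1_right .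
      then have "ennreal ((norm (vfourier w' k))\<^sup>2) * ennreal (norm k powr (2 * \<theta>) / 512)
        \<le> ennreal ((norm (vfourier w' k))\<^sup>2) * (\<integral>\<^sup>+h. ennreal ((norm (character k h - 1))\<^sup>2 * om h) \<partial>torus_borel)"
        by (rule mult_left_mono) simp
      then show ?thesis by (simp add: ennreal_mult[symmetric] mult_ac)
    qed simp
  qed
  also have "\<dots> = (\<integral>\<^sup>+h. (\<Sum>k\<in>K. ennreal ((norm (vfourier w' k))\<^sup>2) * ennreal ((norm (character k h - 1))\<^sup>2 * om h)) \<partial>torus_borel)"
  proof -
    have m: "(\<lambda>h. ennreal ((norm (character k h - 1))\<^sup>2 * om h)) \<in> borel_measurable torus_borel" for k
      by (intro borel_measurable_torus_borel) measurable
    show ?thesis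
      by (subst nn_integral_sum) (auto intro!: sum.cong nn_integral_cmult[symmetric] borel_measurable_times_ennreal m)
  qed
  also have "\<dots> \<le> (\<integral>\<^sup>+h. \<integral>\<^sup>+x. F (x, h + x) \<partial>torus_borel \<partial>torus_borel)"
  proof (rule nn_integral_mono)
    fix h :: "real^3"
    let ?D = "\<lambda>x. w' (x + h) - w' x"
    have D: "?D \<in> L2_torus" by (intro L2_torus_diff L2_torus_shift w'L w'(2))
    have Db: "?D \<in> borel_measurable borel"
      by (intro borel_measurable_diff measurable_compose[OF _ w'(2)] w'(2)) simp
    have Dk: "(norm (vfourier ?D k))\<^sup>2 = (norm (character k h - 1))\<^sup>2 * (norm (vfourier w' k))\<^sup>2" if k: "k \<in> K" for k
    proof -
      have "vfourier ?D k $ i = (character k h - 1) * vfourier w' k $ i" for i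
      proof -
        have "vfourier ?D k $ i = vfourier (\<lambda>x. w' (x + h)) k $ i - vfourier w' k $ i"
          unfolding vfourier_nth
          using fourier_diff[OF sq_integrable_component[OF L2_torus_shift[OF w'L w'(2), of h], of i] sq_integrable_component[OF w'L, of i], of k]
          by simp
        also have "\<dots> = (character k h - 1) * vfourier w' k $ i"
          using vfourier_shift[OF w'L w'(2), of k h i] k K by (auto simp: left_diff_distrib)
        finally show ?thesis .
      qed
      then show ?thesis by (simp add: norm_vec_sq norm_mult power_mult_distrib sum_distrib_left)
    qed
    have "(\<Sum>k\<in>K. ennreal ((norm (vfourier w' k))\<^sup>2) * ennreal ((norm (character k h - 1))\<^sup>2 * om h))
      = ennreal (om h * (\<Sum>k\<in>K. (norm (vfourier ?D k))\<^sup>2))"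
      unfolding sum_distrib_left
      by (subst sum_ennreal[symmetric]) (auto simp: om0 Dk ennreal_mult[symmetric] mult_ac intro!: sum.cong)
    also have "\<dots> \<le> ennreal (om h) * ennreal ((L2_norm ?D)\<^sup>2)"
      by (subst ennreal_mult[symmetric]) (auto simp: om0 intro!: ennreal_leI mult_left_mono vbessel D K)
    also have "\<dots> = ennreal (om h) * (\<integral>\<^sup>+x. ennreal ((norm (?D x))\<^sup>2) \<partial>torus_borel)"
      by (simp only: nn_integral_L2_torus[OF D, symmetric] nn_integral_torus_borel)
    also have "\<dots> = (\<integral>\<^sup>+x. ennreal (om h) * ennreal ((norm (?D x))\<^sup>2) \<partial>torus_borel)"
      by (rule nn_integral_cmult[symmetric]) (use Db in \<open>auto intro: borel_measurable_torus_borel\<close>)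
    also have "\<dots> = (\<integral>\<^sup>+x. F (x, h + x) \<partial>torus_borel)"
    proof (rule nn_integral_cong)
      fix x
      have "om (x - (h + x)) = om h" using infdist_int_lattice_uminus[of h] by (simp add: om_def)
      then show "ennreal (om h) * ennreal ((norm (?D x))\<^sup>2) = F (x, h + x)"
        by (simp add: F_def ennreal_mult[symmetric] om0 norm_minus_commute add.commute mult.commute)
    qed
    finally show "(\<Sum>k\<in>K. ennreal ((norm (vfourier w' k))\<^sup>2) * ennreal ((norm (character k h - 1))\<^sup>2 * om h))
      \<le> (\<integral>\<^sup>+x. F (x, h + x) \<partial>torus_borel)" .
  qed
  also note S[symmetric]
  also have "(\<Sum>k\<in>K. ennreal (norm k powr (2 * \<theta>) * (norm (vfourier w' k))\<^sup>2 / 512))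
    = ennreal ((\<Sum>k\<in>K. norm k powr (2 * \<theta>) * (norm (vfourier w' k))\<^sup>2) / 512)"
    by (subst sum_ennreal) (auto simp: sum_divide_distrib)
  finally have "(\<Sum>k\<in>K. norm k powr (2 * \<theta>) * (norm (vfourier w' k))\<^sup>2) / 512 \<le> (gagliardo_seminorm \<theta> w)\<^sup>2"
    by (subst (asm) ennreal_le_iff) auto
  then show ?thesis by (simp add: coeff)
qed

section \<open>The critical norm\<close>

lemma finite_mi_order_le: "finite {r. mi_order r \<le> n}"
proof (rule finite_imageD)
  have "(\<lambda>r::nat^3. (r $ 1, r $ 2, r $ 3)) ` {r. mi_order r \<le> n} \<subseteq> {..n} \<times> {..n} \<times> {..n}"
    by (auto simp: mi_order_def sum_3)
  then show "finite ((\<lambda>r::nat^3. (r $ 1, r $ 2, r $ 3)) ` {r. mi_order r \<le> n})"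
    by (rule finite_subset) auto
  show "inj_on (\<lambda>r::nat^3. (r $ 1, r $ 2, r $ 3)) {r. mi_order r \<le> n}"
    by (auto simp: inj_on_def vec_eq_iff forall_3)
qed

lemma finite_mi_order_eq: "finite {r. mi_order r = n}"
  by (rule finite_subset[OF _ finite_mi_order_le[of n]]) auto

lemma norm_power_le_coordinates:
  fixes k :: "real^3"
  shows "norm k ^ (2 * n) \<le> 3 ^ n * (\<Sum>i\<in>UNIV. ((2 * pi * k $ i) ^ n)\<^sup>2)"
proof -
  have nk: "(norm k)\<^sup>2 = (k $ 1)\<^sup>2 + (k $ 2)\<^sup>2 + (k $ 3)\<^sup>2"
    by (simp add: norm_vec_sq sum_3)
  have "\<exists>i. (norm k)\<^sup>2 \<le> 3 * (k $ i)\<^sup>2"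
  proof (rule ccontr)
    assume "\<not> ?thesis"
    then have "3 * (k $ i)\<^sup>2 < (norm k)\<^sup>2" for i by (simp add: not_le)
    from this[of 1] this[of 2] this[of 3] show False unfolding nk by linarith
  qed
  then obtain i where i: "(norm k)\<^sup>2 \<le> 3 * (k $ i)\<^sup>2" ..
  have "norm k ^ (2 * n) = ((norm k)\<^sup>2) ^ n" by (simp add: power_mult)
  also have "\<dots> \<le> (3 * (k $ i)\<^sup>2) ^ n" by (rule power_mono[OF i]) simp
  also have "\<dots> = 3 ^ n * ((k $ i)\<^sup>2) ^ n" by (rule power_mult_distrib)
  also have "\<dots> \<le> 3 ^ n * ((2 * pi * k $ i)\<^sup>2) ^ n"
  proof (rule mult_left_mono[OF power_mono])
    have "1 \<le> 2 * pi" using pi_gt3 by simp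
    then have "1\<^sup>2 \<le> (2 * pi)\<^sup>2" by (intro power_mono) auto
    then have "1 * (k $ i)\<^sup>2 \<le> (2 * pi)\<^sup>2 * (k $ i)\<^sup>2" by (intro mult_right_mono) auto
    then show "(k $ i)\<^sup>2 \<le> (2 * pi * k $ i)\<^sup>2" by (simp only: power_mult_distrib mult_1_left)
  qed auto
  also have "((2 * pi * k $ i)\<^sup>2) ^ n = ((2 * pi * k $ i) ^ n)\<^sup>2" by (simp only: power_mult[symmetric] mult.commute)
  also have "\<dots> \<le> (\<Sum>i\<in>UNIV. ((2 * pi * k $ i) ^ n)\<^sup>2)"
    by (rule member_le_sum) auto
  finally show ?thesis by simp
qed

lemma gagliardo_seminorm_nonneg: "0 \<le> gagliardo_seminorm \<theta> w"
  unfolding gagliardo_seminorm_def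
  by (auto intro!: integral_nonneg simp: gagliardo_integrand_def split: prod.splits)

lemma Hs_norm_nonneg: "0 \<le> Hs_norm s v"
  unfolding Hs_norm_def Wk2_norm_def
  by (auto intro!: add_nonneg_nonneg sum_nonneg gagliardo_seminorm_nonneg)

text \<open>For \<open>s = n + \<theta>\<close>, the \<open>n\<close>-th derivatives in the three coordinate directions control the factor \<open>|k|\<^sup>2\<^sup>n\<close>, and the
  Gagliardo seminorms of these derivatives the factor \<open>|k|\<^sup>2\<^sup>\<theta>\<close>.\<close>

lemma Hs_fourier:
  assumes s: "s \<ge> 0" and v: "v \<in> Hs s" and K: "finite K" "K \<subseteq> int_lattice"
  shows "(\<Sum>k\<in>K. norm k powr (2 * s) * (norm (vfourier v k))\<^sup>2)
    \<le> 3 ^ nat \<lfloor>s\<rfloor> * 1536 * (Hs_norm s v)\<^sup>2"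
proof -
  define n where "n = nat \<lfloor>s\<rfloor>"
  define w where "w i = weak_partial (axis_index i n) v" for i
  have vW: "v \<in> Wk2 n" using v by (simp add: Hs_def n_def)
  then have vL: "v \<in> L2_torus" by (simp add: Wk2_def)
  have wp: "is_weak_partial (axis_index i n) v (w i)" for i
  proof -
    have "mi_order (axis_index i n) \<le> n" by simp
    then have "\<exists>z. is_weak_partial (axis_index i n) v z" using vW unfolding Wk2_def by blast
    then show ?thesis unfolding w_def weak_partial_def by (rule someI_ex)
  qed
  then have wL: "w i \<in> L2_torus" for i by (simp add: is_weak_partial_def)
  have pointwise: "norm k powr (2 * s) * (norm (vfourier v k))\<^sup>2
      \<le> 3 ^ n * (\<Sum>i\<in>UNIV. norm k powr (2 * frac s) * (norm (vfourier (w i) k))\<^sup>2)" if k: "k \<in> K" for k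
  proof (cases "k = 0")
    case True
    then show ?thesis by (auto intro!: mult_nonneg_nonneg sum_nonneg)
  next
    case False
    have "2 * s = real (2 * n) + 2 * frac s" using s by (simp add: n_def frac_def)
    then have "norm k powr (2 * s) = norm k powr (real (2 * n) + 2 * frac s)" by (rule arg_cong)
    also have "\<dots> = norm k ^ (2 * n) * norm k powr (2 * frac s)"
      using False by (simp only: powr_add) (simp add: powr_realpow[symmetric])
    finally have "norm k powr (2 * s) * (norm (vfourier v k))\<^sup>2
       = norm k ^ (2 * n) * (norm k powr (2 * frac s) * (norm (vfourier v k))\<^sup>2)" by simp
    also have "\<dots> \<le> (3 ^ n * (\<Sum>i\<in>UNIV. ((2 * pi * k $ i) ^ n)\<^sup>2)) * (norm k powr (2 * frac s) * (norm (vfourier v k))\<^sup>2)"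
      by (intro mult_right_mono norm_power_le_coordinates) simp
    also have "\<dots> = 3 ^ n * (\<Sum>i\<in>UNIV. norm k powr (2 * frac s) * (((2 * pi * k $ i) ^ n)\<^sup>2 * (norm (vfourier v k))\<^sup>2))"
      by (simp add: sum_distrib_left sum_distrib_right mult_ac)
    also have "\<dots> = 3 ^ n * (\<Sum>i\<in>UNIV. norm k powr (2 * frac s) * (norm (vfourier (w i) k))\<^sup>2)"
      using weak_partial_fourier[OF vL wp] k K by (simp add: subset_iff)
    finally show ?thesis .
  qed
  have each: "(\<Sum>k\<in>K. norm k powr (2 * frac s) * (norm (vfourier (w i) k))\<^sup>2) \<le> 512 * (Hs_norm s v)\<^sup>2" for i
  proof (cases "frac s = 0")
    case True
    have "(\<Sum>k\<in>K. norm k powr (2 * frac s) * (norm (vfourier (w i) k))\<^sup>2) \<le> (\<Sum>k\<in>K. (norm (vfourier (w i) k))\<^sup>2)"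
      by (intro sum_mono) (auto simp: True)
    also have "\<dots> \<le> (L2_norm (w i))\<^sup>2" by (rule vbessel[OF wL K])
    also have "\<dots> \<le> (\<Sum>r | mi_order r \<le> n. (L2_norm (weak_partial r v))\<^sup>2)"
      unfolding w_def by (rule member_le_sum) (auto simp: finite_mi_order_le)
    also have "\<dots> = (Hs_norm s v)\<^sup>2"
      by (simp add: Hs_norm_def True Wk2_norm_def n_def sum_nonneg)
    also have "\<dots> \<le> 512 * (Hs_norm s v)\<^sup>2" by simp
    finally show ?thesis .
  next
    case False
    then have pos: "frac s > 0" using frac_ge_0[of s] by linarith
    have int: "integrable (lebesgue_on (unit_cube \<times> unit_cube)) (gagliardo_integrand (frac s) (w i))"
      using v False unfolding Hs_def w_def by (simp add: n_def)
    have "(\<Sum>k\<in>K. norm k powr (2 * frac s) * (norm (vfourier (w i) k))\<^sup>2) \<le> 512 * (gagliardo_seminorm (frac s) (w i))\<^sup>2"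
      by (rule gagliardo_fourier[OF wL pos int K])
    also have "\<dots> \<le> 512 * (Hs_norm s v)\<^sup>2"
    proof (intro mult_left_mono power_mono gagliardo_seminorm_nonneg)
      have "gagliardo_seminorm (frac s) (w i) \<le> (\<Sum>r | mi_order r = n. gagliardo_seminorm (frac s) (weak_partial r v))"
        unfolding w_def
        by (rule member_le_sum[where f = "\<lambda>r. gagliardo_seminorm (frac s) (weak_partial r v)"])
          (auto simp: finite_mi_order_eq gagliardo_seminorm_nonneg)
      also have "\<dots> \<le> Hs_norm s v"
        using False by (simp add: Hs_norm_def Wk2_norm_def n_def sum_nonneg)
      finally show "gagliardo_seminorm (frac s) (w i) \<le> Hs_norm s v" .
    qed simp
    finally show ?thesis .
  qed
  have "(\<Sum>k\<in>K. norm k powr (2 * s) * (norm (vfourier v k))\<^sup>2)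
      \<le> (\<Sum>k\<in>K. 3 ^ n * (\<Sum>i\<in>UNIV. norm k powr (2 * frac s) * (norm (vfourier (w i) k))\<^sup>2))"
    by (intro sum_mono pointwise)
  also have "\<dots> = 3 ^ n * (\<Sum>k\<in>K. \<Sum>i\<in>UNIV. norm k powr (2 * frac s) * (norm (vfourier (w i) k))\<^sup>2)"
    by (rule sum_distrib_left[symmetric])
  also have "(\<Sum>k\<in>K. \<Sum>i\<in>UNIV. norm k powr (2 * frac s) * (norm (vfourier (w i) k))\<^sup>2)
      = (\<Sum>i\<in>UNIV. \<Sum>k\<in>K. norm k powr (2 * frac s) * (norm (vfourier (w i) k))\<^sup>2)"
    by (rule sum.swap)
  also have "3 ^ n * \<dots> \<le> 3 ^ n * (\<Sum>i\<in>(UNIV::3 set). 512 * (Hs_norm s v)\<^sup>2)"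
    by (intro mult_left_mono sum_mono each) simp
  finally show ?thesis by (simp add: n_def mult_ac)
qed

text \<open>The exponent \<open>5/6\<close> is an intermediate exponent between \<open>0\<close> and \<open>s\<close>, and the third power of the
  interpolated norm carries exactly the power \<open>5/(2s)\<close> of the \<open>H\<^sup>s\<close> norm.\<close>

lemma critical_sum_bound:
  assumes s: "5 / 6 \<le> s" and v: "v \<in> Hs s" and M: "M > 0" "L2_norm v \<le> M"
    and K: "finite K" "K \<subseteq> int_lattice"
  shows "(\<Sum>k\<in>K. (norm k powr (5 / 6) * norm (vfourier v k))\<^sup>2)
    \<le> (3 ^ nat \<lfloor>s\<rfloor> * 1536 * (Hs_norm s v)\<^sup>2) powr (5 / (6 * s)) * (M\<^sup>2) powr (1 - 5 / (6 * s))"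
    (is "?lhs \<le> ?X powr ?p * ?Y powr ?q")
proof -
  have vL: "v \<in> L2_torus" using v by (simp add: Hs_def Wk2_def)
  let ?a = "\<lambda>k. norm (vfourier v k)"
  have p: "?p > 0" "?q \<ge> 0" "?p + ?q = 1" using s by (auto simp: field_simps)
  have Y: "?Y > 0" using M by simp
  have sumY: "(\<Sum>k\<in>K. (?a k)\<^sup>2) \<le> ?Y"
    using vbessel[OF vL K] power_mono[OF M(2) L2_norm_nonneg[OF vL], of 2] by linarith
  have sumX: "(\<Sum>k\<in>K. norm k powr (2 * s) * (?a k)\<^sup>2) \<le> ?X"
    using s by (intro Hs_fourier v K) auto
  have split: "(norm k powr (5 / 6) * ?a k)\<^sup>2 = (norm k powr (2 * s) * (?a k)\<^sup>2) powr ?p * ((?a k)\<^sup>2) powr ?q" for k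
  proof (cases "?a k = 0 \<or> k = 0")
    case False
    then have a: "?a k > 0" "norm k > 0" by auto
    have "(norm k powr (2 * s) * (?a k)\<^sup>2) powr ?p * ((?a k)\<^sup>2) powr ?q
      = norm k powr (2 * s * ?p) * (((?a k)\<^sup>2) powr ?p * ((?a k)\<^sup>2) powr ?q)"
      using a by (simp add: powr_mult powr_powr)
    also have "((?a k)\<^sup>2) powr ?p * ((?a k)\<^sup>2) powr ?q = (?a k)\<^sup>2"
      using a by (simp only: powr_add[symmetric] p(3)) simp
    also have "2 * s * ?p = 5 / 6 + 5 / 6" using s by simp
    also have "norm k powr (5 / 6 + 5 / 6) = (norm k powr (5 / 6))\<^sup>2"
      unfolding powr_add power2_eq_square ..
    finally show ?thesis by (simp add: power_mult_distrib)
  qed auto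
  show ?thesis
  proof (cases "?X = 0")
    case True
    have "(\<Sum>k\<in>K. norm k powr (2 * s) * (?a k)\<^sup>2) = 0"
      using sumX unfolding True by (intro antisym sum_nonneg) auto
    then have z: "norm k powr (2 * s) * (?a k)\<^sup>2 = 0" if "k \<in> K" for k
      using that K(1) by (subst (asm) sum_nonneg_eq_0_iff) auto
    have "?lhs = 0"
      unfolding split by (intro sum.neutral ballI) (use z p in \<open>simp del: mult_eq_0_iff\<close>)
    then show ?thesis by simp
  next
    case False
    moreover have "?X \<ge> 0" by simp
    ultimately have X: "?X > 0" by linarith
    let ?Z = "?X powr ?p * ?Y powr ?q"
    have "?lhs \<le> (\<Sum>k\<in>K. ?Z * (?p * (norm k powr (2 * s) * (?a k)\<^sup>2 / ?X) + ?q * ((?a k)\<^sup>2 / ?Y)))"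
    proof (rule sum_mono)
      fix k
      let ?x = "norm k powr (2 * s) * (?a k)\<^sup>2" and ?y = "(?a k)\<^sup>2"
      have "(?x / ?X) powr ?p * (?y / ?Y) powr ?q \<le> ?p * (?x / ?X) + ?q * (?y / ?Y)"
      proof (cases "?x = 0")
        case True
        have "0 \<le> ?p * (?x / ?X) + ?q * (?y / ?Y)"
          using p X Y by (intro add_nonneg_nonneg mult_nonneg_nonneg) auto
        then show ?thesis using True p by (simp only: div_0 powr_0 mult_zero_left)
      next
        case False
        then have "?x > 0" "?y > 0" by auto
        then show ?thesis using p X Y by (intro Youngs_inequality_0) auto
      qed
      then have "?Z * ((?x / ?X) powr ?p * (?y / ?Y) powr ?q) \<le> ?Z * (?p * (?x / ?X) + ?q * (?y / ?Y))"
        by (rule mult_left_mono) simp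
      moreover have "?Z * ((?x / ?X) powr ?p * (?y / ?Y) powr ?q) = ?x powr ?p * ?y powr ?q"
      proof -
        have "A * B * ((a / A) * (b / B)) = a * b" if "A > 0" "B > 0" for a b A B :: real
          using that by simp
        moreover have "?X powr ?p > 0" "?Y powr ?q > 0" using X Y powr_gt_zero[of ?X ?p] powr_gt_zero[of ?Y ?q] by linarith+
        moreover have "(?x / ?X) powr ?p = ?x powr ?p / ?X powr ?p" "(?y / ?Y) powr ?q = ?y powr ?q / ?Y powr ?q"
          by (rule powr_divide)+
        ultimately show ?thesis by (simp only:)
      qed
      ultimately show "(norm k powr (5 / 6) * ?a k)\<^sup>2 \<le> ?Z * (?p * (?x / ?X) + ?q * (?y / ?Y))"
        unfolding split by simp
    qed
    also have "\<dots> = ?Z * (?p * ((\<Sum>k\<in>K. norm k powr (2 * s) * (?a k)\<^sup>2) / ?X) + ?q * ((\<Sum>k\<in>K. (?a k)\<^sup>2) / ?Y))"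
      by (simp only: sum_distrib_left[symmetric] sum.distrib sum_divide_distrib)
    also have "\<dots> \<le> ?Z * (?p * 1 + ?q * 1)"
      using X Y sumX sumY p by (intro mult_left_mono add_mono) auto
    also have "\<dots> = ?Z" using p(3) by simp
    finally show ?thesis .
  qed
qed

lemma critical_cubed_bound:
  assumes s: "5 / 6 \<le> s"
  shows "((3 ^ n * 1536 * (Hs_norm s v)\<^sup>2) powr (5 / (6 * s)) * (M\<^sup>2) powr (1 - 5 / (6 * s))) powr (3 / 2)
    = ((3 ^ n * 1536) powr (5 / (4 * s)) * (M\<^sup>2) powr (3 / 2 - 5 / (4 * s))) * Hs_norm s v powr (5 / (2 * s))"
proof -
  have h: "((Hs_norm s v)\<^sup>2) powr (5 / (4 * s)) = Hs_norm s v powr (5 / (2 * s))"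
  proof (cases "Hs_norm s v = 0")
    case False
    then have "Hs_norm s v > 0" using Hs_norm_nonneg[of s v] by linarith
    then have "(Hs_norm s v)\<^sup>2 = Hs_norm s v powr 2" by simp
    then show ?thesis by (simp add: powr_powr)
  qed simp
  have e: "5 / (6 * s) * (3 / 2) = 5 / (4 * s)" "(1 - 5 / (6 * s)) * (3 / 2) = 3 / 2 - 5 / (4 * s)"
    using s by (auto simp: field_simps)
  have "((a * b) powr p * c powr q) powr r = (a powr (p * r) * c powr (q * r)) * b powr (p * r)" for a b c p q r :: real
    by (simp only: powr_mult powr_powr mult_ac)
  then show ?thesis by (simp only: e h)
qed

section \<open>The trilinear estimate\<close>

lemma lattice_ball_card:
  assumes G: "finite G" "G \<subseteq> int_lattice" "\<And>z. z \<in> G \<Longrightarrow> norm z \<le> R" and R: "R \<ge> 1"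
  shows "real (card G) \<le> 27 * R ^ 3"
proof -
  let ?I = "{- \<lfloor>R\<rfloor>..\<lfloor>R\<rfloor>}" and ?f = "\<lambda>z::real^3. (\<lfloor>z $ 1\<rfloor>, \<lfloor>z $ 2\<rfloor>, \<lfloor>z $ 3\<rfloor>)"
  have comp: "z $ i = of_int \<lfloor>z $ i\<rfloor>" if "z \<in> G" for z i
    using G(2) that by (auto simp: int_lattice_def)
  have "card G \<le> card (?I \<times> ?I \<times> ?I)"
  proof (rule card_inj_on_le)
    show "inj_on ?f G"
    proof (rule inj_onI)
      fix x y assume xy: "x \<in> G" "y \<in> G" "?f x = ?f y"
      then have "\<lfloor>x $ i\<rfloor> = \<lfloor>y $ i\<rfloor>" for i using exhaust_3[of i] by auto
      then show "x = y" unfolding vec_eq_iff using comp[OF xy(1)] comp[OF xy(2)] by metis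
    qed
    have "\<lfloor>z $ i\<rfloor> \<in> ?I" if z: "z \<in> G" for z i
    proof -
      have "\<bar>z $ i\<bar> \<le> R" using component_le_norm_cart[of z i] G(3)[OF z] by linarith
      then have "real_of_int \<lfloor>z $ i\<rfloor> \<le> R" "- real_of_int \<lfloor>z $ i\<rfloor> \<le> R" using comp[OF z, of i] by linarith+
      then have "\<lfloor>z $ i\<rfloor> \<le> \<lfloor>R\<rfloor>" "- \<lfloor>z $ i\<rfloor> \<le> \<lfloor>R\<rfloor>" by (simp_all add: le_floor_iff)
      then show ?thesis by simp
    qed
    then show "?f ` G \<subseteq> ?I \<times> ?I \<times> ?I" by auto
  qed simp
  also have "card (?I \<times> ?I \<times> ?I) = nat (2 * \<lfloor>R\<rfloor> + 1) ^ 3"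
    by (simp add: card_cartesian_product power3_eq_cube)
  finally have "real (card G) \<le> real (nat (2 * \<lfloor>R\<rfloor> + 1) ^ 3)" by (simp only: of_nat_le_iff)
  also have "\<dots> = (2 * of_int \<lfloor>R\<rfloor> + 1) ^ 3" using R by simp
  also have "\<dots> \<le> (3 * R) ^ 3" using R of_int_floor_le[of R] by (intro power_mono) (linarith+)
  finally show ?thesis by (simp add: power_mult_distrib)
qed

text \<open>If \<open>x\<close> is the smallest of the lengths of a triad, the other two are comparable, and the weight
  \<open>x / (x y z)\<^sup>5\<^sup>/\<^sup>6\<close> is at most \<open>2 y\<^sup>-\<^sup>3\<^sup>/\<^sup>2\<close>.\<close>

lemma triad_weight:
  fixes x y z :: real
  assumes "0 < x" "x \<le> y" "x \<le> z" "y \<le> x + z"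
  shows "x \<le> 2 * y powr (- 3 / 2) * (x powr (5 / 6) * y powr (5 / 6) * z powr (5 / 6))"
proof -
  have y: "0 < y" and z: "0 < z" using assms by auto
  have yz: "y / 2 \<le> z" using assms by auto
  have "x = x powr (1 / 6) * x powr (5 / 6)"
    using assms by (simp only: powr_add[symmetric]) simp
  also have "\<dots> \<le> y powr (1 / 6) * x powr (5 / 6)"
    using assms by (intro mult_right_mono powr_mono2) auto
  also have "y powr (1 / 6) = y powr (- 3 / 2) * (y powr (5 / 6) * y powr (5 / 6))"
    by (simp only: powr_add[symmetric]) simp
  also have "y powr (5 / 6) = 2 powr (5 / 6) * (y / 2) powr (5 / 6)"
    using y by (simp add: powr_divide)
  also have "y powr (- 3 / 2) * (2 powr (5 / 6) * (y / 2) powr (5 / 6) * (2 powr (5 / 6) * (y / 2) powr (5 / 6))) * x powr (5 / 6)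
     = y powr (- 3 / 2) * (y powr (5 / 6) * (2 powr (5 / 6) * (y / 2) powr (5 / 6))) * x powr (5 / 6)"
    using y by (simp add: powr_divide)
  also have "\<dots> \<le> y powr (- 3 / 2) * (y powr (5 / 6) * (2 * z powr (5 / 6))) * x powr (5 / 6)"
  proof -
    have "2 powr (5 / 6) \<le> (2 :: real) powr 1" by (intro powr_mono) auto
    moreover have "(y / 2) powr (5 / 6) \<le> z powr (5 / 6)" using y yz by (intro powr_mono2) auto
    ultimately have "2 powr (5 / 6) * (y / 2) powr (5 / 6) \<le> 2 * z powr (5 / 6)"
      by (intro mult_mono) auto
    then show ?thesis by (intro mult_right_mono mult_left_mono) auto
  qed
  finally show ?thesis by (simp add: mult_ac)
qed

lemma sum_Un_nonneg_le:
  fixes f :: "'a \<Rightarrow> real"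
  assumes "finite A" "finite B" "\<And>x. f x \<ge> 0"
  shows "sum f (A \<union> B) \<le> sum f A + sum f B"
  using sum.union_inter[OF assms(1,2), of f] sum_nonneg[of "A \<inter> B" f] assms(3) by simp

text \<open>The summand of the trilinear estimate for the triad of frequencies \<open>m\<close>, \<open>k - m\<close> and \<open>k\<close>.\<close>

definition triad :: "(real^3 \<Rightarrow> real) \<Rightarrow> (real^3) \<times> (real^3) \<Rightarrow> real" where
  "triad a = (\<lambda>(k, m). min (norm m) (min (norm k) (norm (k - m))) * a m * a k * a (k - m))"

text \<open>Nonnegative coefficients for which \<open>D\<close> bounds the square of the homogeneous \<open>H\<^sup>5\<^sup>/\<^sup>6\<close> norm.\<close>

locale critical_coefficients =
  fixes a :: "real^3 \<Rightarrow> real" and D :: real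
  assumes a_nonneg: "\<And>k. 0 \<le> a k"
    and sum_le: "\<And>K. finite K \<Longrightarrow> K \<subseteq> int_lattice \<Longrightarrow> (\<Sum>k\<in>K. (norm k powr (5 / 6) * a k)\<^sup>2) \<le> D"
begin

definition b :: "real^3 \<Rightarrow> real" where
  "b k = norm k powr (5 / 6) * a k"

lemma D_nonneg: "0 \<le> D"
  using sum_le[of "{}"] by simp

lemma sum_pairs:
  assumes F: "finite F" "inj_on \<phi> F" "\<phi> ` F \<subseteq> int_lattice \<times> int_lattice"
  shows "(\<Sum>q\<in>F. (b (fst (\<phi> q)))\<^sup>2 * (b (snd (\<phi> q)))\<^sup>2) \<le> D\<^sup>2"
proof -
  let ?A = "fst ` \<phi> ` F" and ?B = "snd ` \<phi> ` F"
  have "(\<Sum>q\<in>F. (b (fst (\<phi> q)))\<^sup>2 * (b (snd (\<phi> q)))\<^sup>2) = (\<Sum>p\<in>\<phi> ` F. (b (fst p))\<^sup>2 * (b (snd p))\<^sup>2)"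
    using F by (simp add: sum.reindex)
  also have "\<dots> \<le> (\<Sum>p\<in>?A \<times> ?B. (b (fst p))\<^sup>2 * (b (snd p))\<^sup>2)"
    by (intro sum_mono2 finite_cartesian_product finite_imageI F(1) subset_fst_snd) simp
  also have "\<dots> = (\<Sum>x\<in>?A. (b x)\<^sup>2) * (\<Sum>y\<in>?B. (b y)\<^sup>2)"
    by (simp add: sum_product sum.cartesian_product case_prod_beta)
  also have "\<dots> \<le> D * D"
    using F unfolding b_def by (intro mult_mono sum_le sum_nonneg D_nonneg) auto
  finally show ?thesis by (simp add: power2_eq_square)
qed

text \<open>The factor \<open>|x|\<^sup>-\<^sup>3\<close> compensates the number of lattice points \<open>y\<close> with \<open>|y| \<le> |x|\<close>.\<close>

lemma sum_weighted:
  assumes F: "finite F" "inj_on \<phi> F" "\<phi> ` F \<subseteq> int_lattice \<times> int_lattice"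
    and nz: "\<And>q. q \<in> F \<Longrightarrow> fst (\<phi> q) \<noteq> 0 \<and> norm (snd (\<phi> q)) \<le> norm (fst (\<phi> q))"
  shows "(\<Sum>q\<in>F. (norm (fst (\<phi> q)) powr (- 3 / 2) * b (fst (\<phi> q)))\<^sup>2) \<le> 27 * D"
proof -
  let ?A = "fst ` \<phi> ` F"
  have fin: "finite ?A" "?A \<subseteq> int_lattice" using F by auto
  have "(\<Sum>q\<in>F. (norm (fst (\<phi> q)) powr (- 3 / 2) * b (fst (\<phi> q)))\<^sup>2)
      = (\<Sum>p\<in>\<phi> ` F. (norm (fst p) powr (- 3 / 2) * b (fst p))\<^sup>2)"
    using F by (simp add: sum.reindex)
  also have "\<dots> = (\<Sum>x\<in>?A. \<Sum>p | p \<in> \<phi> ` F \<and> fst p = x. (norm (fst p) powr (- 3 / 2) * b (fst p))\<^sup>2)"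
    by (rule sum.image_gen) (simp add: F)
  also have "\<dots> \<le> (\<Sum>x\<in>?A. 27 * (b x)\<^sup>2)"
  proof (rule sum_mono)
    fix x assume x: "x \<in> ?A"
    then have x0: "x \<noteq> 0" "x \<in> int_lattice" using nz F by auto
    have nx: "norm x \<ge> 1" by (rule norm_int_lattice_ge_1) (use x0 in auto)
    let ?P = "{p. p \<in> \<phi> ` F \<and> fst p = x}"
    have fP: "finite ?P" using F by simp
    have lat: "snd (\<phi> q) \<in> int_lattice" if "q \<in> F" for q
      using F(3) that by (auto simp: image_subset_iff mem_Times_iff)
    have "card ?P = card (snd ` ?P)"
      by (rule card_image[symmetric]) (auto simp: inj_on_def prod_eq_iff)
    moreover have "real (card (snd ` ?P)) \<le> 27 * norm x ^ 3"
      using nz fP lat by (intro lattice_ball_card nx) auto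
    ultimately have card: "real (card ?P) \<le> 27 * norm x ^ 3" by simp
    have "(\<Sum>p\<in>?P. (norm (fst p) powr (- 3 / 2) * b (fst p))\<^sup>2) = (\<Sum>p\<in>?P. (norm x powr (- 3 / 2) * b x)\<^sup>2)"
      by (intro sum.cong) auto
    also have "\<dots> = real (card ?P) * (norm x powr (- 3 / 2) * b x)\<^sup>2" by simp
    also have "\<dots> \<le> (27 * norm x ^ 3) * (norm x powr (- 3 / 2) * b x)\<^sup>2"
      by (intro mult_right_mono card) simp
    also have "\<dots> = 27 * (b x)\<^sup>2 * (norm x ^ 3 * (norm x powr (- 3 / 2))\<^sup>2)"
      by (simp add: power_mult_distrib mult_ac)
    also have "(norm x powr (- 3 / 2))\<^sup>2 = norm x powr (- 3)"
      unfolding power2_eq_square powr_add[symmetric] by simp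
    also have "norm x ^ 3 * norm x powr (- 3) = 1"
      using x0(1) by (simp add: powr_minus powr_numeral)
    finally show "(\<Sum>p\<in>?P. (norm (fst p) powr (- 3 / 2) * b (fst p))\<^sup>2) \<le> 27 * (b x)\<^sup>2" by simp
  qed
  also have "\<dots> = 27 * (\<Sum>x\<in>?A. (b x)\<^sup>2)" by (simp add: sum_distrib_left)
  also have "\<dots> \<le> 27 * D" using sum_le[OF fin] by (simp add: b_def)
  finally show ?thesis .
qed

text \<open>The part of the sum in which a given frequency of the triad is the smallest: \<open>\<phi>\<close> lists the second
  frequency and the smallest one, \<open>\<psi>\<close> the smallest one and the third.\<close>

lemma triad_part:
  assumes D: "D > 0"
    and F: "finite F" "inj_on \<phi> F" "\<phi> ` F \<subseteq> int_lattice \<times> int_lattice"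
      "inj_on \<psi> F" "\<psi> ` F \<subseteq> int_lattice \<times> int_lattice"
    and nz: "\<And>q. q \<in> F \<Longrightarrow> snd (\<phi> q) \<noteq> 0" "\<And>q. q \<in> F \<Longrightarrow> snd (\<phi> q) = fst (\<psi> q)"
    and ord: "\<And>q. q \<in> F \<Longrightarrow> norm (snd (\<phi> q)) \<le> norm (fst (\<phi> q))"
      "\<And>q. q \<in> F \<Longrightarrow> norm (snd (\<phi> q)) \<le> norm (snd (\<psi> q))"
      "\<And>q. q \<in> F \<Longrightarrow> norm (fst (\<phi> q)) \<le> norm (snd (\<phi> q)) + norm (snd (\<psi> q))"
  shows "(\<Sum>q\<in>F. norm (snd (\<phi> q)) * a (fst (\<phi> q)) * a (snd (\<phi> q)) * a (snd (\<psi> q))) \<le> 55 * D powr (3 / 2)"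
proof -
  have each: "norm (snd (\<phi> q)) * a (fst (\<phi> q)) * a (snd (\<phi> q)) * a (snd (\<psi> q))
     \<le> ((b (fst (\<psi> q)))\<^sup>2 * (b (snd (\<psi> q)))\<^sup>2) / sqrt D
       + sqrt D * (norm (fst (\<phi> q)) powr (- 3 / 2) * b (fst (\<phi> q)))\<^sup>2" (is "?l \<le> ?r") if q: "q \<in> F" for q
  proof -
    let ?x = "norm (snd (\<phi> q))" and ?y = "norm (fst (\<phi> q))" and ?z = "norm (snd (\<psi> q))"
    let ?P = "b (fst (\<psi> q)) * b (snd (\<psi> q))" and ?Q = "?y powr (- 3 / 2) * b (fst (\<phi> q))"
    have "?l \<le> (2 * ?y powr (- 3 / 2) * (?x powr (5 / 6) * ?y powr (5 / 6) * ?z powr (5 / 6))) * a (fst (\<phi> q)) * a (snd (\<phi> q)) * a (snd (\<psi> q))"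
      using nz(1)[OF q] ord[OF q] by (intro mult_right_mono a_nonneg triad_weight) auto
    also have "\<dots> = 2 * ?P * ?Q"
      using nz(2)[OF q] by (simp add: b_def mult_ac)
\<comment> \<open>this distribution of \<open>D\<close> makes both resulting sums homogeneous of degree \<open>3/2\<close> in \<open>D\<close>\<close>
    also have "\<dots> = 2 * (?P / sqrt (sqrt D)) * (sqrt (sqrt D) * ?Q)" using D by simp
    also have "\<dots> \<le> (?P / sqrt (sqrt D))\<^sup>2 + (sqrt (sqrt D) * ?Q)\<^sup>2" by (rule sum_squares_bound)
    also have "\<dots> = ?r" using D by (simp add: power_mult_distrib power_divide)
    finally show ?thesis .
  qed
  have "(\<Sum>q\<in>F. norm (snd (\<phi> q)) * a (fst (\<phi> q)) * a (snd (\<phi> q)) * a (snd (\<psi> q)))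
     \<le> (\<Sum>q\<in>F. ((b (fst (\<psi> q)))\<^sup>2 * (b (snd (\<psi> q)))\<^sup>2) / sqrt D
       + sqrt D * (norm (fst (\<phi> q)) powr (- 3 / 2) * b (fst (\<phi> q)))\<^sup>2)"
    by (intro sum_mono each)
  also have "\<dots> = (\<Sum>q\<in>F. (b (fst (\<psi> q)))\<^sup>2 * (b (snd (\<psi> q)))\<^sup>2) / sqrt D
       + sqrt D * (\<Sum>q\<in>F. (norm (fst (\<phi> q)) powr (- 3 / 2) * b (fst (\<phi> q)))\<^sup>2)"
    by (simp only: sum.distrib sum_divide_distrib sum_distrib_left)
  also have "\<dots> \<le> D\<^sup>2 / sqrt D + sqrt D * (27 * D)"
  proof (intro add_mono divide_right_mono mult_left_mono sum_pairs sum_weighted F)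
    fix q assume q: "q \<in> F"
    show "fst (\<phi> q) \<noteq> 0 \<and> norm (snd (\<phi> q)) \<le> norm (fst (\<phi> q))"
      using nz(1)[OF q] ord(1)[OF q] by auto
  qed (use D in auto)
  also have "\<dots> = 28 * D powr (3 / 2)"
  proof -
    have "D * sqrt D = D powr 1 * D powr (1 / 2)" using D by (simp add: powr_half_sqrt)
    also have "\<dots> = D powr (3 / 2)" unfolding powr_add[symmetric] by simp
    finally have e: "D * sqrt D = D powr (3 / 2)" .
    have "D\<^sup>2 / sqrt D = D * (D / sqrt D)" by (simp add: power2_eq_square)
    also have "D / sqrt D = sqrt D" using D by (simp add: real_div_sqrt)
    finally show ?thesis using e by (simp add: mult.commute)
  qed
  also have "\<dots> \<le> 55 * D powr (3 / 2)" by simp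
  finally show ?thesis .
qed

lemma triad_sum_le:
  assumes F: "finite F" "F \<subseteq> int_lattice \<times> int_lattice"
  shows "(\<Sum>q\<in>F. triad a q) \<le> 165 * D powr (3 / 2)"
proof (cases "D = 0")
  case True
  have "a k = 0" if "k \<in> int_lattice" "k \<noteq> 0" for k
    using sum_le[of "{k}"] that by (auto simp: True)
  then have "triad a (k, m) = 0" if "(k, m) \<in> F" for k m
    using that F(2) by (cases "k = 0") (auto simp: triad_def min_def)
  then have "triad a q = 0" if "q \<in> F" for q
    using that by (cases q) simp
  then show ?thesis by simp
next
  case False
  then have D: "D > 0" using D_nonneg by simp
  let ?F0 = "{(k, m) \<in> F. k \<noteq> 0 \<and> m \<noteq> 0 \<and> k - m \<noteq> 0}"
  let ?F1 = "{(k, m) \<in> ?F0. norm m \<le> norm k \<and> norm m \<le> norm (k - m)}"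
  let ?F2 = "{(k, m) \<in> ?F0. norm k \<le> norm m \<and> norm k \<le> norm (k - m)}"
  let ?F3 = "{(k, m) \<in> ?F0. norm (k - m) \<le> norm k \<and> norm (k - m) \<le> norm m}"
  have fin: "finite ?F1" "finite ?F2" "finite ?F3"
    using F(1) by (auto intro: rev_finite_subset)
  have lat: "k \<in> int_lattice \<and> m \<in> int_lattice \<and> k - m \<in> int_lattice" if "(k, m) \<in> F" for k m
    using F(2) that by (auto intro: int_lattice_diff)
  have t0: "triad a q \<ge> 0" for q
    by (auto simp: triad_def a_nonneg split: prod.splits)
  have 1: "(\<Sum>q\<in>?F1. triad a q) \<le> 55 * D powr (3 / 2)"
  proof -
    have "(\<Sum>q\<in>?F1. triad a q) = (\<Sum>q\<in>?F1. norm (snd ((fst q, snd q))) * a (fst (fst q, snd q)) * a (snd (fst q, snd q)) * a (snd (snd q, fst q - snd q)))"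
      by (intro sum.cong) (auto simp: triad_def min_def)
    also have "\<dots> \<le> 55 * D powr (3 / 2)"
    proof (rule triad_part[OF D fin(1)])
      show "norm (fst (fst q, snd q)) \<le> norm (snd (fst q, snd q)) + norm (snd (snd q, fst q - snd q))" for q :: "(real^3) \<times> (real^3)"
        using norm_triangle_ineq[of "snd q" "fst q - snd q"] by simp
    qed (use lat in \<open>auto simp: inj_on_def\<close>)
    finally show ?thesis .
  qed
  have 2: "(\<Sum>q\<in>?F2. triad a q) \<le> 55 * D powr (3 / 2)"
  proof -
    have "(\<Sum>q\<in>?F2. triad a q) = (\<Sum>q\<in>?F2. norm (snd ((snd q, fst q))) * a (fst (snd q, fst q)) * a (snd (snd q, fst q)) * a (snd (fst q, fst q - snd q)))"
      by (intro sum.cong) (auto simp: triad_def min_def)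
    also have "\<dots> \<le> 55 * D powr (3 / 2)"
    proof (rule triad_part[OF D fin(2)])
      show "norm (fst (snd q, fst q)) \<le> norm (snd (snd q, fst q)) + norm (snd (fst q, fst q - snd q))" for q :: "(real^3) \<times> (real^3)"
        using norm_triangle_ineq4[of "fst q" "fst q - snd q"] by simp
    qed (use lat in \<open>auto simp: inj_on_def\<close>)
    finally show ?thesis .
  qed
  have 3: "(\<Sum>q\<in>?F3. triad a q) \<le> 55 * D powr (3 / 2)"
  proof -
    have "(\<Sum>q\<in>?F3. triad a q) = (\<Sum>q\<in>?F3. norm (snd ((fst q, fst q - snd q))) * a (fst (fst q, fst q - snd q)) * a (snd (fst q, fst q - snd q)) * a (snd (fst q - snd q, snd q)))"
      by (intro sum.cong) (auto simp: triad_def min_def)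
    also have "\<dots> \<le> 55 * D powr (3 / 2)"
    proof (rule triad_part[OF D fin(3)])
      show "norm (fst (fst q, fst q - snd q)) \<le> norm (snd (fst q, fst q - snd q)) + norm (snd (fst q - snd q, snd q))" for q :: "(real^3) \<times> (real^3)"
        using norm_triangle_ineq[of "fst q - snd q" "snd q"] by simp
    qed (use lat in \<open>auto simp: inj_on_def\<close>)
    finally show ?thesis .
  qed
  have "(\<Sum>q\<in>F. triad a q) = (\<Sum>q\<in>?F1 \<union> ?F2 \<union> ?F3. triad a q)"
  proof (rule sum.mono_neutral_right[OF F(1)])
    show "\<forall>q\<in>F - (?F1 \<union> ?F2 \<union> ?F3). triad a q = 0"
    proof (rule ballI)
      fix q assume q: "q \<in> F - (?F1 \<union> ?F2 \<union> ?F3)"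
      obtain k m where km: "q = (k, m)" by force
      have "\<not> (k \<noteq> 0 \<and> m \<noteq> 0 \<and> k - m \<noteq> 0)" using q unfolding km by auto
      then show "triad a q = 0" unfolding km triad_def by (auto simp: min_def)
    qed
  qed auto
  also have "\<dots> \<le> (\<Sum>q\<in>?F1 \<union> ?F2. triad a q) + (\<Sum>q\<in>?F3. triad a q)"
    using fin t0 by (intro sum_Un_nonneg_le) auto
  also have "\<dots> \<le> (\<Sum>q\<in>?F1. triad a q) + (\<Sum>q\<in>?F2. triad a q) + (\<Sum>q\<in>?F3. triad a q)"
    using fin t0 by (intro add_right_mono sum_Un_nonneg_le) auto
  finally show ?thesis using 1 2 3 by linarith
qed

end

section \<open>The energy flux\<close>

lemma infsum_dominated_tendsto_0:
  fixes f :: "nat \<Rightarrow> 'a \<Rightarrow> 'b::banach" and g :: "'a \<Rightarrow> real"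
  assumes g: "g summable_on A" and le: "\<And>n x. x \<in> A \<Longrightarrow> norm (f n x) \<le> g x"
    and lim: "\<And>x. x \<in> A \<Longrightarrow> (\<lambda>n. f n x) \<longlonglongrightarrow> 0"
  shows "(\<lambda>n. infsum (f n) A) \<longlonglongrightarrow> 0"
proof (rule LIMSEQ_I)
  fix r :: real assume r: "r > 0"
  have g0: "g x \<ge> 0" if "x \<in> A" for x using le[OF that, of 0] norm_ge_zero[of "f 0 x"] by linarith
  obtain F where F: "finite F" "F \<subseteq> A" "dist (sum g F) (infsum g A) \<le> r / 3"
    using infsum_finite_approximation[OF g, of "r / 3"] r by auto
  have sub: "A = F \<union> (A - F)" using F by auto
  have gAF: "g summable_on (A - F)" by (rule summable_on_subset_banach[OF g]) auto
  have "infsum g A = sum g F + infsum g (A - F)"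
    using infsum_Un_disjoint[of g F "A - F"] F gAF sub by (simp add: Un_absorb1)
  then have tail: "infsum g (A - F) \<le> r / 3" using F(3) by (simp add: dist_real_def)
  have "\<forall>x\<in>F. \<forall>\<^sub>F n in sequentially. norm (f n x) < r / (3 * (card F + 1))"
    using lim F(2) r by (auto simp: tendsto_iff dist_norm elim!: allE[of _ "r / (3 * (card F + 1))"])
  then have "\<forall>\<^sub>F n in sequentially. \<forall>x\<in>F. norm (f n x) < r / (3 * (card F + 1))"
    using F(1) by (simp add: eventually_ball_finite_distrib)
  then obtain N where N: "\<And>n x. n \<ge> N \<Longrightarrow> x \<in> F \<Longrightarrow> norm (f n x) < r / (3 * (card F + 1))"
    unfolding eventually_sequentially by blast
  show "\<exists>N. \<forall>n\<ge>N. norm (infsum (f n) A - 0) < r"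
  proof (intro exI allI impI)
    fix n assume n: "n \<ge> N"
    have abs: "(\<lambda>x. norm (f n x)) summable_on (A - F)"
      by (rule summable_on_comparison_test[OF gAF]) (auto intro: le)
    have sf: "f n summable_on (A - F)" by (rule abs_summable_summable[OF abs])
    have "infsum (f n) A = sum (f n) F + infsum (f n) (A - F)"
      using infsum_Un_disjoint[of "f n" F "A - F"] F sf sub by (simp add: Un_absorb1)
    also have "norm \<dots> \<le> norm (sum (f n) F) + norm (infsum (f n) (A - F))" by (rule norm_triangle_ineq)
    also have "norm (sum (f n) F) \<le> (\<Sum>x\<in>F. r / (3 * (card F + 1)))"
      by (rule sum_norm_le) (use N[OF n] in \<open>auto intro: less_imp_le\<close>)
    also have "\<dots> \<le> r / 3" using r by (simp add: field_simps)
    also have "norm (infsum (f n) (A - F)) \<le> infsum (\<lambda>x. norm (f n x)) (A - F)"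
      by (rule norm_infsum_bound[OF abs])
    also have "\<dots> \<le> infsum g (A - F)" by (rule infsum_mono[OF abs gAF]) (auto intro: le)
    also have "\<dots> \<le> r / 3" by (rule tail)
    finally show "norm (infsum (f n) A - 0) < r" using r by simp
  qed
qed

text \<open>A Lipschitz cutoff of the frequencies, supported in the finite set below; the radius \<open>N + 1\<close> is positive
  also for \<open>N = 0\<close>.\<close>

definition cutoff :: "nat \<Rightarrow> real^3 \<Rightarrow> real" where
  "cutoff N k = max 0 (1 - norm k / (real N + 1))"

definition cutoff_set :: "nat \<Rightarrow> (real^3) set" where
  "cutoff_set N = {k \<in> int_lattice. norm k \<le> real N + 1}"

lemma cutoff_bounds: "0 \<le> cutoff N k" "cutoff N k \<le> 1"
  by (auto simp: cutoff_def)

lemma cutoff_outside: "k \<in> int_lattice \<Longrightarrow> k \<notin> cutoff_set N \<Longrightarrow> cutoff N k = 0"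
  by (auto simp: cutoff_def cutoff_set_def field_simps)

lemma cutoff_tendsto_1: "(\<lambda>N. cutoff N k) \<longlonglongrightarrow> 1"
proof -
  have "(\<lambda>N. norm k / (real N + 1)) \<longlonglongrightarrow> 0"
    by (rule real_tendsto_divide_at_top[OF tendsto_const])
      (auto intro!: filterlim_tendsto_add_at_top[of _ 1 for x, THEN filterlim_mono] filterlim_real_sequentially simp: add.commute)
  then have "(\<lambda>N. max 0 (1 - norm k / (real N + 1))) \<longlonglongrightarrow> max 0 (1 - 0)"
    by (intro tendsto_intros)
  then show ?thesis by (simp add: cutoff_def)
qed

lemma finite_cutoff_set: "finite (cutoff_set N)"
proof (rule ccontr)
  assume inf: "infinite (cutoff_set N)"
  obtain n :: nat where n: "27 * (real N + 1) ^ 3 < real n" using reals_Archimedean2 by blast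
  obtain G where G: "G \<subseteq> cutoff_set N" "finite G" "card G = n"
    using infinite_arbitrarily_large[OF inf, of n] by blast
  have "real (card G) \<le> 27 * (real N + 1) ^ 3"
    using G by (intro lattice_ball_card) (auto simp: cutoff_set_def)
  then show False using n G by simp
qed

text \<open>The multiplier difference gains the smallest of the three frequencies, uniformly in the cutoff.\<close>

lemma cutoff_difference:
  "min (norm k) (norm l) * \<bar>cutoff N k - cutoff N l\<bar> \<le> min (norm (k - l)) (min (norm k) (norm l))"
proof -
  let ?R = "real N + 1"
  have sym: "min (norm k) (norm l) * \<bar>cutoff N k - cutoff N l\<bar> \<le> norm (k - l)" if kl: "norm k \<le> norm l" for k l
  proof (cases "norm k \<le> ?R")
    case True
    have "\<bar>cutoff N k - cutoff N l\<bar> \<le> \<bar>norm k / ?R - norm l / ?R\<bar>"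
    proof -
      have "\<bar>max 0 (1 - x) - max 0 (1 - y)\<bar> \<le> \<bar>x - y\<bar>" for x y :: real
        by (auto simp: max_def abs_if)
      then show ?thesis unfolding cutoff_def .
    qed
    also have "\<dots> = \<bar>norm k - norm l\<bar> / ?R" by (simp add: diff_divide_distrib[symmetric])
    also have "\<dots> \<le> norm (k - l) / ?R" by (intro divide_right_mono norm_triangle_ineq3) simp
    finally have "norm k * \<bar>cutoff N k - cutoff N l\<bar> \<le> ?R * (norm (k - l) / ?R)"
      using True by (intro mult_mono) auto
    also have "?R * (norm (k - l) / ?R) = norm (k - l)" by simp
    finally show ?thesis using kl by (simp add: min_def)
  next
    case False
    then have "cutoff N k = 0" "cutoff N l = 0" using kl by (auto simp: cutoff_def field_simps)
    then show ?thesis by simp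
  qed
  have 1: "min (norm k) (norm l) * \<bar>cutoff N k - cutoff N l\<bar> \<le> norm (k - l)"
  proof (cases "norm k \<le> norm l")
    case False
    then show ?thesis using sym[of l k] by (simp add: min.commute abs_minus_commute norm_minus_commute)
  qed (rule sym)
  have "\<bar>cutoff N k - cutoff N l\<bar> \<le> 1"
    using cutoff_bounds[of N k] cutoff_bounds[of N l] by linarith
  then have "min (norm k) (norm l) * \<bar>cutoff N k - cutoff N l\<bar> \<le> min (norm k) (norm l) * 1"
    by (intro mult_left_mono) auto
  with 1 show ?thesis by simp
qed

text \<open>The Fourier coefficient of the product of two velocity components.\<close>

definition quadratic_coeff :: "(real^3 \<Rightarrow> real^3) \<Rightarrow> 3 \<Rightarrow> 3 \<Rightarrow> real^3 \<Rightarrow> complex" where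
  "quadratic_coeff v j l k = fourier (\<lambda>x. complex_of_real (v x $ j * v x $ l)) k"

text \<open>The imaginary part, multiplied by \<open>4 \<pi>\<close>, is the rate of change of \<open>|v\<^sub>k|\<^sup>2\<close> under the Euler
  equations; the energy flux gives the corresponding rate for the sum of these squares weighted with the cutoff.\<close>

definition mode_flux :: "(real^3 \<Rightarrow> real^3) \<Rightarrow> real^3 \<Rightarrow> complex" where
  "mode_flux v k = (\<Sum>l\<in>UNIV. \<Sum>j\<in>UNIV. cnj (vfourier v k $ l) * complex_of_real (k $ j) * quadratic_coeff v j l k)"

definition energy_flux :: "nat \<Rightarrow> (real^3 \<Rightarrow> real^3) \<Rightarrow> complex" where
  "energy_flux N v = (\<Sum>k\<in>cutoff_set N. complex_of_real (cutoff N k) * mode_flux v k)"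

text \<open>The contribution to \<open>mode_flux v k\<close> of the interaction of \<open>m\<close> and \<open>k - m\<close>.\<close>

definition flux_term :: "(real^3 \<Rightarrow> real^3) \<Rightarrow> (real^3) \<times> (real^3) \<Rightarrow> complex" where
  "flux_term v = (\<lambda>(k, m). (\<Sum>j\<in>UNIV. complex_of_real (k $ j) * vfourier v m $ j)
     * (\<Sum>l\<in>UNIV. vfourier v (k - m) $ l * cnj (vfourier v k $ l)))"

context
  fixes v :: "real^3 \<Rightarrow> real^3"
  assumes v: "v \<in> H_space"
begin

lemma flux_term_has_sum:
  assumes k: "k \<in> int_lattice"
  shows "((\<lambda>m. flux_term v (k, m)) has_sum mode_flux v k) int_lattice"
proof -
  have vL: "v \<in> L2_torus" using v by (simp add: H_space_def)
  have "((\<lambda>m. \<Sum>l\<in>UNIV. \<Sum>j\<in>UNIV. cnj (vfourier v k $ l) * complex_of_real (k $ j) * (vfourier v m $ j * vfourier v (k - m) $ l)) has_sum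
     mode_flux v k) int_lattice"
    unfolding mode_flux_def vfourier_nth quadratic_coeff_def
    by (intro has_sum_finite_sum has_sum_cmult_right fourier_mult_of_real H_space_trig_approximable v
        sq_integrable_component vL finite)
  moreover have "(\<Sum>l\<in>UNIV. \<Sum>j\<in>UNIV. cnj (vfourier v k $ l) * complex_of_real (k $ j) * (vfourier v m $ j * vfourier v (k - m) $ l))
     = flux_term v (k, m)" for m
    unfolding flux_term_def prod.case sum_product by (subst sum.swap) (simp add: mult_ac)
  ultimately show ?thesis by simp
qed

lemma norm_bilinear_le:
  "norm (\<Sum>l\<in>UNIV. x $ l * cnj (y $ l)) \<le> 3 * (norm x * norm y)" for x y :: "complex^3"
proof -
  have "norm (\<Sum>l\<in>UNIV. x $ l * cnj (y $ l)) \<le> (\<Sum>l\<in>(UNIV::3 set). norm x * norm y)"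
    by (rule sum_norm_le) (auto simp: norm_mult intro!: mult_mono component_le_norm_cart[unfolded real_norm_def] Finite_Cartesian_Product.norm_nth_le)
  then show ?thesis by simp
qed

lemma flux_term_bound:
  assumes m: "m \<in> int_lattice"
  shows "norm (flux_term v (k, m)) \<le> 9 * (min (norm k) (norm (k - m)) * (norm (vfourier v m) * norm (vfourier v k) * norm (vfourier v (k - m))))"
proof -
  let ?a = "\<lambda>k. norm (vfourier v k)"
  have lin: "norm (\<Sum>j\<in>UNIV. complex_of_real (x $ j) * vfourier v m $ j) \<le> 3 * (norm x * ?a m)" for x :: "real^3"
  proof -
    have "norm (\<Sum>j\<in>UNIV. complex_of_real (x $ j) * vfourier v m $ j) \<le> (\<Sum>j\<in>(UNIV::3 set). norm x * ?a m)"
      by (rule sum_norm_le) (auto simp: norm_mult intro!: mult_mono component_le_norm_cart Finite_Cartesian_Product.norm_nth_le)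
    then show ?thesis by simp
  qed
  have "(\<Sum>j\<in>UNIV. complex_of_real (k $ j) * vfourier v m $ j) = (\<Sum>j\<in>UNIV. complex_of_real ((k - m) $ j) * vfourier v m $ j)"
    using H_space_fourier(1)[OF v m] by (simp add: left_diff_distrib sum_subtractf)
  then have "norm (\<Sum>j\<in>UNIV. complex_of_real (k $ j) * vfourier v m $ j) \<le> 3 * (min (norm k) (norm (k - m)) * ?a m)"
    using lin[of k] lin[of "k - m"] by (auto simp: min_def)
  then have "norm (flux_term v (k, m)) \<le> (3 * (min (norm k) (norm (k - m)) * ?a m)) * (3 * (?a (k - m) * ?a k))"
    unfolding flux_term_def prod.case norm_mult
    by (intro mult_mono norm_bilinear_le) auto
  then show ?thesis by (simp add: mult_ac)
qed

lemma cnj_flux_term: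
  assumes m: "m \<in> int_lattice"
  shows "cnj (flux_term v (k, m)) = flux_term v (k - m, - m)"
proof -
  have "(\<Sum>j\<in>UNIV. complex_of_real ((k - m) $ j) * vfourier v (- m) $ j) = (\<Sum>j\<in>UNIV. complex_of_real (k $ j) * vfourier v (- m) $ j)"
    using H_space_fourier(1)[OF v int_lattice_uminus[OF m]]
    by (simp add: left_diff_distrib sum_subtractf sum_negf)
  then show ?thesis
    by (simp add: flux_term_def vfourier_minus mult.commute)
qed

lemma coefficient_sum_le:
  assumes "finite K" "K \<subseteq> int_lattice"
  shows "(\<Sum>k\<in>K. (norm (vfourier v k))\<^sup>2) \<le> (L2_norm v)\<^sup>2"
  using assms v by (intro vbessel) (auto simp: H_space_def)

lemma cutoff_flux_summable:
  "(\<lambda>(k, m). complex_of_real (cutoff N k) * flux_term v (k, m)) summable_on (int_lattice \<times> int_lattice)"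
proof -
  let ?a = "\<lambda>k. norm (vfourier v k)"
  let ?f = "\<lambda>p. norm (complex_of_real (cutoff N (fst p)) * flux_term v p)"
  let ?B = "\<Sum>k\<in>cutoff_set N. 9 * (norm k * (?a k * (L2_norm v)\<^sup>2))"
  have "?f summable_on (int_lattice \<times> int_lattice)"
  proof (rule nonneg_bounded_partial_sums_imp_summable_on[where C = ?B])
    show "\<forall>\<^sub>F X in finite_subsets_at_top (int_lattice \<times> int_lattice). sum ?f X \<le> ?B"
    proof (rule eventually_finite_subsets_at_top_weakI)
      fix X :: "((real^3) \<times> (real^3)) set" assume X: "finite X" "X \<subseteq> int_lattice \<times> int_lattice"
      let ?K = "fst ` X" and ?M = "snd ` X"
      have KM: "finite ?K" "?K \<subseteq> int_lattice" "finite ?M" "?M \<subseteq> int_lattice" using X by auto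
      have "sum ?f X \<le> sum ?f (?K \<times> ?M)"
        using KM by (intro sum_mono2 subset_fst_snd) auto
      also have "\<dots> = (\<Sum>k\<in>?K. \<Sum>m\<in>?M. ?f (k, m))" by (simp add: sum.cartesian_product case_prod_beta)
      also have "\<dots> \<le> (\<Sum>k\<in>?K. if k \<in> cutoff_set N then 9 * (norm k * (?a k * (L2_norm v)\<^sup>2)) else 0)"
      proof (rule sum_mono)
        fix k assume k: "k \<in> ?K"
        then have kL: "k \<in> int_lattice" using KM by auto
        show "(\<Sum>m\<in>?M. ?f (k, m)) \<le> (if k \<in> cutoff_set N then 9 * (norm k * (?a k * (L2_norm v)\<^sup>2)) else 0)"
        proof (cases "k \<in> cutoff_set N")
          case False
          then show ?thesis using cutoff_outside[OF kL False] by simp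
        next
          case True
          have "(\<Sum>m\<in>?M. ?f (k, m)) \<le> (\<Sum>m\<in>?M. 9 * (norm k * (?a k * (((?a m)\<^sup>2 + (?a (k - m))\<^sup>2) / 2))))"
          proof (rule sum_mono)
            fix m assume "m \<in> ?M"
            then have mL: "m \<in> int_lattice" using KM by auto
            have "?f (k, m) \<le> 1 * norm (flux_term v (k, m))"
              unfolding norm_mult using cutoff_bounds[of N k] by (intro mult_right_mono) auto
            also have "\<dots> \<le> 9 * (min (norm k) (norm (k - m)) * (?a m * ?a k * ?a (k - m)))"
              using flux_term_bound[OF mL] by simp
            also have "\<dots> \<le> 9 * (norm k * (?a m * ?a k * ?a (k - m)))"
              by (intro mult_left_mono mult_right_mono) auto
            also have "\<dots> = 9 * (norm k * (?a k * (?a m * ?a (k - m))))" by (simp add: mult_ac)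
            also have "\<dots> \<le> 9 * (norm k * (?a k * (((?a m)\<^sup>2 + (?a (k - m))\<^sup>2) / 2)))"
              using sum_squares_bound[of "?a m" "?a (k - m)"] by (intro mult_left_mono) auto
            finally show "?f (k, m) \<le> 9 * (norm k * (?a k * (((?a m)\<^sup>2 + (?a (k - m))\<^sup>2) / 2)))" .
          qed
          also have "\<dots> = 9 * (norm k * (?a k * (((\<Sum>m\<in>?M. (?a m)\<^sup>2) + (\<Sum>m\<in>?M. (?a (k - m))\<^sup>2)) / 2)))"
            by (simp only: sum_distrib_left[symmetric] sum_divide_distrib[symmetric] sum.distrib)
          also have "\<dots> \<le> 9 * (norm k * (?a k * (((L2_norm v)\<^sup>2 + (L2_norm v)\<^sup>2) / 2)))"
          proof -
            have "(\<Sum>m\<in>?M. (?a (k - m))\<^sup>2) = (\<Sum>l\<in>(\<lambda>m. k - m) ` ?M. (?a l)\<^sup>2)"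
              by (rule sum.reindex[symmetric, unfolded o_def]) (auto simp: inj_on_def)
            also have "\<dots> \<le> (L2_norm v)\<^sup>2"
              using KM kL by (intro coefficient_sum_le) (auto intro: int_lattice_diff)
            finally have "(\<Sum>m\<in>?M. (?a (k - m))\<^sup>2) \<le> (L2_norm v)\<^sup>2" .
            then show ?thesis
              using coefficient_sum_le[OF KM(3,4)] by (intro mult_left_mono divide_right_mono add_mono) auto
          qed
          finally show ?thesis using True by simp
        qed
      qed
      also have "\<dots> = (\<Sum>k\<in>?K \<inter> cutoff_set N. 9 * (norm k * (?a k * (L2_norm v)\<^sup>2)))"
        using KM(1) by (simp add: sum.inter_restrict)
      also have "\<dots> \<le> ?B"
        by (rule sum_mono2[OF finite_cutoff_set]) auto
      finally show "sum ?f X \<le> ?B" .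
    qed
  qed auto
  then have "(\<lambda>p. complex_of_real (cutoff N (fst p)) * flux_term v p) summable_on (int_lattice \<times> int_lattice)"
    by (rule abs_summable_summable)
  then show ?thesis by (simp add: case_prod_beta')
qed

lemma energy_flux_infsum:
  "((\<lambda>(k, m). complex_of_real (cutoff N k) * flux_term v (k, m)) has_sum energy_flux N v) (int_lattice \<times> int_lattice)"
proof -
  let ?c = "mode_flux v"
  let ?h = "\<lambda>(k, m). complex_of_real (cutoff N k) * flux_term v (k, m)"
  have s: "(?h has_sum infsum ?h (int_lattice \<times> int_lattice)) (int_lattice \<times> int_lattice)"
    using cutoff_flux_summable by (rule has_sum_infsum)
  have "((\<lambda>k. complex_of_real (cutoff N k) * ?c k) has_sum infsum ?h (int_lattice \<times> int_lattice)) int_lattice"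
    by (rule has_sum_SigmaD[OF s]) (simp add: has_sum_cmult_right flux_term_has_sum)
  moreover have "((\<lambda>k. complex_of_real (cutoff N k) * ?c k) has_sum energy_flux N v) int_lattice"
    unfolding energy_flux_def
    by (rule has_sum_finite_neutralI) (use finite_cutoff_set cutoff_outside in \<open>auto simp: cutoff_set_def\<close>)
  ultimately have "infsum ?h (int_lattice \<times> int_lattice) = energy_flux N v" by (rule has_sum_unique)
  with s show ?thesis by (simp only:)
qed

text \<open>The involution \<open>(k, m) \<mapsto> (k - m, -m)\<close> exchanges the two advected modes of a triad and conjugates the
  summand; only the difference of the two cutoffs survives in the imaginary part.\<close>

lemma Im_energy_flux:
  "((\<lambda>(k, m). complex_of_real (cutoff N k - cutoff N (k - m)) * flux_term v (k, m)) has_sum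
     2 * \<i> * complex_of_real (Im (energy_flux N v))) (int_lattice \<times> int_lattice)"
proof -
  let ?L2 = "int_lattice \<times> int_lattice"
  let ?h = "\<lambda>(k, m). complex_of_real (cutoff N k) * flux_term v (k, m)"
  have "((\<lambda>p. cnj (?h p)) has_sum cnj (energy_flux N v)) ?L2"
    using energy_flux_infsum by (simp only: has_sum_cnj_iff)
  then have "((\<lambda>(k, m). complex_of_real (cutoff N (k - m)) * flux_term v (k, m)) has_sum cnj (energy_flux N v)) ?L2"
  proof (subst (asm) has_sum_reindex_bij_witness[of ?L2 "\<lambda>(k, m). (k - m, - m)" "\<lambda>(k, m). (k - m, - m)"])
  qed (auto simp: cnj_flux_term int_lattice_diff int_lattice_uminus)
  then have "((\<lambda>p. - (case p of (k, m) \<Rightarrow> complex_of_real (cutoff N (k - m)) * flux_term v (k, m))) has_sum - cnj (energy_flux N v)) ?L2"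
    by (simp only: has_sum_uminus minus_minus)
  from has_sum_add[OF energy_flux_infsum this]
  have "((\<lambda>p. (case p of (k, m) \<Rightarrow> complex_of_real (cutoff N k) * flux_term v (k, m)) - (case p of (k, m) \<Rightarrow> complex_of_real (cutoff N (k - m)) * flux_term v (k, m)))
     has_sum energy_flux N v - cnj (energy_flux N v)) ?L2"
    by (simp only: add_uminus_conv_diff)
  moreover have "energy_flux N v - cnj (energy_flux N v) = 2 * \<i> * complex_of_real (Im (energy_flux N v))"
    by (simp add: complex_eq_iff)
  ultimately show ?thesis by (simp add: case_prod_beta' left_diff_distrib)
qed

lemma energy_flux_bound_and_limit:
  assumes D: "\<And>K. finite K \<Longrightarrow> K \<subseteq> int_lattice \<Longrightarrow> (\<Sum>k\<in>K. (norm k powr (5 / 6) * norm (vfourier v k))\<^sup>2) \<le> D"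
  shows "\<bar>Im (energy_flux N v)\<bar> \<le> 743 * D powr (3 / 2)"
    and "(\<lambda>N. Im (energy_flux N v)) \<longlonglongrightarrow> 0"
proof -
  let ?L2 = "int_lattice \<times> int_lattice"
  let ?a = "\<lambda>k. norm (vfourier v k)"
  interpret critical_coefficients ?a D
    by standard (auto intro: D)
  let ?f = "\<lambda>N (k, m). complex_of_real (cutoff N k - cutoff N (k - m)) * flux_term v (k, m)"
  let ?g = "\<lambda>p. 9 * triad ?a p"
  have t0: "triad ?a p \<ge> 0" for p by (auto simp: triad_def split: prod.splits)
  have bound: "\<forall>\<^sub>F X in finite_subsets_at_top ?L2. sum ?g X \<le> 9 * (165 * D powr (3 / 2))"
    by (rule eventually_finite_subsets_at_top_weakI)
      (auto simp only: sum_distrib_left[symmetric] intro!: mult_left_mono triad_sum_le)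
  have g: "?g summable_on ?L2"
    by (rule nonneg_bounded_partial_sums_imp_summable_on[OF _ bound]) (simp add: t0)
  have gs: "infsum ?g ?L2 \<le> 9 * (165 * D powr (3 / 2))"
    using g by (rule infsum_le_finite_sums) (auto simp only: sum_distrib_left[symmetric] intro!: mult_left_mono triad_sum_le)
  have le: "norm (?f N p) \<le> ?g p" if p: "p \<in> ?L2" for N p
  proof -
    obtain k m where km: "p = (k, m)" "m \<in> int_lattice" using p by auto
    let ?A = "?a m * ?a k * ?a (k - m)"
    have "norm (?f N p) = \<bar>cutoff N k - cutoff N (k - m)\<bar> * norm (flux_term v (k, m))"
      unfolding km(1) prod.case norm_mult norm_of_real ..
    also have "\<dots> \<le> \<bar>cutoff N k - cutoff N (k - m)\<bar> * (9 * (min (norm k) (norm (k - m)) * ?A))"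
      by (intro mult_left_mono flux_term_bound km) simp
    also have "\<dots> = 9 * ((min (norm k) (norm (k - m)) * \<bar>cutoff N k - cutoff N (k - m)\<bar>) * ?A)"
      by (simp add: mult_ac)
    also have "\<dots> \<le> 9 * (min (norm m) (min (norm k) (norm (k - m))) * ?A)"
      using cutoff_difference[of k "k - m" N] by (intro mult_left_mono mult_right_mono) auto
    also have "\<dots> = ?g p" by (simp add: triad_def km mult_ac)
    finally show ?thesis .
  qed
  have lim: "(\<lambda>N. ?f N p) \<longlonglongrightarrow> 0" for p
  proof -
    obtain k m where km: "p = (k, m)" by force
    have "(\<lambda>N. complex_of_real (cutoff N k - cutoff N (k - m)) * flux_term v (k, m)) \<longlonglongrightarrow> complex_of_real (1 - 1) * flux_term v (k, m)"
      by (intro tendsto_intros cutoff_tendsto_1)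
    then show ?thesis by (simp add: km)
  qed
  have val: "infsum (?f N) ?L2 = 2 * \<i> * complex_of_real (Im (energy_flux N v))" for N
    by (rule infsumI[OF Im_energy_flux])
  have nrm: "norm (2 * \<i> * complex_of_real (Im (energy_flux N v))) = 2 * \<bar>Im (energy_flux N v)\<bar>" for N
    by (simp add: norm_mult)
  show "\<bar>Im (energy_flux N v)\<bar> \<le> 743 * D powr (3 / 2)"
  proof -
    have abs: "(\<lambda>p. norm (?f N p)) summable_on ?L2"
      by (rule summable_on_comparison_test[OF g]) (use le in auto)
    have "2 * \<bar>Im (energy_flux N v)\<bar> = norm (infsum (?f N) ?L2)" unfolding val nrm ..
    also have "\<dots> \<le> infsum (\<lambda>p. norm (?f N p)) ?L2" by (rule norm_infsum_bound[OF abs])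
    also have "\<dots> \<le> infsum ?g ?L2" by (rule infsum_mono[OF abs g le])
    also note gs
    finally show ?thesis using powr_ge_zero[of D "3 / 2"] by linarith
  qed
  have "(\<lambda>N. infsum (?f N) ?L2) \<longlonglongrightarrow> 0"
    by (rule infsum_dominated_tendsto_0[OF g le lim])
  then have "(\<lambda>N. norm (2 * \<i> * complex_of_real (Im (energy_flux N v)))) \<longlonglongrightarrow> 0"
    unfolding val by (rule tendsto_norm_zero)
  then have "(\<lambda>N. (1/2) * (2 * \<bar>Im (energy_flux N v)\<bar>)) \<longlonglongrightarrow> (1/2) * 0"
    unfolding nrm by (intro tendsto_intros)
  then show "(\<lambda>N. Im (energy_flux N v)) \<longlonglongrightarrow> 0"
    by (simp add: tendsto_rabs_zero_iff)
qed

end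

section \<open>Test fields\<close>

text \<open>The functions \<open>x\<^sup>-\<^sup>m exp(-1/x)\<close>, extended by zero; differentiation stays within their span.\<close>

definition flat_exp :: "nat \<Rightarrow> real \<Rightarrow> real" where
  "flat_exp m x = (if x \<le> 0 then 0 else exp (- (1 / x)) / x ^ m)"

lemma flat_exp_tendsto_0: "(flat_exp m \<longlongrightarrow> 0) (at_right 0)"
proof -
  have "((\<lambda>x::real. (inverse x) ^ m / exp (inverse x)) \<longlongrightarrow> 0) (at_right 0)"
    by (rule filterlim_compose[OF tendsto_power_div_exp_0 filterlim_inverse_at_top_right])
  moreover have "\<forall>\<^sub>F x in at_right 0. (inverse x) ^ m / exp (inverse x) = flat_exp m x"
    unfolding eventually_at_right_field
    by (intro exI[of _ 1]) (auto simp: flat_exp_def exp_minus field_simps power_inverse inverse_eq_divide)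
  ultimately show ?thesis by (rule Lim_transform_eventually)
qed

lemma flat_exp_derivative:
  "(flat_exp m has_real_derivative flat_exp (m + 2) x - real m * flat_exp (m + 1) x) (at x)"
proof -
  consider "x < 0" | "x = 0" | "x > 0" by linarith
  then show ?thesis
  proof cases
    case 1
    have "(flat_exp m has_real_derivative 0) (at x)"
    proof (rule has_field_derivative_transform_within_open[where f = "\<lambda>_. 0" and S = "{..<0}"])
      show "((\<lambda>_. 0) has_real_derivative 0) (at x)" by simp
    qed (use 1 in \<open>auto simp: flat_exp_def\<close>)
    then show ?thesis using 1 by (simp add: flat_exp_def)
  next
    case 3
    have "((\<lambda>y. exp (- (1 / y)) / y ^ m) has_real_derivative flat_exp (m + 2) x - real m * flat_exp (m + 1) x) (at x)"
    proof -
      have "((\<lambda>y. exp (- (1 / y)) / y ^ m) has_real_derivative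
          ((exp (- (1 / x)) * (1 / x\<^sup>2)) * x ^ m - exp (- (1 / x)) * (real m * x ^ (m - 1))) / (x ^ m * x ^ m)) (at x)"
        using 3 by (auto intro!: derivative_eq_intros simp: power2_eq_square)
      moreover have "((exp (- (1 / x)) * (1 / x\<^sup>2)) * x ^ m - exp (- (1 / x)) * (real m * x ^ (m - 1))) / (x ^ m * x ^ m)
          = flat_exp (m + 2) x - real m * flat_exp (m + 1) x"
      proof (cases m)
        case 0
        then show ?thesis using 3 by (simp add: flat_exp_def power2_eq_square)
      next
        case (Suc j)
        then show ?thesis using 3 by (simp add: flat_exp_def field_simps power2_eq_square)
      qed
      ultimately show ?thesis by simp
    qed
    then show ?thesis
      by (rule has_field_derivative_transform_within_open[where S = "{0<..}"]) (use 3 in \<open>auto simp: flat_exp_def\<close>)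
  next
    case 2
    have "((\<lambda>y. (flat_exp m y - flat_exp m 0) / (y - 0)) \<longlongrightarrow> 0) (at 0)"
    proof (rule filterlim_split_at)
      have "\<forall>\<^sub>F y in at_left 0. 0 = (flat_exp m y - flat_exp m 0) / (y - 0)"
        unfolding eventually_at_left_field by (intro exI[of _ "-1"]) (auto simp: flat_exp_def)
      then show "((\<lambda>y. (flat_exp m y - flat_exp m 0) / (y - 0)) \<longlongrightarrow> 0) (at_left 0)"
        by (rule Lim_transform_eventually[OF tendsto_const])
      have "\<forall>\<^sub>F y in at_right 0. flat_exp (m + 1) y = (flat_exp m y - flat_exp m 0) / (y - 0)"
        unfolding eventually_at_right_field by (intro exI[of _ 1]) (auto simp: flat_exp_def)
      then show "((\<lambda>y. (flat_exp m y - flat_exp m 0) / (y - 0)) \<longlongrightarrow> 0) (at_right 0)"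
        by (rule Lim_transform_eventually[OF flat_exp_tendsto_0])
    qed
    then show ?thesis by (simp add: 2 has_field_derivative_iff flat_exp_def)
  qed
qed

text \<open>\<open>n\<close> times continuously differentiable on the real line.\<close>

primrec smooth_real :: "nat \<Rightarrow> (real \<Rightarrow> real) \<Rightarrow> bool" where
  "smooth_real 0 f \<longleftrightarrow> continuous_on UNIV f"
| "smooth_real (Suc n) f \<longleftrightarrow> (\<exists>f'. (\<forall>x. (f has_real_derivative f' x) (at x)) \<and> smooth_real n f')"

lemma smooth_real_add: "smooth_real n f \<Longrightarrow> smooth_real n g \<Longrightarrow> smooth_real n (\<lambda>x. f x + g x)"
proof (induction n arbitrary: f g)
  case 0
  then show ?case by (auto intro!: continuous_intros)
next
  case (Suc n)
  then obtain f' g' where "\<forall>x. (f has_real_derivative f' x) (at x)" "smooth_real n f'"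
    "\<forall>x. (g has_real_derivative g' x) (at x)" "smooth_real n g'" by auto
  then show ?case using Suc.IH[of f' g']
    by (auto intro!: exI[of _ "\<lambda>x. f' x + g' x"] derivative_intros)
qed

lemma smooth_real_SucD: "smooth_real (Suc n) f \<Longrightarrow> smooth_real n f"
proof (induction n arbitrary: f)
  case 0
  then obtain f' where "\<And>x. (f has_real_derivative f' x) (at x)" by auto
  then have "isCont f x" for x by (rule DERIV_isCont)
  then show ?case by (simp add: continuous_at_imp_continuous_on)
next
  case (Suc n)
  then show ?case by (metis smooth_real.simps(2))
qed

lemma flat_exp_affine_derivative:
  "((\<lambda>t. flat_exp m (L * (B - t))) has_real_derivative
     - L * (flat_exp (m + 2) (L * (B - t)) - real m * flat_exp (m + 1) (L * (B - t)))) (at t)"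
proof -
  have h: "((\<lambda>t. L * (B - t)) has_real_derivative - L) (at t)"
    by (auto intro!: derivative_eq_intros)
  show ?thesis using DERIV_chain2[OF flat_exp_derivative h, of m] by (simp only: mult.commute)
qed

lemma smooth_real_flat_exp: "smooth_real n (\<lambda>t. c * flat_exp m (L * (B - t)))"
proof (induction n arbitrary: c m)
  case 0
  have "isCont (\<lambda>t. c * flat_exp m (L * (B - t))) t" for t
    using DERIV_isCont[OF flat_exp_affine_derivative[of m L B t]] by (intro continuous_intros)
  then show ?case by (auto intro!: continuous_at_imp_continuous_on)
next
  case (Suc n)
  let ?f' = "\<lambda>t. (c * - L) * flat_exp (m + 2) (L * (B - t)) + (c * L * real m) * flat_exp (m + 1) (L * (B - t))"
  have "((\<lambda>t. c * flat_exp m (L * (B - t))) has_real_derivative ?f' t) (at t)" for t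
    using DERIV_cmult[OF flat_exp_affine_derivative[of m L B t], of c] by (simp add: algebra_simps)
  moreover have "smooth_real n ?f'" by (intro smooth_real_add Suc.IH)
  ultimately show ?case unfolding smooth_real.simps by (intro exI[of _ ?f'] conjI allI)
qed

text \<open>A smooth approximation of \<open>max 0 (B - t)\<close> as \<open>L \<rightarrow> \<infinity>\<close>.\<close>

definition ramp :: "real \<Rightarrow> real \<Rightarrow> real \<Rightarrow> real" where
  "ramp L B t = (B - t) * flat_exp 0 (L * (B - t))"

text \<open>The derivative of \<open>ramp L B\<close>, see \<open>ramp_derivative\<close> below.\<close>

definition ramp_deriv :: "real \<Rightarrow> real \<Rightarrow> real \<Rightarrow> real" where
  "ramp_deriv L B t = - flat_exp 0 (L * (B - t)) - flat_exp 1 (L * (B - t))"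

lemma ramp_derivative: "(ramp L B has_real_derivative ramp_deriv L B t) (at t)"
proof -
  have "((\<lambda>t. (B - t) * flat_exp 0 (L * (B - t))) has_real_derivative
     (- 1) * flat_exp 0 (L * (B - t)) + (- L * (flat_exp 2 (L * (B - t)))) * (B - t)) (at t)"
  proof -
    have "((\<lambda>t. B - t) has_real_derivative - 1) (at t)" by (auto intro!: derivative_eq_intros)
    from DERIV_mult[OF this flat_exp_affine_derivative[of 0 L B t]]
    show ?thesis by (simp only: of_nat_0 mult_zero_left diff_zero add_0)
  qed
  moreover have "(- L * (flat_exp 2 (L * (B - t)))) * (B - t) = - flat_exp 1 (L * (B - t))"
    by (cases "L * (B - t) = 0") (auto simp: flat_exp_def power2_eq_square)
  ultimately show ?thesis by (simp add: ramp_def[abs_def] ramp_deriv_def)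
qed

lemma smooth_real_ramp_deriv: "smooth_real n (ramp_deriv L B)"
  using smooth_real_add[OF smooth_real_flat_exp[of n "-1" 0 L B] smooth_real_flat_exp[of n "-1" 1 L B]]
  by (simp add: ramp_deriv_def[abs_def])

lemma smooth_real_ramp: "smooth_real n (ramp L B)"
proof -
  have "smooth_real (Suc n) (ramp L B)"
    unfolding smooth_real.simps using ramp_derivative smooth_real_ramp_deriv
    by (intro exI[of _ "ramp_deriv L B"] conjI allI)
  then show ?thesis by (rule smooth_real_SucD)
qed

lemma borel_ramp [measurable]: "ramp L B \<in> borel_measurable borel" "ramp_deriv L B \<in> borel_measurable borel"
proof -
  have "smooth_real 0 (ramp L B)" "smooth_real 0 (ramp_deriv L B)"
    using smooth_real_ramp[of 0 L B] smooth_real_ramp_deriv[of 0 L B] by simp_all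
  then show "ramp L B \<in> borel_measurable borel" "ramp_deriv L B \<in> borel_measurable borel"
    by (simp_all add: borel_measurable_continuous_onI)
qed

lemma flat_exp_01_bounds: "0 \<le> flat_exp 0 x" "flat_exp 0 x \<le> 1" "0 \<le> flat_exp 1 x" "flat_exp 1 x \<le> 1"
proof -
  show "0 \<le> flat_exp 0 x" "flat_exp 0 x \<le> 1" "0 \<le> flat_exp 1 x" by (auto simp: flat_exp_def)
  show "flat_exp 1 x \<le> 1"
  proof (cases "x \<le> 0")
    case False
    have "1 / x \<le> exp (1 / x)" using exp_ge_add_one_self[of "1 / x"] by linarith
    then have "exp (- (1 / x)) * (1 / x) \<le> exp (- (1 / x)) * exp (1 / x)" by (intro mult_left_mono) auto
    then show ?thesis using False by (simp add: flat_exp_def mult_exp_exp)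
  qed (simp add: flat_exp_def)
qed

lemma ramp_bounds: "\<bar>ramp L B t\<bar> \<le> \<bar>B - t\<bar>" "\<bar>ramp_deriv L B t\<bar> \<le> 2"
proof -
  show "\<bar>ramp L B t\<bar> \<le> \<bar>B - t\<bar>"
    unfolding ramp_def abs_mult using flat_exp_01_bounds[of "L * (B - t)"] by (intro mult_left_le) auto
  show "\<bar>ramp_deriv L B t\<bar> \<le> 2"
    unfolding ramp_deriv_def using flat_exp_01_bounds[of "L * (B - t)"] by linarith
qed

lemma ramp_outside: "L > 0 \<Longrightarrow> t \<ge> B \<Longrightarrow> ramp L B t = 0"
  by (auto simp: ramp_def flat_exp_def mult_le_0_iff)

lemma ramp_limits:
  shows "(\<lambda>n. ramp (real n + 1) B t) \<longlonglongrightarrow> max 0 (B - t)"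
    and "(\<lambda>n. ramp_deriv (real n + 1) B t) \<longlonglongrightarrow> (if t < B then -1 else 0)"
proof -
  have *: "(\<lambda>n. flat_exp 0 ((real n + 1) * (B - t))) \<longlonglongrightarrow> 1 \<and> (\<lambda>n. flat_exp 1 ((real n + 1) * (B - t))) \<longlonglongrightarrow> 0" if "t < B"
  proof -
    have i: "(\<lambda>n. 1 / ((real n + 1) * (B - t))) \<longlonglongrightarrow> 0"
    proof -
      have "(\<lambda>n. inverse (real (Suc n)) * (1 / (B - t))) \<longlonglongrightarrow> 0 * (1 / (B - t))"
        by (intro tendsto_intros LIMSEQ_inverse_real_of_nat)
      then show ?thesis by (simp add: field_simps)
    qed
    have e: "(\<lambda>n. exp (- (1 / ((real n + 1) * (B - t))))) \<longlonglongrightarrow> exp (- 0)"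
      by (intro tendsto_intros i)
    have pos: "0 < (real n + 1) * (B - t)" for n using that by (intro mult_pos_pos) auto
    have "flat_exp 0 ((real n + 1) * (B - t)) = exp (- (1 / ((real n + 1) * (B - t))))"
      "flat_exp 1 ((real n + 1) * (B - t)) = exp (- (1 / ((real n + 1) * (B - t)))) * (1 / ((real n + 1) * (B - t)))" for n
      using pos[of n] by (auto simp: flat_exp_def)
    then show ?thesis using e tendsto_mult[OF e i] by simp
  qed
  have z: "flat_exp m ((real n + 1) * (B - t)) = 0" if "\<not> t < B" for m n
    using that by (auto simp: flat_exp_def mult_le_0_iff)
  show "(\<lambda>n. ramp (real n + 1) B t) \<longlonglongrightarrow> max 0 (B - t)"
  proof (cases "t < B")
    case True
    have "(\<lambda>n. ramp (real n + 1) B t) \<longlonglongrightarrow> (B - t) * 1"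
      unfolding ramp_def by (intro tendsto_intros *[OF True, THEN conjunct1])
    then show ?thesis using True by simp
  next
    case False
    then show ?thesis using z by (simp add: ramp_def)
  qed
  show "(\<lambda>n. ramp_deriv (real n + 1) B t) \<longlonglongrightarrow> (if t < B then -1 else 0)"
  proof (cases "t < B")
    case True
    have "(\<lambda>n. ramp_deriv (real n + 1) B t) \<longlonglongrightarrow> - 1 - 0"
      unfolding ramp_deriv_def by (intro tendsto_intros *[OF True, THEN conjunct1] *[OF True, THEN conjunct2])
    then show ?thesis using True by simp
  next
    case False
    then show ?thesis using z by (simp add: ramp_deriv_def)
  qed
qed

lemma frechet_derivative_cong_on:
  assumes "\<And>x. x \<in> S \<Longrightarrow> f x = g x" "x \<in> S"
  shows "frechet_derivative f (at x within S) = frechet_derivative g (at x within S)"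
proof -
  have "(f has_derivative D) (at x within S) \<longleftrightarrow> (g has_derivative D) (at x within S)" for D
    using has_derivative_transform[OF assms(2), of g f D] has_derivative_transform[OF assms(2), of f g D] assms(1)
    by auto
  then show ?thesis by (simp add: frechet_derivative_def)
qed

lemma Ck_on_cong: "(\<And>x. x \<in> S \<Longrightarrow> f x = g x) \<Longrightarrow> Ck_on n S f \<longleftrightarrow> Ck_on n S g"
proof (induction n arbitrary: f g)
  case 0
  then show ?case by (simp cong: continuous_on_cong)
next
  case (Suc n)
  have "f differentiable_on S \<longleftrightarrow> g differentiable_on S"
    unfolding differentiable_on_def differentiable_def
  proof (rule ball_cong[OF refl])
    fix x assume x: "x \<in> S"
    have "(f has_derivative D) (at x within S) \<longleftrightarrow> (g has_derivative D) (at x within S)" for D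
      using has_derivative_transform[OF x, of g f D] has_derivative_transform[OF x, of f g D] Suc.prems by auto
    then show "(\<exists>D. (f has_derivative D) (at x within S)) \<longleftrightarrow> (\<exists>D. (g has_derivative D) (at x within S))" by simp
  qed
  moreover have "Ck_on n S (\<lambda>x. frechet_derivative f (at x within S) b) \<longleftrightarrow> Ck_on n S (\<lambda>x. frechet_derivative g (at x within S) b)" for b
    by (rule Suc.IH) (simp add: frechet_derivative_cong_on[OF Suc.prems])
  ultimately show ?case by simp
qed

text \<open>A plane wave with polarisation \<open>c\<close> and amplitude \<open>\<eta>(t)\<close>.\<close>

definition wave_field :: "(real \<Rightarrow> real) \<Rightarrow> real^3 \<Rightarrow> real \<Rightarrow> real^3 \<Rightarrow> real \<Rightarrow> real^3 \<Rightarrow> real^3" where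
  "wave_field \<eta> k \<alpha> c t x = (\<eta> t * wave k \<alpha> x) *\<^sub>R c"

lemma wave_field_derivative:
  assumes "\<And>t. (\<eta> has_real_derivative \<eta>' t) (at t)"
  shows "((\<lambda>(t, x). wave_field \<eta> k \<alpha> c t x) has_derivative
     (\<lambda>(\<tau>, h). (\<eta>' t * \<tau> * wave k \<alpha> x + \<eta> t * (2 * pi * (k \<bullet> h)) * wave k (\<alpha> + pi / 2) x) *\<^sub>R c)) (at (t, x) within S)"
proof -
  have 1: "((\<lambda>p. \<eta> (fst p)) has_derivative (\<lambda>p. \<eta>' t * fst p)) (at (t, x) within S)"
  proof -
    have "(\<eta> has_derivative (\<lambda>h. \<eta>' t * h)) (at (fst (t, x)))"
      using assms[of t] by (simp add: has_field_derivative_def)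
    from has_derivative_compose[OF has_derivative_fst[OF has_derivative_ident] this]
    show ?thesis .
  qed
  have 2: "((\<lambda>p. wave k \<alpha> (snd p)) has_derivative (\<lambda>p. (2 * pi * (k \<bullet> snd p)) * wave k (\<alpha> + pi / 2) x)) (at (t, x) within S)"
  proof -
    have "(wave k \<alpha> has_derivative (\<lambda>h. (2 * pi * (k \<bullet> h)) * wave k (\<alpha> + pi / 2) x)) (at (snd (t, x)))"
      using has_derivative_wave[of 1 k \<alpha> x UNIV] by simp
    from has_derivative_compose[OF has_derivative_snd[OF has_derivative_ident] this]
    show ?thesis .
  qed
  have "((\<lambda>p. (\<eta> (fst p) * wave k \<alpha> (snd p)) *\<^sub>R c) has_derivative
     (\<lambda>p. (\<eta> t * ((2 * pi * (k \<bullet> snd p)) * wave k (\<alpha> + pi / 2) x) + \<eta>' t * fst p * wave k \<alpha> x) *\<^sub>R c)) (at (t, x) within S)"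
    using has_derivative_scaleR_left[OF has_derivative_mult[OF 1 2], of c] by simp
  then show ?thesis
    by (simp add: wave_field_def case_prod_beta' add.commute mult.assoc)
qed

text \<open>Both the time derivative and the space derivatives of a wave field are again wave fields.  Derivatives within
  \<open>[0,T) \<times> \<real>\<^sup>3\<close> are unique at \<open>t = 0\<close> because small positive increments in all basis directions stay in that set.\<close>

lemma Ck_on_wave_field:
  assumes T: "T > 0"
  shows "smooth_real n \<eta> \<Longrightarrow> Ck_on n ({0..<T} \<times> UNIV) (\<lambda>(t, x). wave_field \<eta> k \<alpha> c t x)"
proof (induction n arbitrary: \<eta> \<alpha> c)
  case 0
  then have c: "continuous_on UNIV \<eta>" by simp
  have "continuous_on ({0..<T} \<times> UNIV) (\<lambda>p. \<eta> (fst p))"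
    by (rule continuous_on_compose2[OF c continuous_on_fst[OF continuous_on_id]]) simp
  moreover have "continuous_on ({0..<T} \<times> UNIV) (\<lambda>p. wave k \<alpha> (snd p))"
    by (rule continuous_on_compose2[OF continuous_wave[of UNIV] continuous_on_snd[OF continuous_on_id]]) simp
  ultimately show ?case unfolding Ck_on.simps wave_field_def case_prod_beta' by (intro continuous_intros)
next
  case (Suc n)
  let ?S = "{0..<T} \<times> (UNIV :: (real^3) set)"
  let ?f = "\<lambda>(t, x). wave_field \<eta> k \<alpha> c t x"
  obtain \<eta>' where \<eta>': "\<And>t. (\<eta> has_real_derivative \<eta>' t) (at t)" "smooth_real n \<eta>'"
    using Suc.prems by auto
  let ?D = "\<lambda>(t, x) (\<tau>, h). (\<eta>' t * \<tau> * wave k \<alpha> x + \<eta> t * (2 * pi * (k \<bullet> h)) * wave k (\<alpha> + pi / 2) x) *\<^sub>R c"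
  have der: "(?f has_derivative ?D p) (at p within S)" for p S
    using wave_field_derivative[OF \<eta>'(1), of k \<alpha> c "fst p" "snd p" S] by (simp add: case_prod_beta')
  have frechet: "frechet_derivative ?f (at p within ?S) = ?D p" if p: "p \<in> ?S" for p
  proof (rule frechet_derivative_unique_within[OF _ der])
    show "(?f has_derivative frechet_derivative ?f (at p within ?S)) (at p within ?S)"
      unfolding frechet_derivative_works[symmetric] differentiable_def using der by blast
    fix i :: "real \<times> (real^3)" and e :: real assume i: "i \<in> Basis" and e: "e > 0"
\<comment> \<open>a forward step in time, admissible also at \<open>t = 0\<close>\<close>
    let ?d = "min (e / 2) ((T - fst p) / 2)"
    have d: "0 < ?d" "?d < e" "fst p + ?d < T" using e p by (auto simp: min_def field_simps)
    have "fst i = 0 \<or> fst i = 1" using i by (auto simp: Basis_prod_def)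
    then have "p + ?d *\<^sub>R i \<in> ?S" using d p by (auto simp: mem_Times_iff)
    then show "\<exists>d. 0 < \<bar>d\<bar> \<and> \<bar>d\<bar> < e \<and> p + d *\<^sub>R i \<in> ?S" using d by (intro exI[of _ ?d]) auto
  qed
  have "?f differentiable_on ?S" unfolding differentiable_on_def differentiable_def using der by blast
  moreover have "Ck_on n ?S (\<lambda>p. frechet_derivative ?f (at p within ?S) b)" if b: "b \<in> Basis" for b
  proof -
    \<comment> \<open>the basis direction is the time direction or a space direction\<close>
    have "Ck_on n ?S (\<lambda>p. ?D p b)"
    proof (cases "b = (1, 0)")
      case True
      have "(\<lambda>p. ?D p b) = (\<lambda>(t, x). wave_field \<eta>' k \<alpha> c t x)"
        by (simp add: True wave_field_def case_prod_beta')
      then show ?thesis using Suc.IH[OF \<eta>'(2), of \<alpha> c] by simp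
    next
      case False
      then obtain h where h: "b = (0, h)" using b by (auto simp: Basis_prod_def)
      have "(\<lambda>p. ?D p b) = (\<lambda>(t, x). wave_field \<eta> k (\<alpha> + pi / 2) ((2 * pi * (k \<bullet> h)) *\<^sub>R c) t x)"
        by (simp add: h wave_field_def case_prod_beta' mult_ac)
      then show ?thesis using Suc.IH[OF smooth_real_SucD[OF Suc.prems], of "\<alpha> + pi / 2" "(2 * pi * (k \<bullet> h)) *\<^sub>R c"] by simp
    qed
    then show ?thesis using frechet by (subst Ck_on_cong[of ?S _ "\<lambda>p. ?D p b"]) auto
  qed
  ultimately show ?case by simp
qed

lemma wave_field_space_derivative:
  "(wave_field \<eta> k \<alpha> c t has_derivative (\<lambda>h. (\<eta> t * (2 * pi * (k \<bullet> h)) * wave k (\<alpha> + pi / 2) x) *\<^sub>R c)) (at x)"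
  using has_derivative_scaleR_left[OF has_derivative_wave[of "\<eta> t" k \<alpha> x UNIV], of c]
  by (simp add: wave_field_def[abs_def] mult_ac)

lemma jacobian_wave_field:
  "jacobian (wave_field \<eta> k \<alpha> c t) (at x) $ i $ j = \<eta> t * (2 * pi * k $ j) * wave k (\<alpha> + pi / 2) x * c $ i"
  by (simp add: jacobian_def matrix_def frechet_derivative_at[OF wave_field_space_derivative, symmetric] inner_axis)

lemma wave_field_test_field:
  assumes T: "T > 0" and k: "k \<in> int_lattice" and c: "k \<bullet> c = 0"
    and \<eta>: "\<And>n. smooth_real n \<eta>" and B: "0 < B" "B < T" "\<And>t. t \<ge> B \<Longrightarrow> \<eta> t = 0"
  shows "wave_field \<eta> k \<alpha> c \<in> test_fields T"
  unfolding test_fields_def mem_Collect_eq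
proof (intro conjI)
  show "\<forall>t\<in>{0..<T}. periodic (wave_field \<eta> k \<alpha> c t)"
    using periodic_wave[OF k, of \<alpha>] by (simp add: periodic_def wave_field_def)
  show "smooth_on ({0..<T} \<times> UNIV) (\<lambda>(t, x). wave_field \<eta> k \<alpha> c t x)"
    unfolding smooth_on_def using Ck_on_wave_field[OF T \<eta>] by blast
  show "\<exists>K. compact K \<and> K \<subseteq> {0..<T} \<and> (\<forall>t\<in>{0..<T} - K. \<forall>x. wave_field \<eta> k \<alpha> c t x = 0)"
    using B by (intro exI[of _ "{0..B}"]) (auto simp: wave_field_def)
  have "(\<Sum>i\<in>UNIV. k $ i * c $ i) = 0" using c by (simp add: inner_vec_def)
  then have "(\<Sum>i\<in>UNIV. \<eta> t * (2 * pi * k $ i) * wave k (\<alpha> + pi / 2) x * c $ i) = 0" for t x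
  proof -
    have "(\<Sum>i\<in>UNIV. \<eta> t * (2 * pi * k $ i) * wave k (\<alpha> + pi / 2) x * c $ i)
      = (\<eta> t * 2 * pi * wave k (\<alpha> + pi / 2) x) * (\<Sum>i\<in>UNIV. k $ i * c $ i)"
      unfolding sum_distrib_left by (intro sum.cong refl) (simp add: mult_ac)
    then show ?thesis using \<open>(\<Sum>i\<in>UNIV. k $ i * c $ i) = 0\<close> by simp
  qed
  then show "\<forall>t\<in>{0..<T}. \<forall>x. divergence (wave_field \<eta> k \<alpha> c t) x = 0"
    by (simp add: divergence_def trace_def jacobian_wave_field)
qed

lemma time_deriv_wave_field:
  assumes "(\<eta> has_real_derivative d) (at t)"
  shows "time_deriv (wave_field \<eta> k \<alpha> c) t x = (d * wave k \<alpha> x) *\<^sub>R c"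
proof -
  have "((\<lambda>\<tau>. (\<eta> \<tau> * wave k \<alpha> x) *\<^sub>R c) has_vector_derivative (d * wave k \<alpha> x) *\<^sub>R c) (at t)"
    using DERIV_cmult_right[OF assms, of "wave k \<alpha> x"]
    by (intro has_vector_derivative_scaleR[where g = "\<lambda>_. c" and g' = 0, simplified]) (auto simp: has_real_derivative_iff_has_vector_derivative)
  then show ?thesis unfolding time_deriv_def wave_field_def by (rule vector_derivative_at)
qed

text \<open>The terms of the weak formulation for a wave field.\<close>

lemma wave_field_pairings:
  assumes \<eta>: "\<And>t. (\<eta> has_real_derivative \<eta>' t) (at t)"
  shows "L2_inner v (time_deriv (wave_field \<eta> k \<alpha> c) t) = \<eta>' t * wave_coeff k \<alpha> (\<lambda>x. v x \<bullet> c)"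
    and "L2_inner (\<lambda>x. outer (v x) (v x)) (\<lambda>x. jacobian (wave_field \<eta> k \<alpha> c t) (at x))
      = \<eta> t * (2 * pi * wave_coeff k (\<alpha> + pi / 2) (\<lambda>x. (v x \<bullet> c) * (v x \<bullet> k)))"
    and "L2_inner v (wave_field \<eta> k \<alpha> c t) = \<eta> t * wave_coeff k \<alpha> (\<lambda>x. v x \<bullet> c)"
proof -
  have "L2_inner v (time_deriv (wave_field \<eta> k \<alpha> c) t) = (LINT x|torus. \<eta>' t * (wave k \<alpha> x * (v x \<bullet> c)))"
    unfolding L2_inner_def time_deriv_wave_field[OF \<eta>] by (simp add: mult_ac)
  then show "L2_inner v (time_deriv (wave_field \<eta> k \<alpha> c) t) = \<eta>' t * wave_coeff k \<alpha> (\<lambda>x. v x \<bullet> c)"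
    by (simp add: wave_coeff_def)
  have "L2_inner v (wave_field \<eta> k \<alpha> c t) = (LINT x|torus. \<eta> t * (wave k \<alpha> x * (v x \<bullet> c)))"
    unfolding L2_inner_def wave_field_def by (simp add: mult_ac)
  then show "L2_inner v (wave_field \<eta> k \<alpha> c t) = \<eta> t * wave_coeff k \<alpha> (\<lambda>x. v x \<bullet> c)"
    by (simp add: wave_coeff_def)
  have "outer a a \<bullet> jacobian (wave_field \<eta> k \<alpha> c t) (at x)
      = (\<eta> t * (2 * pi)) * (wave k (\<alpha> + pi / 2) x * ((a \<bullet> c) * (a \<bullet> k)))" for a x
  proof -
    have "outer a a \<bullet> jacobian (wave_field \<eta> k \<alpha> c t) (at x)
      = (\<Sum>i\<in>UNIV. \<Sum>j\<in>UNIV. (\<eta> t * (2 * pi) * wave k (\<alpha> + pi / 2) x) * ((a $ i * c $ i) * (a $ j * k $ j)))"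
      by (simp add: inner_vec_def outer_def jacobian_wave_field mult_ac)
    also have "\<dots> = (\<eta> t * (2 * pi) * wave k (\<alpha> + pi / 2) x) * ((a \<bullet> c) * (a \<bullet> k))"
      by (simp only: sum_distrib_left[symmetric] sum_distrib_right[symmetric] inner_vec_def inner_real_def)
    finally show ?thesis by (simp only: mult.assoc)
  qed
  then have "L2_inner (\<lambda>x. outer (v x) (v x)) (\<lambda>x. jacobian (wave_field \<eta> k \<alpha> c t) (at x))
     = (LINT x|torus. (\<eta> t * (2 * pi)) * (wave k (\<alpha> + pi / 2) x * ((v x \<bullet> c) * (v x \<bullet> k))))"
    by (simp add: L2_inner_def)
  then show "L2_inner (\<lambda>x. outer (v x) (v x)) (\<lambda>x. jacobian (wave_field \<eta> k \<alpha> c t) (at x))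
      = \<eta> t * (2 * pi * wave_coeff k (\<alpha> + pi / 2) (\<lambda>x. (v x \<bullet> c) * (v x \<bullet> k)))"
    by (simp add: wave_coeff_def mult_ac)
qed

section \<open>A linear equation in time in the weak sense\<close>

text \<open>The positive and the negative part of \<open>W\<close> are densities of two finite measures that agree on half-lines.\<close>

lemma AE_zero_of_halfline_integrals:
  fixes W :: "real \<Rightarrow> real"
  assumes W: "integrable lborel W" and zero: "\<And>x. (LINT t|lborel. indicator {x<..} t * W t) = 0"
  shows "AE t in lborel. W t = 0"
proof -
  let ?p = "\<lambda>t. ennreal (max 0 (W t))" and ?n = "\<lambda>t. ennreal (max 0 (- W t))"
  have [measurable]: "W \<in> borel_measurable borel" using W by (auto dest: borel_measurable_integrable)
  have int: "integrable lborel (\<lambda>t. indicator {x<..} t * max 0 (W t))" "integrable lborel (\<lambda>t. indicator {x<..} t * max 0 (- W t))" for x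
    by (rule Bochner_Integration.integrable_bound[OF W]; auto simp: indicator_def)+
  have em: "emeasure (density lborel ?p) {x<..} = ennreal (LINT t|lborel. indicator {x<..} t * max 0 (W t))"
    "emeasure (density lborel ?n) {x<..} = ennreal (LINT t|lborel. indicator {x<..} t * max 0 (- W t))" for x
  proof -
    have "emeasure (density lborel ?p) {x<..} = (\<integral>\<^sup>+t. ennreal (indicator {x<..} t * max 0 (W t)) \<partial>lborel)"
      by (subst emeasure_density) (auto intro!: nn_integral_cong simp: indicator_def)
    then show "emeasure (density lborel ?p) {x<..} = ennreal (LINT t|lborel. indicator {x<..} t * max 0 (W t))"
      using nn_integral_eq_integral[OF int(1)] by simp
    have "emeasure (density lborel ?n) {x<..} = (\<integral>\<^sup>+t. ennreal (indicator {x<..} t * max 0 (- W t)) \<partial>lborel)"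
      by (subst emeasure_density) (auto intro!: nn_integral_cong simp: indicator_def)
    then show "emeasure (density lborel ?n) {x<..} = ennreal (LINT t|lborel. indicator {x<..} t * max 0 (- W t))"
      using nn_integral_eq_integral[OF int(2)] by simp
  qed
  have eq: "(LINT t|lborel. indicator {x<..} t * max 0 (W t)) = (LINT t|lborel. indicator {x<..} t * max 0 (- W t))" for x
  proof -
    have "(LINT t|lborel. indicator {x<..} t * max 0 (W t)) - (LINT t|lborel. indicator {x<..} t * max 0 (- W t))
      = (LINT t|lborel. indicator {x<..} t * max 0 (W t) - indicator {x<..} t * max 0 (- W t))"
      by (rule Bochner_Integration.integral_diff[symmetric]) (rule int)+
    also have "\<dots> = (LINT t|lborel. indicator {x<..} t * W t)"
      by (rule Bochner_Integration.integral_cong) (auto simp: max_def indicator_def)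
    finally show ?thesis using zero[of x] by simp
  qed
  have "density lborel ?p = density lborel ?n"
  proof (rule measure_eqI_lessThan)
    show "emeasure (density lborel ?p) {x<..} < \<infinity>" for x unfolding em by simp
    show "emeasure (density lborel ?p) {x<..} = emeasure (density lborel ?n) {x<..}" for x
      unfolding em eq ..
  qed simp_all
  moreover have "(\<integral>\<^sup>+t. ?p t \<partial>lborel) \<noteq> \<infinity>"
  proof -
    have "integrable lborel (\<lambda>t. max 0 (W t))"
      by (rule Bochner_Integration.integrable_bound[OF W]) auto
    from nn_integral_eq_integral[OF this] show ?thesis by simp
  qed
  ultimately have "AE t in lborel. ?p t = ?n t"
    by (subst (asm) finite_density_unique) auto
  then show ?thesis by eventually_elim (auto simp: max_def split: if_splits)
qed

lemma bounded_support_integrable: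
  fixes f :: "real \<Rightarrow> real"
  assumes "f \<in> borel_measurable borel" "\<And>t. \<bar>f t\<bar> \<le> C * indicator {0<..<T} t"
  shows "integrable lborel f"
proof (rule Bochner_Integration.integrable_bound)
  show "integrable lborel (\<lambda>t. C * indicator {0<..<T} t)"
    by (cases "0 \<le> T") (auto intro!: integrable_mult_right integrable_real_indicator)
  have "norm (f t) \<le> norm (C * indicator {0<..<T} t)" for t
    using assms(2)[of t] unfolding real_norm_def by linarith
  then show "AE t in lborel. norm (f t) \<le> norm (C * indicator {0<..<T} t)" by simp
qed (use assms in simp)

lemma bounded_support_integrable2:
  fixes f :: "real \<times> real \<Rightarrow> real"
  assumes f: "f \<in> borel_measurable (lborel \<Otimes>\<^sub>M lborel)" "\<And>p. \<bar>f p\<bar> \<le> C * indicator ({0<..<T} \<times> {0<..<T}) p"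
  shows "integrable (lborel \<Otimes>\<^sub>M lborel) f"
proof (rule Bochner_Integration.integrable_bound)
  have "emeasure (lborel \<Otimes>\<^sub>M lborel) ({0<..<T} \<times> {0<..<T}) = emeasure lborel {0<..<T} * emeasure lborel {0<..<T}"
    by (rule lborel.emeasure_pair_measure_Times) auto
  also have "\<dots> < \<infinity>" by (cases "0 \<le> T") (auto simp: ennreal_mult_less_top)
  finally show "integrable (lborel \<Otimes>\<^sub>M lborel) (\<lambda>p. C * indicator ({0<..<T} \<times> {0<..<T}) p)"
    by (intro integrable_mult_right integrable_real_indicator) auto
  have "norm (f p) \<le> norm (C * indicator ({0<..<T} \<times> {0<..<T}) p)" for p
    using f(2)[of p] unfolding real_norm_def by linarith
  then show "AE p in lborel \<Otimes>\<^sub>M lborel. norm (f p) \<le> norm (C * indicator ({0<..<T} \<times> {0<..<T}) p)"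
    by simp
qed (rule f)

text \<open>The equation \<open>U' = G\<close> on \<open>(0,T)\<close> with initial value \<open>U0\<close>, tested only with the functions \<open>ramp L b\<close>.\<close>

locale weak_ode =
  fixes T U0 B :: real and U G :: "real \<Rightarrow> real"
  assumes T: "T > 0"
    and U_borel [measurable]: "U \<in> borel_measurable borel" and G_borel [measurable]: "G \<in> borel_measurable borel"
    and U_bound: "\<And>t. \<bar>U t\<bar> \<le> B * indicator {0<..<T} t" and G_bound: "\<And>t. \<bar>G t\<bar> \<le> B * indicator {0<..<T} t"
    and weak: "\<And>L b. L > 0 \<Longrightarrow> 0 < b \<Longrightarrow> b < T \<Longrightarrow>
      (LINT t|lborel. ramp_deriv L b t * U t + ramp L b t * G t) = - ramp L b 0 * U0"
begin

text \<open>The primitive of \<open>G\<close>, which vanishes at times \<open>t \<le> 0\<close>.\<close>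

definition J :: "real \<Rightarrow> real" where
  "J t = (LINT r|lborel. indicator {..<t} r * G r)"

lemma B_nonneg: "B \<ge> 0"
proof -
  have "\<bar>U (T / 2)\<bar> \<le> B" using U_bound[of "T / 2"] T by simp
  then show ?thesis by linarith
qed

lemma
  assumes "t \<notin> {0<..<T}"
  shows U_outside: "U t = 0" and G_outside: "G t = 0"
proof -
  have "indicator {0<..<T} t = (0 :: real)" using assms by (rule indicator_simps(2))
  then show "U t = 0" "G t = 0" using U_bound[of t] G_bound[of t] by simp_all
qed

lemma abs_U_le: "\<bar>U t\<bar> \<le> B" and abs_G_le: "\<bar>G t\<bar> \<le> B"
proof -
  have "B * indicator {0<..<T} t \<le> B" using B_nonneg by (simp add: indicator_def)
  then show "\<bar>U t\<bar> \<le> B" "\<bar>G t\<bar> \<le> B" using U_bound[of t] G_bound[of t] by linarith+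
qed

lemma J_borel [measurable]: "J \<in> borel_measurable borel"
proof -
  have "(\<lambda>p::real \<times> real. indicator {..<fst p} (snd p) * G (snd p)) \<in> borel_measurable (borel \<Otimes>\<^sub>M lborel)"
  proof -
    have "(\<lambda>p::real \<times> real. if snd p < fst p then G (snd p) else 0) \<in> borel_measurable (borel \<Otimes>\<^sub>M lborel)"
      by measurable
    moreover have "(\<lambda>p::real \<times> real. if snd p < fst p then G (snd p) else 0) = (\<lambda>p. indicator {..<fst p} (snd p) * G (snd p))"
      by (auto simp: fun_eq_iff indicator_def)
    ultimately show ?thesis by simp
  qed
  then have "(\<lambda>(t, r). indicator {..<t} r * G r) \<in> borel_measurable (borel \<Otimes>\<^sub>M lborel)"
    by (simp add: case_prod_beta')
  from lborel.borel_measurable_lebesgue_integral[OF this] show ?thesis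
    unfolding J_def[abs_def] .
qed

lemma integrable_restricted_G:
  assumes "A \<in> sets borel" shows "integrable lborel (\<lambda>r. indicator A r * G r)"
  using assms G_bound abs_G_le B_nonneg
  by (intro bounded_support_integrable[where C = B and T = T]) (auto simp: indicator_def G_outside)

lemma J_bound: "\<bar>J t\<bar> \<le> B * T"
proof -
  have "\<bar>J t\<bar> \<le> (LINT r|lborel. norm (indicator {..<t} r * G r))"
    unfolding J_def using integral_norm_bound[of lborel "\<lambda>r. indicator {..<t} r * G r"] by simp
  also have "\<dots> \<le> (LINT r|lborel. B * indicator {0<..<T} r)"
  proof (rule integral_mono)
    show "integrable lborel (\<lambda>r. norm (indicator {..<t} r * G r))"
      by (intro integrable_norm integrable_restricted_G) simp
    show "integrable lborel (\<lambda>r. B * indicator {0<..<T} r)"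
      using T by (intro integrable_mult_right integrable_real_indicator) auto
    show "norm (indicator {..<t} r * G r) \<le> B * indicator {0<..<T} r" for r
      using G_bound[of r] by (auto simp: indicator_def split: if_splits)
  qed
  also have "\<dots> = B * T" using T by simp
  finally show ?thesis .
qed

text \<open>The limit \<open>L \<rightarrow> \<infinity>\<close> of the tested equation.\<close>

lemma weak_limit:
  assumes b: "0 < b" "b < T"
  shows "(LINT t|lborel. indicator {..<b} t * U t) = b * U0 + (LINT t|lborel. max 0 (b - t) * G t)"
proof -
  let ?s = "\<lambda>n t. ramp_deriv (real n + 1) b t * U t + ramp (real n + 1) b t * G t"
  let ?f = "\<lambda>t. (if t < b then - 1 else 0) * U t + max 0 (b - t) * G t"
  have bnd: "\<bar>?s n t\<bar> \<le> (2 * B + T * B) * indicator {0<..<T} t" for n t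
  proof (cases "t \<in> {0<..<T}")
    case True
    then have "\<bar>b - t\<bar> \<le> T" using b by auto
    then have "\<bar>ramp (real n + 1) b t\<bar> \<le> T" using ramp_bounds(1)[of "real n + 1" b t] by linarith
    then have "\<bar>ramp_deriv (real n + 1) b t * U t\<bar> \<le> 2 * B" "\<bar>ramp (real n + 1) b t * G t\<bar> \<le> T * B"
      unfolding abs_mult using ramp_bounds(2)[of "real n + 1" b t] abs_U_le[of t] abs_G_le[of t] T
      by (intro mult_mono; simp)+
    then show ?thesis using True by (simp add: abs_triangle_ineq[THEN order_trans])
  qed (simp add: U_outside G_outside)
  have "(\<lambda>n. LINT t|lborel. ?s n t) \<longlonglongrightarrow> (LINT t|lborel. ?f t)"
  proof (rule integral_dominated_convergence[where w = "\<lambda>t. (2 * B + T * B) * indicator {0<..<T} t"])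
    show "integrable lborel (\<lambda>t. (2 * B + T * B) * indicator {0<..<T} t :: real)"
      using T by (intro integrable_mult_right integrable_real_indicator) auto
    show "AE t in lborel. (\<lambda>n. ?s n t) \<longlonglongrightarrow> ?f t"
      by (intro AE_I2 tendsto_intros ramp_limits)
    show "AE t in lborel. norm (?s n t) \<le> (2 * B + T * B) * indicator {0<..<T} t" for n
      using bnd by simp
  qed measurable
  moreover have "(\<lambda>n. LINT t|lborel. ?s n t) \<longlonglongrightarrow> - max 0 (b - 0) * U0"
  proof -
    have "(LINT t|lborel. ?s n t) = - ramp (real n + 1) b 0 * U0" for n
      using b by (intro weak) auto
    then show ?thesis by (simp only:) (intro tendsto_intros ramp_limits)
  qed
  ultimately have eq: "(LINT t|lborel. ?f t) = - b * U0"
    using LIMSEQ_unique b by fastforce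
  have "(LINT t|lborel. ?f t) = (LINT t|lborel. max 0 (b - t) * G t - indicator {..<b} t * U t)"
    by (intro Bochner_Integration.integral_cong) (auto simp: indicator_def)
  also have "\<dots> = (LINT t|lborel. max 0 (b - t) * G t) - (LINT t|lborel. indicator {..<b} t * U t)"
  proof (rule Bochner_Integration.integral_diff)
    have "\<bar>max 0 (b - t) * G t\<bar> \<le> (T * B) * indicator {0<..<T} t" for t
    proof (cases "t \<in> {0<..<T}")
      case True
      then show ?thesis unfolding abs_mult using b abs_G_le[of t] B_nonneg T by (auto intro!: mult_mono)
    qed (simp add: G_outside)
    then show "integrable lborel (\<lambda>t. max 0 (b - t) * G t)"
      by (intro bounded_support_integrable) auto
    have "\<bar>indicator {..<b} t * U t\<bar> \<le> B * indicator {0<..<T} t" for t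
      using U_bound[of t] by (auto simp: indicator_def split: if_splits)
    then show "integrable lborel (\<lambda>t. indicator {..<b} t * U t)"
      by (intro bounded_support_integrable) auto
  qed
  finally show ?thesis using eq by simp
qed

lemma integral_J:
  assumes b: "0 < b" "b < T"
  shows "(LINT t|lborel. indicator {0<..<b} t * J t) = (LINT r|lborel. max 0 (b - r) * G r)"
proof -
  let ?h = "\<lambda>t r. if 0 < t \<and> t < b \<and> r < t then G r else 0"
  have int: "integrable (lborel \<Otimes>\<^sub>M lborel) (\<lambda>(t, r). ?h t r)"
  proof (rule bounded_support_integrable2)
    have "(\<lambda>p::real \<times> real. ?h (fst p) (snd p)) \<in> borel_measurable (lborel \<Otimes>\<^sub>M lborel)"
      by measurable
    then show "(\<lambda>(t, r). ?h t r) \<in> borel_measurable (lborel \<Otimes>\<^sub>M lborel)" by (simp add: case_prod_beta')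
    show "\<bar>case p of (t, r) \<Rightarrow> ?h t r\<bar> \<le> B * indicator ({0<..<T} \<times> {0<..<T}) p" for p
      using b abs_G_le[of "snd p"] B_nonneg by (cases p) (auto simp: indicator_def G_outside)
  qed
  have "(LINT t|lborel. indicator {0<..<b} t * J t) = (LINT t|lborel. LINT r|lborel. ?h t r)"
  proof (rule Bochner_Integration.integral_cong[OF refl])
    fix t :: real
    have "indicator {0<..<b} t * J t = (LINT r|lborel. indicator {0<..<b} t * (indicator {..<t} r * G r))"
      unfolding J_def by simp
    also have "\<dots> = (LINT r|lborel. ?h t r)"
      by (intro Bochner_Integration.integral_cong) (auto simp: indicator_def)
    finally show "indicator {0<..<b} t * J t = (LINT r|lborel. ?h t r)" .
  qed
  also have "\<dots> = (LINT r|lborel. LINT t|lborel. ?h t r)"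
    by (rule lborel_pair.Fubini_integral[OF int, symmetric])
  also have "\<dots> = (LINT r|lborel. max 0 (b - r) * G r)"
  proof (rule Bochner_Integration.integral_cong[OF refl])
    fix r :: real
    show "(LINT t|lborel. ?h t r) = max 0 (b - r) * G r"
    proof (cases "r \<in> {0<..<T}")
      case True
      have "(LINT t|lborel. ?h t r) = (LINT t|lborel. indicator {r<..<b} t * G r)"
        using True by (intro Bochner_Integration.integral_cong) (auto simp: indicator_def)
      also have "\<dots> = measure lborel {r<..<b} * G r" by simp
      also have "measure lborel {r<..<b} = max 0 (b - r)" by (cases "r \<le> b") auto
      finally show ?thesis .
    next
      case False
      then have "G r = 0" by (rule G_outside)
      then show ?thesis by (simp cong: if_cong)
    qed
  qed
  finally show ?thesis .
qed

text \<open>By \<open>weak_limit\<close> and \<open>integral_J\<close>, the integrals of \<open>U\<close> and of \<open>U0 + J\<close> over \<open>(0,b)\<close> agree for all \<open>b < T\<close>.\<close>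

lemma solution_AE: "AE t in lborel. t \<in> {0<..<T} \<longrightarrow> U t = U0 + J t"
proof -
  define W where "W t = indicator {0<..<T} t * (U t - U0 - J t)" for t
  have [measurable]: "W \<in> borel_measurable borel" unfolding W_def by measurable
  let ?C = "B + \<bar>U0\<bar> + B * T"
  have Wb: "\<bar>W t\<bar> \<le> ?C * indicator {0<..<T} t" for t
    using abs_U_le[of t] J_bound[of t] by (auto simp: W_def indicator_def)
  have intW: "integrable lborel (\<lambda>t. indicator A t * W t)" if [measurable]: "A \<in> sets borel" for A
  proof (rule bounded_support_integrable[where C = ?C and T = T])
    show "\<bar>indicator A t * W t\<bar> \<le> ?C * indicator {0<..<T} t" for t
      using Wb[of t] by (auto simp: indicator_def split: if_splits)
  qed measurable
  have zero: "(LINT t|lborel. indicator {..<b} t * W t) = 0" if b: "b < T" for b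
  proof (cases "b \<le> 0")
    case True
    have "(LINT t|lborel. indicator {..<b} t * W t) = (LINT t|(lborel :: real measure). 0)"
      by (rule Bochner_Integration.integral_cong) (use True in \<open>auto simp: W_def indicator_def\<close>)
    then show ?thesis by simp
  next
    case False
    then have b0: "0 < b" by simp
    have i1: "integrable lborel (\<lambda>t. indicator {..<b} t * U t)"
    proof (rule bounded_support_integrable[where C = B and T = T])
      show "\<bar>indicator {..<b} t * U t\<bar> \<le> B * indicator {0<..<T} t" for t
        using U_bound[of t] by (auto simp: indicator_def split: if_splits)
    qed measurable
    have i2: "integrable lborel (\<lambda>t. indicator {0<..<b} t * U0)"
      using b0 by (intro integrable_mult_left integrable_real_indicator) auto
    have i3: "integrable lborel (\<lambda>t. indicator {0<..<b} t * J t)"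
    proof (rule bounded_support_integrable[where C = "B * T" and T = T])
      show "\<bar>indicator {0<..<b} t * J t\<bar> \<le> B * T * indicator {0<..<T} t" for t
        using J_bound[of t] b by (auto simp: indicator_def)
    qed measurable
    have "(LINT t|lborel. indicator {..<b} t * W t)
        = (LINT t|lborel. indicator {..<b} t * U t - indicator {0<..<b} t * U0 - indicator {0<..<b} t * J t)"
      using b by (intro Bochner_Integration.integral_cong) (auto simp: W_def indicator_def U_outside)
    also have "\<dots> = (LINT t|lborel. indicator {..<b} t * U t) - (LINT t|lborel. indicator {0<..<b} t * U0)
        - (LINT t|lborel. indicator {0<..<b} t * J t)"
      using i1 i2 i3 by (simp only: Bochner_Integration.integral_diff Bochner_Integration.integrable_diff)
    also have "(LINT t|lborel. indicator {0<..<b} t * U0) = b * U0" using b0 by simp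
    finally show ?thesis using weak_limit[OF b0 b] integral_J[OF b0 b] by simp
  qed
  have "AE t in lborel. indicator {..<b} t * W t = 0" if b: "b < T" for b
  proof (rule AE_zero_of_halfline_integrals[OF intW])
    fix x :: real
    show "(LINT t|lborel. indicator {x<..} t * (indicator {..<b} t * W t)) = 0"
    proof (cases "x < b")
      case False
      then have "(LINT t|lborel. indicator {x<..} t * (indicator {..<b} t * W t)) = (LINT t|(lborel :: real measure). 0)"
        by (intro Bochner_Integration.integral_cong) (auto simp: indicator_def)
      then show ?thesis by simp
    next
      case True
      have "(LINT t|lborel. indicator {x<..} t * (indicator {..<b} t * W t))
          = (LINT t|lborel. indicator {..<b} t * W t - indicator {..<x} t * W t)"
      proof (rule integral_cong_AE)
        show "AE t in lborel. indicator {x<..} t * (indicator {..<b} t * W t) = indicator {..<b} t * W t - indicator {..<x} t * W t"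
          using AE_lborel_singleton[of x] by eventually_elim (use True in \<open>auto simp: indicator_def\<close>)
      qed measurable
      also have "\<dots> = (LINT t|lborel. indicator {..<b} t * W t) - (LINT t|lborel. indicator {..<x} t * W t)"
        by (intro Bochner_Integration.integral_diff intW) auto
      finally show ?thesis using zero[OF b] zero[of x] True b by simp
    qed
  qed simp
  then have "AE t in lborel. \<forall>n. indicator {..<T - T / (real n + 1)} t * W t = 0"
    unfolding AE_all_countable using T by auto
  then show ?thesis
  proof eventually_elim
    case (elim t)
    show ?case
    proof
      assume t: "t \<in> {0<..<T}"
      obtain n where n: "T / (T - t) < real n" using reals_Archimedean2 by blast
      have "T < (real n + 1) * (T - t)" using n t T by (simp add: divide_less_eq algebra_simps)
      then have "T / (real n + 1) < T - t" by (simp add: divide_less_eq mult.commute)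
      then have "t < T - T / (real n + 1)" by simp
      then have "W t = 0" using elim[rule_format, of n] by simp
      then show "U t = U0 + J t" using t by (simp add: W_def)
    qed
  qed
qed

text \<open>The square of a primitive: the square \<open>(0,t) \<times> (0,t)\<close> is split along its diagonal.\<close>

lemma J_square: "(J t)\<^sup>2 = (LINT s|lborel. indicator {..<t} s * (2 * J s * G s))"
proof -
  let ?h = "\<lambda>s. indicator {..<t} s * G s"
  have hb: "\<bar>?h s\<bar> \<le> B * indicator {0<..<T} s" for s
    using G_bound[of s] by (auto simp: indicator_def split: if_splits)
  have hm [measurable]: "?h \<in> borel_measurable borel" by measurable
  let ?k = "\<lambda>s r. if s \<le> r then ?h s * ?h r else 0" and ?l = "\<lambda>s r. if r < s then ?h s * ?h r else 0"
  have bound: "\<bar>?h s * ?h r\<bar> \<le> B * B * indicator ({0<..<T} \<times> {0<..<T}) (s, r)" for s r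
  proof -
    have "\<bar>?h s * ?h r\<bar> \<le> (B * indicator {0<..<T} s) * (B * indicator {0<..<T} r)"
      unfolding abs_mult[of "?h s"] by (intro mult_mono hb) (use hb[of s] in auto)
    then show ?thesis by (simp add: indicator_times mult_ac)
  qed
  have intk: "integrable (lborel \<Otimes>\<^sub>M lborel) (\<lambda>(s, r). ?k s r)"
  proof (rule bounded_support_integrable2)
    have "(\<lambda>p::real \<times> real. ?k (fst p) (snd p)) \<in> borel_measurable (lborel \<Otimes>\<^sub>M lborel)" by measurable
    then show "(\<lambda>(s, r). ?k s r) \<in> borel_measurable (lborel \<Otimes>\<^sub>M lborel)" by (simp add: case_prod_beta')
    show "\<bar>case p of (s, r) \<Rightarrow> ?k s r\<bar> \<le> B * B * indicator ({0<..<T} \<times> {0<..<T}) p" for p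
      using bound[of "fst p" "snd p"] by (cases p) auto
  qed
  have inth: "integrable lborel ?h" by (rule bounded_support_integrable[OF hm hb])
  have intl: "integrable lborel (\<lambda>r. ?l s r)" "integrable lborel (\<lambda>r. ?k s r)" for s
  proof -
    show "integrable lborel (\<lambda>r. ?l s r)"
      by (rule Bochner_Integration.integrable_bound[OF integrable_mult_right[OF inth, of "?h s"]]) auto
    show "integrable lborel (\<lambda>r. ?k s r)"
      by (rule Bochner_Integration.integrable_bound[OF integrable_mult_right[OF inth, of "?h s"]]) auto
  qed
  have l: "(LINT r|lborel. ?l s r) = ?h s * J s" for s
  proof -
    have "(LINT r|lborel. ?l s r) = (LINT r|lborel. ?h s * (indicator {..<s} r * G r))"
      by (intro Bochner_Integration.integral_cong) (auto simp: indicator_def)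
    then show ?thesis by (simp add: J_def)
  qed
  have k: "(LINT s|lborel. ?k s r) = ?h r * J r" for r
  proof -
    have "(LINT s|lborel. ?k s r) = (LINT s|lborel. ?h r * (indicator {..<r} s * G s))"
    proof (rule integral_cong_AE)
      show "AE s in lborel. ?k s r = ?h r * (indicator {..<r} s * G s)"
        using AE_lborel_singleton[of r] by eventually_elim (auto simp: indicator_def)
    qed measurable
    then show ?thesis by (simp add: J_def)
  qed
  have intJ: "integrable lborel (\<lambda>s. ?h s * J s)"
  proof (rule bounded_support_integrable[where C = "B * (B * T)" and T = T])
    show "\<bar>?h s * J s\<bar> \<le> B * (B * T) * indicator {0<..<T} s" for s
    proof -
      have "\<bar>?h s * J s\<bar> \<le> (B * indicator {0<..<T} s) * (B * T)"
        unfolding abs_mult[of "?h s"] by (intro mult_mono hb J_bound) (use hb[of s] in auto)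
      then show ?thesis by (simp add: mult_ac)
    qed
  qed measurable
  have "(J t)\<^sup>2 = (LINT s|lborel. ?h s * J t)" by (simp add: power2_eq_square J_def)
  also have "\<dots> = (LINT s|lborel. (LINT r|lborel. ?l s r) + (LINT r|lborel. ?k s r))"
  proof (rule Bochner_Integration.integral_cong[OF refl])
    fix s
    have "?h s * J t = (LINT r|lborel. ?h s * ?h r)" by (simp add: J_def)
    also have "\<dots> = (LINT r|lborel. ?l s r + ?k s r)"
      by (intro Bochner_Integration.integral_cong) auto
    also have "\<dots> = (LINT r|lborel. ?l s r) + (LINT r|lborel. ?k s r)"
      by (rule Bochner_Integration.integral_add[OF intl])
    finally show "?h s * J t = (LINT r|lborel. ?l s r) + (LINT r|lborel. ?k s r)" .
  qed
  also have "\<dots> = (LINT s|lborel. ?h s * J s) + (LINT s|lborel. LINT r|lborel. ?k s r)"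
    unfolding l
    by (rule Bochner_Integration.integral_add[OF intJ]) (use lborel_pair.integrable_fst'[OF intk] in simp)
  also have "(LINT s|lborel. LINT r|lborel. ?k s r) = (LINT r|lborel. LINT s|lborel. ?k s r)"
    by (rule lborel_pair.Fubini_integral[OF intk, symmetric])
  also have "\<dots> = (LINT r|lborel. ?h r * J r)" unfolding k ..
  also have "(LINT s|lborel. ?h s * J s) + (LINT r|lborel. ?h r * J r) = (LINT s|lborel. indicator {..<t} s * (2 * J s * G s))"
  proof -
    have "(LINT s|lborel. ?h s * J s) + (LINT r|lborel. ?h r * J r) = (LINT s|lborel. 2 * (?h s * J s))" by simp
    also have "\<dots> = (LINT s|lborel. indicator {..<t} s * (2 * J s * G s))"
      by (rule Bochner_Integration.integral_cong) (simp_all add: mult_ac)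
    finally show ?thesis .
  qed
  finally show ?thesis .
qed

text \<open>The energy identity of a single mode.\<close>

lemma square_identity:
  "AE t in lborel. t \<in> {0<..<T} \<longrightarrow> (U t)\<^sup>2 = U0\<^sup>2 + (LINT s|lborel. indicator {..<t} s * (2 * U s * G s))"
proof -
  have intJG: "integrable lborel (\<lambda>s. indicator {..<t} s * (2 * J s * G s))" for t
  proof (rule bounded_support_integrable[where C = "2 * (B * T) * B" and T = T])
    show "\<bar>indicator {..<t} s * (2 * J s * G s)\<bar> \<le> 2 * (B * T) * B * indicator {0<..<T} s" for s
    proof (cases "s \<in> {0<..<T}")
      case True
      have "\<bar>2 * J s * G s\<bar> \<le> 2 * (B * T) * B"
        unfolding abs_mult using J_bound[of s] abs_G_le[of s] B_nonneg T by (intro mult_mono) auto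
      then show ?thesis using True B_nonneg T by (auto simp: indicator_def)
    qed (simp add: G_outside)
  qed measurable
  show ?thesis
    using solution_AE
  proof eventually_elim
    case (elim t)
    show ?case
    proof
      assume "t \<in> {0<..<T}"
      with elim have Ut: "U t = U0 + J t" by simp
      have "(LINT s|lborel. indicator {..<t} s * (2 * U s * G s))
        = (LINT s|lborel. 2 * U0 * (indicator {..<t} s * G s) + indicator {..<t} s * (2 * J s * G s))"
      proof (rule integral_cong_AE)
        show "AE s in lborel. indicator {..<t} s * (2 * U s * G s) = 2 * U0 * (indicator {..<t} s * G s) + indicator {..<t} s * (2 * J s * G s)"
          using solution_AE
        proof eventually_elim
          case (elim s)
          show ?case
          proof (cases "s \<in> {0<..<T}")
            case True
            then show ?thesis using elim by (simp add: algebra_simps)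
          qed (simp add: G_outside)
        qed
      qed measurable
      also have "\<dots> = (LINT s|lborel. 2 * U0 * (indicator {..<t} s * G s)) + (LINT s|lborel. indicator {..<t} s * (2 * J s * G s))"
        by (intro Bochner_Integration.integral_add integrable_mult_right integrable_restricted_G intJG) auto
      also have "\<dots> = 2 * U0 * J t + (J t)\<^sup>2"
        unfolding J_square by (simp add: J_def)
      finally show "(U t)\<^sup>2 = U0\<^sup>2 + (LINT s|lborel. indicator {..<t} s * (2 * U s * G s))"
        unfolding Ut by (simp add: power2_sum)
    qed
  qed
qed

end

section \<open>The energy identity of a single Fourier mode\<close>

lemma AE_lebesgue_on_Ioo:
  fixes T :: real
  shows "(AE t in lebesgue_on {0<..<T}. P t) \<longleftrightarrow> (AE t in lborel. t \<in> {0<..<T} \<longrightarrow> P t)"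
  by (subst AE_restrict_space_iff) (auto simp: AE_completion_iff)

lemma integral_lebesgue_on_borel:
  fixes f g :: "real \<Rightarrow> real"
  assumes g: "g \<in> borel_measurable borel" and out: "\<And>t. t \<notin> {0<..<T} \<Longrightarrow> g t = 0"
    and ae: "AE t in lborel. t \<in> {0<..<T} \<longrightarrow> f t = g t"
  shows "(LINT t|lebesgue_on {0<..<T}. f t) = (LINT t|lborel. g t)"
proof -
  have gl: "g \<in> borel_measurable lebesgue" using g by (intro measurable_completion) simp
  have ae': "AE t in lebesgue. g t = indicator {0<..<T} t *\<^sub>R f t"
    using AE_completion[OF ae] by eventually_elim (use out in \<open>auto simp: indicator_def\<close>)
  have fl: "(\<lambda>t. indicator {0<..<T} t *\<^sub>R f t) \<in> borel_measurable lebesgue"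
    by (rule borel_measurable_AE[OF gl ae'])
  have "(LINT t|lebesgue_on {0<..<T}. f t) = (LINT t|lebesgue. indicator {0<..<T} t *\<^sub>R f t)"
    by (rule integral_restrict_space) simp
  also have "\<dots> = (LINT t|lebesgue. g t)"
    by (rule integral_cong_AE[OF fl gl]) (use ae' in eventually_elim, simp)
  also have "\<dots> = (LINT t|lborel. g t)"
    by (rule integral_completion) (use g in simp)
  finally show ?thesis .
qed

lemma measurable_field_borel_representative:
  assumes "measurable_field T u"
  obtains w :: "real \<times> (real^3) \<Rightarrow> real^3" where "w \<in> borel_measurable borel"
    "AE t in lborel. t \<in> {0<..<T} \<longrightarrow> (AE x in lborel. u t x = w (t, x))"
proof -
  let ?S = "{0<..<T} \<times> (UNIV :: (real^3) set)"
  have "open ?S" by (intro open_Times) auto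
  then have S: "?S \<in> sets lebesgue" by (intro sets_completionI_sets) (simp add: borel_open)
  have um: "(\<lambda>(t, x). u t x) \<in> borel_measurable (lebesgue_on ?S)" using assms by (simp add: measurable_field_def)
  have "\<exists>g. g \<in> borel_measurable lborel \<and> (AE p in lborel. (if p \<in> ?S then u (fst p) (snd p) $ i else 0) = g p)" for i
  proof -
    have "(\<lambda>p. (case p of (t, x) \<Rightarrow> u t x) $ i) \<in> borel_measurable (lebesgue_on ?S)"
      by (rule measurable_compose[OF um]) (intro borel_measurable_continuous_onI continuous_intros)
    then have "(\<lambda>p. if p \<in> ?S then u (fst p) (snd p) $ i else 0) \<in> borel_measurable lebesgue"
      using S unfolding case_prod_beta' by (subst (asm) borel_measurable_if[symmetric]) auto
    then show ?thesis
      using completion_ex_borel_measurable_real[of "\<lambda>p. if p \<in> ?S then u (fst p) (snd p) $ i else 0" lborel] by blast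
  qed
  then have "\<exists>g. \<forall>i. g i \<in> borel_measurable lborel \<and> (AE p in lborel. (if p \<in> ?S then u (fst p) (snd p) $ i else 0) = g i p)"
    by (intro choice allI)
  then obtain g where g: "\<And>i. g i \<in> borel_measurable lborel"
    "\<And>i. AE p in lborel. (if p \<in> ?S then u (fst p) (snd p) $ i else 0) = g i p" by blast
  define w where "w p = (\<chi> i. g i p)" for p
  have wb: "w \<in> borel_measurable borel"
  proof (subst borel_measurable_euclidean_space, intro ballI)
    fix b :: "real^3" assume "b \<in> Basis"
    then obtain i where "b = axis i 1" by (auto simp: Basis_vec_def)
    then have "(\<lambda>x. w x \<bullet> b) = g i" by (simp add: w_def inner_axis)
    then show "(\<lambda>x. w x \<bullet> b) \<in> borel_measurable borel" using g(1)[of i] by simp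
  qed
  have "AE p in lborel. \<forall>i\<in>UNIV. (if p \<in> ?S then u (fst p) (snd p) $ i else 0) = g i p"
    by (subst AE_finite_all) (use g(2) in auto)
  then have "AE p in lborel \<Otimes>\<^sub>M lborel. p \<in> ?S \<longrightarrow> u (fst p) (snd p) = w p"
    unfolding lborel_prod
  proof eventually_elim
    case (elim p)
    show ?case
    proof
      assume p: "p \<in> ?S"
      have "u (fst p) (snd p) $ i = g i p" for i
        using elim[rule_format, of i] by (simp only: if_P[OF p] UNIV_I)
      then show "u (fst p) (snd p) = w p" by (simp add: vec_eq_iff w_def)
    qed
  qed
  then have "AE t in lborel. AE x in lborel. (t, x) \<in> ?S \<longrightarrow> u (fst (t, x)) (snd (t, x)) = w (t, x)"
    by (rule lborel_pair.AE_pair)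
  then have "AE t in lborel. t \<in> {0<..<T} \<longrightarrow> (AE x in lborel. u t x = w (t, x))"
    by eventually_elim auto
  with wb show ?thesis by (rule that)
qed

text \<open>Coefficients of continuous functions of the velocity are Borel functions of time up to a null set.\<close>

lemma wave_coeff_time_borel:
  assumes u: "measurable_field T u" "AE t in lborel. t \<in> {0<..<T} \<longrightarrow> u t \<in> L2_torus"
    and q: "continuous_on UNIV q"
  obtains h where "h \<in> borel_measurable borel"
    "AE t in lborel. t \<in> {0<..<T} \<longrightarrow> wave_coeff k \<alpha> (\<lambda>x. q (u t x)) = h t"
proof -
  obtain w where w: "w \<in> borel_measurable borel"
    "AE t in lborel. t \<in> {0<..<T} \<longrightarrow> (AE x in lborel. u t x = w (t, x))"
    using measurable_field_borel_representative[OF u(1)] .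
  have qb: "q \<in> borel_measurable borel" by (rule borel_measurable_continuous_onI[OF q])
  define h where "h t = (LINT x|torus_borel. wave k \<alpha> x * q (w (t, x)))" for t
  have "h \<in> borel_measurable borel"
  proof -
    have s: "snd \<in> borel_measurable ((borel :: real measure) \<Otimes>\<^sub>M torus_borel)"
      by (rule measurable_compose[OF measurable_snd measurable_ident_torus_borel])
    have "(\<lambda>p. (fst p, snd p)) \<in> borel_measurable ((borel :: real measure) \<Otimes>\<^sub>M torus_borel)"
      by (rule borel_measurable_Pair[OF measurable_fst s])
    from measurable_compose[OF this measurable_compose[OF w(1) qb]]
    have "(\<lambda>p. wave k \<alpha> (snd p) * q (w (fst p, snd p))) \<in> borel_measurable (borel \<Otimes>\<^sub>M torus_borel)"
      by (intro borel_measurable_times measurable_compose[OF s borel_wave])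
    then have "(\<lambda>(t, x). wave k \<alpha> x * q (w (t, x))) \<in> borel_measurable (borel \<Otimes>\<^sub>M torus_borel)"
      by (simp add: case_prod_beta')
    from torus_borel.borel_measurable_lebesgue_integral[OF this] show ?thesis unfolding h_def[abs_def] .
  qed
  moreover have "AE t in lborel. t \<in> {0<..<T} \<longrightarrow> wave_coeff k \<alpha> (\<lambda>x. q (u t x)) = h t"
    using w(2) u(2)
  proof eventually_elim
    case (elim t)
    show ?case
    proof
      assume t: "t \<in> {0<..<T}"
      have wt: "(\<lambda>x. wave k \<alpha> x * q (w (t, x))) \<in> borel_measurable borel"
      proof -
        have "(\<lambda>x. (t, x)) \<in> borel_measurable borel"
          by (intro borel_measurable_continuous_onI continuous_intros)
        from measurable_compose[OF this measurable_compose[OF w(1) qb]] show ?thesis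
          by (intro borel_measurable_times borel_wave)
      qed
      have "u t \<in> borel_measurable torus"
        using elim t by (auto simp: L2_torus_def intro: measurable_restrict_space1)
      from measurable_compose[OF this qb]
      have m: "(\<lambda>x. wave k \<alpha> x * q (u t x)) \<in> borel_measurable torus"
        by (intro borel_measurable_times lebesgue_on_borelI[OF borel_wave])
      have "wave_coeff k \<alpha> (\<lambda>x. q (u t x)) = (LINT x|torus. wave k \<alpha> x * q (w (t, x)))"
        unfolding wave_coeff_def
      proof (rule integral_cong_AE[OF m lebesgue_on_borelI[OF wt]])
        have "AE x in lborel. u t x = w (t, x)" using elim t by blast
        from AE_torusI[OF this] show "AE x in torus. wave k \<alpha> x * q (u t x) = wave k \<alpha> x * q (w (t, x))"
          by eventually_elim simp
      qed
      then show "wave_coeff k \<alpha> (\<lambda>x. q (u t x)) = h t"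
        unfolding h_def by (simp add: integral_torus_borel(1)[OF wt])
    qed
  qed
  ultimately show ?thesis by (rule that)
qed

lemma wave_coeff_bound:
  assumes v: "v \<in> L2_torus" and q: "q \<in> borel_measurable borel" "\<And>y. \<bar>q y\<bar> \<le> C * (1 + (norm y)\<^sup>2)"
  shows "\<bar>wave_coeff k \<alpha> (\<lambda>x. q (v x))\<bar> \<le> C * (1 + (L2_norm v)\<^sup>2)"
    and "integrable torus (\<lambda>x. q (v x))"
proof -
  have vm: "v \<in> borel_measurable torus" and vi: "integrable torus (\<lambda>x. (norm (v x))\<^sup>2)"
    using v by (auto simp: L2_torus_def intro: measurable_restrict_space1)
  have dom: "integrable torus (\<lambda>x. C * (1 + (norm (v x))\<^sup>2))"
    by (intro integrable_mult_right Bochner_Integration.integrable_add vi torus.integrable_const)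
  have qm: "(\<lambda>x. q (v x)) \<in> borel_measurable torus" by (rule measurable_compose[OF vm q(1)])
  show qi: "integrable torus (\<lambda>x. q (v x))"
  proof (rule Bochner_Integration.integrable_bound[OF dom qm])
    show "AE x in torus. norm (q (v x)) \<le> norm (C * (1 + (norm (v x))\<^sup>2))"
    proof (rule AE_I2)
      fix x
      show "norm (q (v x)) \<le> norm (C * (1 + (norm (v x))\<^sup>2))"
        using q(2)[of "v x"] unfolding real_norm_def by linarith
    qed
  qed
  have "\<bar>wave_coeff k \<alpha> (\<lambda>x. q (v x))\<bar> \<le> (LINT x|torus. norm (wave k \<alpha> x * q (v x)))"
    unfolding wave_coeff_def using integral_norm_bound[of torus "\<lambda>x. wave k \<alpha> x * q (v x)"] by simp
  also have "\<dots> \<le> (LINT x|torus. C * (1 + (norm (v x))\<^sup>2))"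
  proof (rule integral_mono[OF _ dom])
    have le: "norm (wave k \<alpha> x * q (v x)) \<le> \<bar>q (v x)\<bar>" for x
      using abs_wave_le[of k \<alpha> x] by (simp add: abs_mult mult_left_le_one_le)
    have wm: "(\<lambda>x. wave k \<alpha> x * q (v x)) \<in> borel_measurable torus"
      by (intro borel_measurable_times lebesgue_on_borelI[OF borel_wave] qm)
    show "integrable torus (\<lambda>x. norm (wave k \<alpha> x * q (v x)))"
      by (intro integrable_norm Bochner_Integration.integrable_bound[OF qi wm]) (use le in auto)
    show "norm (wave k \<alpha> x * q (v x)) \<le> C * (1 + (norm (v x))\<^sup>2)" for x
      using le[of x] q(2)[of "v x"] by linarith
  qed
  also have "\<dots> = C * (1 + (LINT x|torus. (norm (v x))\<^sup>2))"
  proof -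
    have "(LINT x|torus. 1 + (norm (v x))\<^sup>2) = (LINT x|torus. 1) + (LINT x|torus. (norm (v x))\<^sup>2)"
      by (intro Bochner_Integration.integral_add vi torus.integrable_const)
    then show ?thesis by simp
  qed
  also have "(LINT x|torus. (norm (v x))\<^sup>2) = (L2_norm v)\<^sup>2"
  proof -
    have "0 \<le> (LINT x|torus. (norm (v x))\<^sup>2)" by simp
    then show ?thesis by (simp add: L2_norm_def L2_inner_def power2_norm_eq_inner)
  qed
  finally show "\<bar>wave_coeff k \<alpha> (\<lambda>x. q (v x))\<bar> \<le> C * (1 + (L2_norm v)\<^sup>2)" .
qed

lemma abs_inner_le: "\<bar>y \<bullet> c\<bar> \<le> norm c * (1 + (norm y)\<^sup>2)"
  and abs_inner_inner_le: "\<bar>(y \<bullet> c) * (y \<bullet> k)\<bar> \<le> (norm c * norm k) * (1 + (norm y)\<^sup>2)"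
  for y c k :: "real^3"
proof -
  have "2 * norm y \<le> (norm y)\<^sup>2 + 1" using sum_squares_bound[of "norm y" 1] by simp
  then have "norm y \<le> 1 + (norm y)\<^sup>2" using norm_ge_zero[of y] by linarith
  then have "norm c * norm y \<le> norm c * (1 + (norm y)\<^sup>2)" by (intro mult_left_mono) auto
  then show "\<bar>y \<bullet> c\<bar> \<le> norm c * (1 + (norm y)\<^sup>2)"
    using Cauchy_Schwarz_ineq2[of y c] by (simp add: mult.commute)
  have "\<bar>(y \<bullet> c) * (y \<bullet> k)\<bar> \<le> (norm y * norm c) * (norm y * norm k)"
    unfolding abs_mult by (intro mult_mono Cauchy_Schwarz_ineq2) auto
  also have "\<dots> = (norm c * norm k) * (norm y)\<^sup>2" by (simp add: power2_eq_square mult_ac)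
  also have "\<dots> \<le> (norm c * norm k) * (1 + (norm y)\<^sup>2)" by (intro mult_left_mono) auto
  finally show "\<bar>(y \<bullet> c) * (y \<bullet> k)\<bar> \<le> (norm c * norm k) * (1 + (norm y)\<^sup>2)" .
qed

text \<open>The function \<open>E\<close> on \<open>(0,T)\<close> is almost everywhere equal to the primitive of \<open>R\<close> with initial value
  \<open>E0\<close>.  The rate \<open>R\<close> need only coincide almost everywhere with a bounded Borel function.\<close>

definition evolves :: "real \<Rightarrow> (real \<Rightarrow> real) \<Rightarrow> real \<Rightarrow> (real \<Rightarrow> real) \<Rightarrow> bool" where
  "evolves T E E0 R \<longleftrightarrow> (\<exists>P B. P \<in> borel_measurable borel \<and> (\<forall>t. \<bar>P t\<bar> \<le> B * indicator {0<..<T} t)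
    \<and> (AE s in lborel. s \<in> {0<..<T} \<longrightarrow> P s = R s)
    \<and> (AE t in lborel. t \<in> {0<..<T} \<longrightarrow> E t = E0 + (LINT s|lborel. indicator {..<t} s * P s)))"

lemma evolves_cong:
  assumes "evolves T E E0 R"
    and "AE t in lborel. t \<in> {0<..<T} \<longrightarrow> E t = E' t \<and> R t = R' t" and "E0 = E0'"
  shows "evolves T E' E0' R'"
proof -
  obtain P B where P: "P \<in> borel_measurable borel" "\<And>t. \<bar>P t\<bar> \<le> B * indicator {0<..<T} t"
    "AE s in lborel. s \<in> {0<..<T} \<longrightarrow> P s = R s"
    "AE t in lborel. t \<in> {0<..<T} \<longrightarrow> E t = E0 + (LINT s|lborel. indicator {..<t} s * P s)"
    using assms(1) unfolding evolves_def by blast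
  have "AE s in lborel. s \<in> {0<..<T} \<longrightarrow> P s = R' s"
    "AE t in lborel. t \<in> {0<..<T} \<longrightarrow> E' t = E0' + (LINT s|lborel. indicator {..<t} s * P s)"
    using P(3) assms(2) by (eventually_elim, auto) (use P(4) assms(2,3) in \<open>eventually_elim, auto\<close>)
  then show ?thesis using P(1,2) unfolding evolves_def by blast
qed

lemma evolves_sum:
  assumes fin: "finite I" and ev: "\<And>i. i \<in> I \<Longrightarrow> evolves T (E i) (E0 i) (R i)"
  shows "evolves T (\<lambda>t. \<Sum>i\<in>I. c i * E i t) (\<Sum>i\<in>I. c i * E0 i) (\<lambda>t. \<Sum>i\<in>I. c i * R i t)"
proof -
  have "\<forall>i\<in>I. \<exists>P B. P \<in> borel_measurable borel \<and> (\<forall>t. \<bar>P t\<bar> \<le> B * indicator {0<..<T} t)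
    \<and> (AE s in lborel. s \<in> {0<..<T} \<longrightarrow> P s = R i s)
    \<and> (AE t in lborel. t \<in> {0<..<T} \<longrightarrow> E i t = E0 i + (LINT s|lborel. indicator {..<t} s * P s))"
    using ev unfolding evolves_def by blast
  from bchoice[OF this] obtain P where "\<forall>i\<in>I. \<exists>B. P i \<in> borel_measurable borel \<and> (\<forall>t. \<bar>P i t\<bar> \<le> B * indicator {0<..<T} t)
    \<and> (AE s in lborel. s \<in> {0<..<T} \<longrightarrow> P i s = R i s)
    \<and> (AE t in lborel. t \<in> {0<..<T} \<longrightarrow> E i t = E0 i + (LINT s|lborel. indicator {..<t} s * P i s))" ..
  from bchoice[OF this] obtain B where "\<forall>i\<in>I. P i \<in> borel_measurable borel \<and> (\<forall>t. \<bar>P i t\<bar> \<le> B i * indicator {0<..<T} t)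
    \<and> (AE s in lborel. s \<in> {0<..<T} \<longrightarrow> P i s = R i s)
    \<and> (AE t in lborel. t \<in> {0<..<T} \<longrightarrow> E i t = E0 i + (LINT s|lborel. indicator {..<t} s * P i s))" ..
  then have Pm: "\<And>i. i \<in> I \<Longrightarrow> P i \<in> borel_measurable borel"
    and Pb: "\<And>i t. i \<in> I \<Longrightarrow> \<bar>P i t\<bar> \<le> B i * indicator {0<..<T} t"
    and PR: "\<And>i. i \<in> I \<Longrightarrow> AE s in lborel. s \<in> {0<..<T} \<longrightarrow> P i s = R i s"
    and PE: "\<And>i. i \<in> I \<Longrightarrow> AE t in lborel. t \<in> {0<..<T} \<longrightarrow> E i t = E0 i + (LINT s|lborel. indicator {..<t} s * P i s)"
    by blast+
  have intP: "integrable lborel (\<lambda>s. indicator {..<t} s * P i s)" if i: "i \<in> I" for t i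
  proof (rule bounded_support_integrable)
    show "(\<lambda>s. indicator {..<t} s * P i s) \<in> borel_measurable borel" using Pm[OF i] by simp
    show "\<bar>indicator {..<t} s * P i s\<bar> \<le> B i * indicator {0<..<T} s" for s
      using Pb[OF i, of s] by (cases "s < t") auto
  qed
  show ?thesis
    unfolding evolves_def
  proof (intro exI[of _ "\<lambda>s. \<Sum>i\<in>I. c i * P i s"] exI[of _ "\<Sum>i\<in>I. \<bar>c i\<bar> * B i"] conjI allI)
    show "(\<lambda>s. \<Sum>i\<in>I. c i * P i s) \<in> borel_measurable borel"
      by (intro borel_measurable_sum borel_measurable_times borel_measurable_const Pm)
    show "\<bar>\<Sum>i\<in>I. c i * P i t\<bar> \<le> (\<Sum>i\<in>I. \<bar>c i\<bar> * B i) * indicator {0<..<T} t" for t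
    proof -
      have "\<bar>\<Sum>i\<in>I. c i * P i t\<bar> \<le> (\<Sum>i\<in>I. \<bar>c i\<bar> * (B i * indicator {0<..<T} t))"
        by (rule order_trans[OF sum_abs]) (intro sum_mono, simp only: abs_mult, intro mult_left_mono Pb abs_ge_zero)
      then show ?thesis by (simp only: sum_distrib_right mult.assoc)
    qed
    have "AE s in lborel. \<forall>i\<in>I. s \<in> {0<..<T} \<longrightarrow> P i s = R i s"
      by (subst AE_finite_all[OF fin]) (use PR in blast)
    then show "AE s in lborel. s \<in> {0<..<T} \<longrightarrow> (\<Sum>i\<in>I. c i * P i s) = (\<Sum>i\<in>I. c i * R i s)"
      by eventually_elim simp
    have "AE t in lborel. \<forall>i\<in>I. t \<in> {0<..<T} \<longrightarrow> E i t = E0 i + (LINT s|lborel. indicator {..<t} s * P i s)"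
      by (subst AE_finite_all[OF fin]) (use PE in blast)
    then show "AE t in lborel. t \<in> {0<..<T} \<longrightarrow> (\<Sum>i\<in>I. c i * E i t)
        = (\<Sum>i\<in>I. c i * E0 i) + (LINT s|lborel. indicator {..<t} s * (\<Sum>i\<in>I. c i * P i s))"
    proof eventually_elim
      case (elim t)
      show ?case
      proof
        assume t: "t \<in> {0<..<T}"
        have "(\<Sum>i\<in>I. c i * E i t) = (\<Sum>i\<in>I. c i * (E0 i + (LINT s|lborel. indicator {..<t} s * P i s)))"
          using elim t by (intro sum.cong refl) simp
        also have "\<dots> = (\<Sum>i\<in>I. c i * E0 i) + (\<Sum>i\<in>I. (LINT s|lborel. c i * (indicator {..<t} s * P i s)))"
          by (simp add: distrib_left sum.distrib)
        also have "(\<Sum>i\<in>I. (LINT s|lborel. c i * (indicator {..<t} s * P i s)))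
            = (LINT s|lborel. (\<Sum>i\<in>I. c i * (indicator {..<t} s * P i s)))"
          by (rule Bochner_Integration.integral_sum[symmetric]) (intro integrable_mult_right intP)
        also have "(\<lambda>s. (\<Sum>i\<in>I. c i * (indicator {..<t} s * P i s))) = (\<lambda>s. indicator {..<t} s * (\<Sum>i\<in>I. c i * P i s))"
          unfolding sum_distrib_left by (intro ext sum.cong refl) simp
        finally show "(\<Sum>i\<in>I. c i * E i t)
          = (\<Sum>i\<in>I. c i * E0 i) + (LINT s|lborel. indicator {..<t} s * (\<Sum>i\<in>I. c i * P i s))" .
      qed
    qed
  qed
qed

text \<open>A weak solution of the Euler equations, without the regularity assumption.\<close>

locale euler_solution =
  fixes T :: real and u0 :: "real^3 \<Rightarrow> real^3" and u :: "real \<Rightarrow> real^3 \<Rightarrow> real^3"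
  assumes T: "T > 0" and u0: "u0 \<in> H_space" and sol: "euler_weak_solution T u0 u"
begin

lemma measurable_u: "measurable_field T u"
  and AE_H: "AE t in lborel. t \<in> {0<..<T} \<longrightarrow> u t \<in> H_space"
  and bounded_energy: "\<exists>M>0. AE t in lborel. t \<in> {0<..<T} \<longrightarrow> L2_norm (u t) \<le> M"
proof -
  have s: "u \<in> Linf_time T H_space L2_norm" using sol by (simp add: euler_weak_solution_def)
  then show "measurable_field T u" by (simp add: Linf_time_def)
  show "AE t in lborel. t \<in> {0<..<T} \<longrightarrow> u t \<in> H_space"
    using s by (simp add: Linf_time_def AE_lebesgue_on_Ioo)
  obtain C where C: "AE t in lborel. t \<in> {0<..<T} \<longrightarrow> L2_norm (u t) \<le> C"
    using s by (auto simp: Linf_time_def AE_lebesgue_on_Ioo)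
  have "AE t in lborel. t \<in> {0<..<T} \<longrightarrow> L2_norm (u t) \<le> max 1 C"
    using C by eventually_elim auto
  then show "\<exists>M>0. AE t in lborel. t \<in> {0<..<T} \<longrightarrow> L2_norm (u t) \<le> M"
    by (intro exI[of _ "max 1 C"]) auto
qed

lemma AE_L2: "AE t in lborel. t \<in> {0<..<T} \<longrightarrow> u t \<in> L2_torus"
  using AE_H by eventually_elim (auto simp: H_space_def)

lemma wave_coeff_bounded_borel:
  assumes q: "continuous_on UNIV q" "\<And>y. \<bar>q y\<bar> \<le> C * (1 + (norm y)\<^sup>2)"
  shows "\<exists>h B. h \<in> borel_measurable borel \<and> (\<forall>t. \<bar>h t\<bar> \<le> B * indicator {0<..<T} t)
     \<and> (AE t in lborel. t \<in> {0<..<T} \<longrightarrow> wave_coeff k \<alpha> (\<lambda>x. q (u t x)) = h t)"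
proof -
  obtain h where h: "h \<in> borel_measurable borel"
    "AE t in lborel. t \<in> {0<..<T} \<longrightarrow> wave_coeff k \<alpha> (\<lambda>x. q (u t x)) = h t"
    using wave_coeff_time_borel[OF measurable_u AE_L2 q(1)] .
  obtain M where M: "M > 0" "AE t in lborel. t \<in> {0<..<T} \<longrightarrow> L2_norm (u t) \<le> M"
    using bounded_energy by blast
  have C: "C \<ge> 0" using q(2)[of 0] by simp
  let ?B = "C * (1 + M\<^sup>2)"
\<comment> \<open>truncation turns the almost everywhere bound into a bound everywhere\<close>
  define g where "g t = (if t \<in> {0<..<T} \<and> \<bar>h t\<bar> \<le> ?B then h t else 0)" for t
  have "g \<in> borel_measurable borel" using h(1) unfolding g_def by measurable
  moreover have "\<bar>g t\<bar> \<le> ?B * indicator {0<..<T} t" for t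
    using C by (auto simp: g_def)
  moreover have "AE t in lborel. t \<in> {0<..<T} \<longrightarrow> wave_coeff k \<alpha> (\<lambda>x. q (u t x)) = g t"
    using h(2) M(2) AE_L2
  proof eventually_elim
    case (elim t)
    show ?case
    proof
      assume t: "t \<in> {0<..<T}"
      have "\<bar>wave_coeff k \<alpha> (\<lambda>x. q (u t x))\<bar> \<le> C * (1 + (L2_norm (u t))\<^sup>2)"
        using elim t by (intro wave_coeff_bound q borel_measurable_continuous_onI) auto
      also have "\<dots> \<le> ?B"
        using elim t C L2_norm_nonneg[of "u t"] by (intro mult_left_mono add_left_mono power_mono) auto
      finally show "wave_coeff k \<alpha> (\<lambda>x. q (u t x)) = g t" using elim t by (simp add: g_def)
    qed
  qed
  ultimately show ?thesis by blast
qed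

text \<open>Testing the equation with a plane wave with polarisation \<open>c\<close> orthogonal to \<open>k\<close>.\<close>

lemma mode_identity:
  assumes k: "k \<in> int_lattice" and c: "k \<bullet> c = 0"
  shows "evolves T (\<lambda>t. (wave_coeff k \<alpha> (\<lambda>x. u t x \<bullet> c))\<^sup>2) ((wave_coeff k \<alpha> (\<lambda>x. u0 x \<bullet> c))\<^sup>2)
    (\<lambda>t. 4 * pi * (wave_coeff k \<alpha> (\<lambda>x. u t x \<bullet> c) * wave_coeff k (\<alpha> + pi / 2) (\<lambda>x. (u t x \<bullet> c) * (u t x \<bullet> k))))"
proof -
  let ?q1 = "\<lambda>y::real^3. y \<bullet> c" and ?q2 = "\<lambda>y::real^3. (y \<bullet> c) * (y \<bullet> k)"
  obtain U B1 where U: "U \<in> borel_measurable borel" "\<And>t. \<bar>U t\<bar> \<le> B1 * indicator {0<..<T} t"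
    "AE t in lborel. t \<in> {0<..<T} \<longrightarrow> wave_coeff k \<alpha> (\<lambda>x. u t x \<bullet> c) = U t"
  proof -
    have "continuous_on UNIV ?q1" by (intro continuous_intros)
    from wave_coeff_bounded_borel[OF this abs_inner_le, of k \<alpha>] show ?thesis using that by blast
  qed
  obtain G0 B2 where G0: "G0 \<in> borel_measurable borel" "\<And>t. \<bar>G0 t\<bar> \<le> B2 * indicator {0<..<T} t"
    "AE t in lborel. t \<in> {0<..<T} \<longrightarrow> wave_coeff k (\<alpha> + pi / 2) (\<lambda>x. (u t x \<bullet> c) * (u t x \<bullet> k)) = G0 t"
  proof -
    have "continuous_on UNIV ?q2" by (intro continuous_intros)
    from wave_coeff_bounded_borel[OF this abs_inner_inner_le, of k "\<alpha> + pi / 2"] show ?thesis using that by blast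
  qed
  let ?G = "\<lambda>t. 2 * pi * G0 t"
\<comment> \<open>one constant for both bounds; nothing is recorded about the signs of \<open>B1\<close> and \<open>B2\<close>\<close>
  let ?B = "\<bar>B1\<bar> + 2 * pi * \<bar>B2\<bar>"
  let ?U0 = "wave_coeff k \<alpha> (\<lambda>x. u0 x \<bullet> c)"
  have Ub: "\<bar>U t\<bar> \<le> ?B * indicator {0<..<T} t" for t
  proof (cases "t \<in> {0<..<T}")
    case True
    have "0 \<le> 2 * pi * \<bar>B2\<bar>" by simp
    moreover have "\<bar>U t\<bar> \<le> B1" using U(2)[of t] True by simp
    ultimately have "\<bar>U t\<bar> \<le> ?B" by linarith
    then show ?thesis using True by simp
  qed (use U(2)[of t] in simp)
  have Gb: "\<bar>?G t\<bar> \<le> ?B * indicator {0<..<T} t" for t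
  proof (cases "t \<in> {0<..<T}")
    case True
    then have "\<bar>G0 t\<bar> \<le> \<bar>B2\<bar>" using G0(2)[of t] by auto
    then have "2 * pi * \<bar>G0 t\<bar> \<le> 2 * pi * \<bar>B2\<bar>" by (intro mult_left_mono) auto
    moreover have "\<bar>?G t\<bar> = 2 * pi * \<bar>G0 t\<bar>" by (simp add: abs_mult)
    ultimately have "\<bar>?G t\<bar> \<le> ?B" using abs_ge_zero[of B1] by linarith
    then show ?thesis using True by simp
  qed (use G0(2)[of t] in simp)
  interpret weak_ode T ?U0 ?B U ?G
  proof
    show "0 < T" by (rule T)
    show "U \<in> borel_measurable borel" by (rule U(1))
    show "?G \<in> borel_measurable borel" using G0(1) by simp
    show "\<bar>U t\<bar> \<le> ?B * indicator {0<..<T} t" "\<bar>?G t\<bar> \<le> ?B * indicator {0<..<T} t" for t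
      by (rule Ub, rule Gb)
    fix L b :: real assume L: "L > 0" and b: "0 < b" "b < T"
    let ?\<phi> = "wave_field (ramp L b) k \<alpha> c"
    have "?\<phi> \<in> test_fields T"
      by (rule wave_field_test_field[OF T k c smooth_real_ramp b]) (rule ramp_outside[OF L])
    then have "(LINT t|lebesgue_on {0<..<T}.
        L2_inner (u t) (time_deriv ?\<phi> t) + L2_inner (\<lambda>x. outer (u t x) (u t x)) (\<lambda>x. jacobian (?\<phi> t) (at x)))
        = - L2_inner u0 (?\<phi> 0)"
      using sol unfolding euler_weak_solution_def by blast
    then have eq: "(LINT t|lebesgue_on {0<..<T}. ramp_deriv L b t * wave_coeff k \<alpha> (\<lambda>x. u t x \<bullet> c)
        + ramp L b t * (2 * pi * wave_coeff k (\<alpha> + pi / 2) (\<lambda>x. (u t x \<bullet> c) * (u t x \<bullet> k))))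
        = - ramp L b 0 * ?U0"
      by (simp add: wave_field_pairings[OF ramp_derivative])
    show "(LINT t|lborel. ramp_deriv L b t * U t + ramp L b t * ?G t) = - ramp L b 0 * ?U0"
      unfolding eq[symmetric]
    proof (rule integral_lebesgue_on_borel[symmetric])
      show "(\<lambda>t. ramp_deriv L b t * U t + ramp L b t * ?G t) \<in> borel_measurable borel"
        using U(1) G0(1) by measurable
      show "ramp_deriv L b t * U t + ramp L b t * ?G t = 0" if "t \<notin> {0<..<T}" for t
        using U(2)[of t] G0(2)[of t] that by simp
      show "AE t in lborel. t \<in> {0<..<T} \<longrightarrow> ramp_deriv L b t * wave_coeff k \<alpha> (\<lambda>x. u t x \<bullet> c)
        + ramp L b t * (2 * pi * wave_coeff k (\<alpha> + pi / 2) (\<lambda>x. (u t x \<bullet> c) * (u t x \<bullet> k)))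
        = ramp_deriv L b t * U t + ramp L b t * ?G t"
        using U(3) G0(3) by eventually_elim simp
    qed
  qed
  have Pb: "\<bar>2 * U t * ?G t\<bar> \<le> (2 * ?B * ?B) * indicator {0<..<T} t" for t
  proof (cases "t \<in> {0<..<T}")
    case True
    then have "\<bar>2 * U t * ?G t\<bar> \<le> 2 * ?B * ?B"
      unfolding abs_mult[of "2 * U t"] abs_mult[of 2] using abs_U_le[of t] abs_G_le[of t] by (intro mult_mono) auto
    then show ?thesis using True by simp
  qed (use U(2)[of t] in simp)
  show ?thesis
    unfolding evolves_def
  proof (intro exI[of _ "\<lambda>t. 2 * U t * ?G t"] exI[of _ "2 * ?B * ?B"] conjI allI Pb)
    show "(\<lambda>t. 2 * U t * ?G t) \<in> borel_measurable borel" using U(1) G0(1) by simp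
    show "AE s in lborel. s \<in> {0<..<T} \<longrightarrow> 2 * U s * ?G s
        = 4 * pi * (wave_coeff k \<alpha> (\<lambda>x. u s x \<bullet> c) * wave_coeff k (\<alpha> + pi / 2) (\<lambda>x. (u s x \<bullet> c) * (u s x \<bullet> k)))"
      using U(3) G0(3) by eventually_elim simp
    show "AE t in lborel. t \<in> {0<..<T} \<longrightarrow> (wave_coeff k \<alpha> (\<lambda>x. u t x \<bullet> c))\<^sup>2
         = ?U0\<^sup>2 + (LINT s|lborel. indicator {..<t} s * (2 * U s * ?G s))"
      using U(3) square_identity by eventually_elim simp
  qed
qed

end

section \<open>Conservation of energy\<close>

text \<open>The \<open>i\<close>-th basis vector projected to the orthogonal complement of \<open>k\<close>.\<close>

definition leray_axis :: "real^3 \<Rightarrow> 3 \<Rightarrow> real^3" where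
  "leray_axis k i = axis i 1 - (k $ i / (k \<bullet> k)) *\<^sub>R k"

lemma leray_axis_orthogonal: "k \<bullet> leray_axis k i = 0"
proof (cases "k = 0")
  case False
  then show ?thesis by (simp add: leray_axis_def inner_diff_right inner_axis)
qed simp

lemma leray_axis_nth: "leray_axis k i $ l = (if l = i then 1 else 0) - k $ i * k $ l / (k \<bullet> k)"
  by (simp add: leray_axis_def axis_def)

lemma fourier_inner:
  assumes "v \<in> L2_torus"
  shows "fourier (\<lambda>x. complex_of_real (v x \<bullet> c)) k = (\<Sum>j\<in>UNIV. complex_of_real (c $ j) * vfourier v k $ j)"
    and "sq_integrable (\<lambda>x. complex_of_real (v x \<bullet> c))"
proof -
  have e: "complex_of_real (v x \<bullet> c) = (\<Sum>j\<in>UNIV. complex_of_real (c $ j) * complex_of_real (v x $ j))" for x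
    by (simp add: inner_vec_def mult.commute)
  show "sq_integrable (\<lambda>x. complex_of_real (v x \<bullet> c))"
    unfolding e by (intro sq_integrable_sum sq_integrable_cmult sq_integrable_component assms finite)
  have int: "integrable torus (\<lambda>x. complex_of_real (v x $ j) * character (- k) x)" for j
    by (intro integrable_mult_sq sq_integrable_component sq_integrable_character assms)
  have "fourier (\<lambda>x. complex_of_real (v x \<bullet> c)) k
     = (LINT x|torus. (\<Sum>j\<in>UNIV. complex_of_real (c $ j) * (complex_of_real (v x $ j) * character (- k) x)))"
    unfolding fourier_def e by (simp only: sum_distrib_right mult.assoc)
  also have "\<dots> = (\<Sum>j\<in>UNIV. (LINT x|torus. complex_of_real (c $ j) * (complex_of_real (v x $ j) * character (- k) x)))"
    by (intro Bochner_Integration.integral_sum integrable_mult_right int)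
  finally show "fourier (\<lambda>x. complex_of_real (v x \<bullet> c)) k = (\<Sum>j\<in>UNIV. complex_of_real (c $ j) * vfourier v k $ j)"
    by (simp add: vfourier_nth fourier_def)
qed

lemma fourier_leray_axis:
  assumes v: "v \<in> H_space" and k: "k \<in> int_lattice"
  shows "fourier (\<lambda>x. complex_of_real (v x \<bullet> leray_axis k i)) k = vfourier v k $ i"
proof -
  have vL: "v \<in> L2_torus" using v by (simp add: H_space_def)
  have "(\<Sum>j\<in>UNIV. complex_of_real (leray_axis k i $ j) * vfourier v k $ j)
     = (\<Sum>j\<in>UNIV. (if j = i then vfourier v k $ j else 0) - complex_of_real (k $ i / (k \<bullet> k)) * (complex_of_real (k $ j) * vfourier v k $ j))"
    by (intro sum.cong refl) (simp add: leray_axis_nth left_diff_distrib)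
  also have "\<dots> = vfourier v k $ i - complex_of_real (k $ i / (k \<bullet> k)) * (\<Sum>j\<in>UNIV. complex_of_real (k $ j) * vfourier v k $ j)"
    by (simp add: sum_subtractf sum_distrib_left)
  finally show ?thesis using H_space_fourier(1)[OF v k] by (simp add: fourier_inner(1)[OF vL])
qed

lemma fourier_wave_coeff_integrable:
  assumes "integrable torus f"
  shows "fourier (\<lambda>x. complex_of_real (f x)) k = Complex (wave_coeff k 0 f) (wave_coeff k (pi / 2) f)"
proof -
  have fm: "(\<lambda>x. complex_of_real (f x)) \<in> borel_measurable torus"
    using borel_measurable_integrable[OF assms] by simp
  have int: "integrable torus (\<lambda>x. complex_of_real (f x) * character (- k) x)"
  proof (rule Bochner_Integration.integrable_bound[OF assms])
    show "(\<lambda>x. complex_of_real (f x) * character (- k) x) \<in> borel_measurable torus"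
      by (intro borel_measurable_times fm borel_character_torus)
  qed (simp add: norm_mult)
  show ?thesis
    unfolding complex_eq_iff fourier_def wave_coeff_def
    using integral_Re[OF int] integral_Im[OF int] by (simp add: character_uminus_wave mult.commute)
qed

text \<open>The projections drop out, because the coefficients of \<open>v\<close> are orthogonal to \<open>k\<close>.\<close>

lemma mode_flux_leray:
  assumes v: "v \<in> H_space" and k: "k \<in> int_lattice"
  shows "(\<Sum>i\<in>UNIV. cnj (vfourier v k $ i) * fourier (\<lambda>x. complex_of_real ((v x \<bullet> leray_axis k i) * (v x \<bullet> k))) k) = mode_flux v k"
proof -
  have vL: "v \<in> L2_torus" using v by (simp add: H_space_def)
  let ?c = "leray_axis k"
  have q: "fourier (\<lambda>x. complex_of_real ((v x \<bullet> ?c i) * (v x \<bullet> k))) k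
     = (\<Sum>l\<in>UNIV. \<Sum>j\<in>UNIV. complex_of_real (?c i $ l) * (complex_of_real (k $ j) * quadratic_coeff v j l k))" for i
  proof -
    have e: "complex_of_real ((v x \<bullet> ?c i) * (v x \<bullet> k)) * character (- k) x
      = (\<Sum>l\<in>UNIV. \<Sum>j\<in>UNIV. complex_of_real (?c i $ l) * (complex_of_real (k $ j) * (complex_of_real (v x $ j * v x $ l) * character (- k) x)))" for x
    proof -
      have "(v x \<bullet> ?c i) * (v x \<bullet> k) = (\<Sum>l\<in>UNIV. \<Sum>j\<in>UNIV. (v x $ l * ?c i $ l) * (v x $ j * k $ j))"
        unfolding inner_vec_def sum_product by simp
      then show ?thesis
        unfolding of_real_sum sum_distrib_right by (simp only: of_real_sum sum_distrib_right) (intro sum.cong refl, simp)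
    qed
    have int: "integrable torus (\<lambda>x. complex_of_real (v x $ j * v x $ l) * character (- k) x)" for j l
      using integrable_mult_sq[OF sq_integrable_component[OF vL, of j] sq_integrable_mult_character[OF sq_integrable_component[OF vL, of l], of "- k"]]
      by (simp add: mult.assoc)
    show ?thesis
      unfolding fourier_def[of "\<lambda>x. complex_of_real ((v x \<bullet> ?c i) * (v x \<bullet> k))"] e quadratic_coeff_def fourier_def
      by (simp add: Bochner_Integration.integral_sum Bochner_Integration.integrable_sum int del: of_real_mult)
  qed
  have p: "(\<Sum>i\<in>UNIV. cnj (vfourier v k $ i) * complex_of_real (?c i $ l)) = cnj (vfourier v k $ l)" for l
  proof -
    have "(\<Sum>i\<in>UNIV. cnj (vfourier v k $ i) * complex_of_real (?c i $ l))
      = (\<Sum>i\<in>UNIV. (if i = l then cnj (vfourier v k $ i) else 0) - complex_of_real (k $ l / (k \<bullet> k)) * cnj (complex_of_real (k $ i) * vfourier v k $ i))"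
      by (intro sum.cong refl) (simp add: leray_axis_nth right_diff_distrib)
    also have "\<dots> = cnj (vfourier v k $ l) - complex_of_real (k $ l / (k \<bullet> k)) * cnj (\<Sum>i\<in>UNIV. complex_of_real (k $ i) * vfourier v k $ i)"
      by (simp only: sum_subtractf sum_distrib_left[symmetric] cnj_sum[symmetric]) simp
    finally show ?thesis using H_space_fourier(1)[OF v k] by simp
  qed
  have "(\<Sum>i\<in>UNIV. cnj (vfourier v k $ i) * fourier (\<lambda>x. complex_of_real ((v x \<bullet> ?c i) * (v x \<bullet> k))) k)
    = (\<Sum>i\<in>UNIV. \<Sum>l\<in>UNIV. (cnj (vfourier v k $ i) * complex_of_real (?c i $ l)) * (\<Sum>j\<in>UNIV. complex_of_real (k $ j) * quadratic_coeff v j l k))"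
    unfolding q by (simp only: sum_distrib_left mult.assoc)
  also have "\<dots> = (\<Sum>l\<in>UNIV. (\<Sum>i\<in>UNIV. cnj (vfourier v k $ i) * complex_of_real (?c i $ l)) * (\<Sum>j\<in>UNIV. complex_of_real (k $ j) * quadratic_coeff v j l k))"
    by (subst sum.swap) (simp only: sum_distrib_right)
  finally show ?thesis unfolding p mode_flux_def by (simp only: sum_distrib_left mult.assoc)
qed

text \<open>The rates and energies of the real coefficients with phases \<open>0\<close> and \<open>\<pi>/2\<close> and all three projected
  polarisations add up to those of the complex mode.\<close>

lemma mode_power:
  assumes v: "v \<in> H_space" and k: "k \<in> int_lattice"
  shows "(\<Sum>i\<in>UNIV. wave_coeff k 0 (\<lambda>x. v x \<bullet> leray_axis k i) * wave_coeff k (0 + pi / 2) (\<lambda>x. (v x \<bullet> leray_axis k i) * (v x \<bullet> k))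
      + wave_coeff k (pi / 2) (\<lambda>x. v x \<bullet> leray_axis k i) * wave_coeff k (pi / 2 + pi / 2) (\<lambda>x. (v x \<bullet> leray_axis k i) * (v x \<bullet> k)))
    = Im (mode_flux v k)" (is "(\<Sum>i\<in>UNIV. ?t i) = _")
    and "(\<Sum>i\<in>UNIV. (wave_coeff k 0 (\<lambda>x. v x \<bullet> leray_axis k i))\<^sup>2 + (wave_coeff k (pi / 2) (\<lambda>x. v x \<bullet> leray_axis k i))\<^sup>2)
    = (norm (vfourier v k))\<^sup>2"
proof -
  have vL: "v \<in> L2_torus" using v by (simp add: H_space_def)
  let ?c = "leray_axis k"
  let ?f = "\<lambda>i x. v x \<bullet> ?c i" and ?q = "\<lambda>i x. (v x \<bullet> ?c i) * (v x \<bullet> k)"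
  have fi: "vfourier v k $ i = Complex (wave_coeff k 0 (?f i)) (wave_coeff k (pi / 2) (?f i))" for i
    unfolding fourier_leray_axis[OF v k, of i, symmetric]
    by (rule fourier_wave_coeff[OF fourier_inner(2)[OF vL]])
  have qint: "integrable torus (?q i)" for i
    by (rule wave_coeff_bound(2)[OF vL _ abs_inner_inner_le])
      (intro borel_measurable_continuous_onI continuous_intros)
  have qi: "fourier (\<lambda>x. complex_of_real (?q i x)) k = Complex (wave_coeff k 0 (?q i)) (wave_coeff k (pi / 2) (?q i))" for i
    by (rule fourier_wave_coeff_integrable[OF qint])
  have neg: "wave_coeff k (pi / 2 + pi / 2) (?q i) = - wave_coeff k 0 (?q i)" for i
  proof -
    have "wave k (pi / 2 + pi / 2) x = - wave k 0 x" for x by (simp add: wave_def cos_add)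
    then show ?thesis by (simp add: wave_coeff_def)
  qed
  have "?t i = Im (cnj (vfourier v k $ i) * fourier (\<lambda>x. complex_of_real (?q i x)) k)" for i
    unfolding fi qi neg by simp
  then have "(\<Sum>i\<in>UNIV. ?t i) = Im (\<Sum>i\<in>UNIV. cnj (vfourier v k $ i) * fourier (\<lambda>x. complex_of_real (?q i x)) k)"
    by (simp only: Im_sum)
  then show "(\<Sum>i\<in>UNIV. ?t i) = Im (mode_flux v k)" unfolding mode_flux_leray[OF v k] .
  show "(\<Sum>i\<in>UNIV. (wave_coeff k 0 (?f i))\<^sup>2 + (wave_coeff k (pi / 2) (?f i))\<^sup>2) = (norm (vfourier v k))\<^sup>2"
    unfolding norm_vec_sq by (intro sum.cong refl) (simp add: fi cmod_power2)
qed

text \<open>The square of the \<open>L\<^sup>2\<close> norm (twice the kinetic energy), with the modes weighted by the cutoff.\<close>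

definition truncated_energy :: "nat \<Rightarrow> (real^3 \<Rightarrow> real^3) \<Rightarrow> real" where
  "truncated_energy N v = (\<Sum>k\<in>cutoff_set N. cutoff N k * (norm (vfourier v k))\<^sup>2)"

lemma truncated_energy_tendsto:
  assumes v: "v \<in> H_space"
  shows "(\<lambda>N. truncated_energy N v) \<longlonglongrightarrow> (L2_norm v)\<^sup>2"
proof -
  let ?a = "\<lambda>k. (norm (vfourier v k))\<^sup>2"
  have P: "(?a has_sum (L2_norm v)\<^sup>2) int_lattice" by (rule H_space_parseval[OF v])
  have E: "((\<lambda>k. cutoff N k * ?a k) has_sum truncated_energy N v) int_lattice" for N
    unfolding truncated_energy_def
    by (rule has_sum_finite_neutralI) (use finite_cutoff_set cutoff_outside in \<open>auto simp: cutoff_set_def\<close>)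
  have diff: "((\<lambda>k. (cutoff N k - 1) * ?a k) has_sum (truncated_energy N v - (L2_norm v)\<^sup>2)) int_lattice" for N
  proof -
    have "((\<lambda>k. - ?a k) has_sum - (L2_norm v)\<^sup>2) int_lattice" using P by (simp add: has_sum_uminus)
    from has_sum_add[OF E[of N] this] show ?thesis by (simp add: left_diff_distrib)
  qed
  have "(\<lambda>N. infsum (\<lambda>k. (cutoff N k - 1) * ?a k) int_lattice) \<longlonglongrightarrow> 0"
  proof (rule infsum_dominated_tendsto_0)
    show "?a summable_on int_lattice" using P by (rule has_sum_imp_summable)
    fix N k
    have "\<bar>cutoff N k - 1\<bar> \<le> 1" using cutoff_bounds[of N k] by linarith
    then have "\<bar>cutoff N k - 1\<bar> * ?a k \<le> 1 * ?a k" by (intro mult_right_mono) auto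
    then show "norm ((cutoff N k - 1) * ?a k) \<le> ?a k" by (simp add: abs_mult)
  next
    fix k
    have "(\<lambda>N. (cutoff N k - 1) * ?a k) \<longlonglongrightarrow> (1 - 1) * ?a k"
      by (intro tendsto_intros cutoff_tendsto_1)
    then show "(\<lambda>N. (cutoff N k - 1) * ?a k) \<longlonglongrightarrow> 0" by simp
  qed
  then have "(\<lambda>N. truncated_energy N v - (L2_norm v)\<^sup>2) \<longlonglongrightarrow> 0"
    unfolding infsumI[OF diff] .
  then show ?thesis by (simp add: LIM_zero_iff)
qed

context euler_solution
begin

lemma mode_energy:
  assumes k: "k \<in> int_lattice"
  shows "evolves T (\<lambda>t. (norm (vfourier (u t) k))\<^sup>2) ((norm (vfourier u0 k))\<^sup>2) (\<lambda>t. 4 * pi * Im (mode_flux (u t) k))"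
proof -
  let ?I = "(UNIV :: 3 set) \<times> {0, pi / 2 :: real}" and ?c = "leray_axis k"
  let ?U = "\<lambda>v p. wave_coeff k (snd p) (\<lambda>x. v x \<bullet> ?c (fst p))"
    and ?G = "\<lambda>v p. wave_coeff k (snd p + pi / 2) (\<lambda>x. (v x \<bullet> ?c (fst p)) * (v x \<bullet> k))"
  have split: "(\<Sum>p\<in>?I. g p) = (\<Sum>i\<in>UNIV. g (i, 0) + g (i, pi / 2))" for g :: "3 \<times> real \<Rightarrow> real"
  proof -
    have "(\<Sum>p\<in>?I. g p) = (\<Sum>i\<in>UNIV. \<Sum>\<alpha>\<in>{0, pi / 2}. g (i, \<alpha>))"
      by (simp only: sum.cartesian_product case_prod_eta)
    then show ?thesis by simp
  qed
  have energy: "(\<Sum>p\<in>?I. 1 * (?U v p)\<^sup>2) = (norm (vfourier v k))\<^sup>2" if "v \<in> H_space" for v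
    unfolding split mode_power(2)[OF that k, symmetric] by simp
  have flux: "(\<Sum>p\<in>?I. 1 * (4 * pi * (?U v p * ?G v p))) = 4 * pi * Im (mode_flux v k)" if "v \<in> H_space" for v
    unfolding split mode_power(1)[OF that k, symmetric] sum_distrib_left
    by (intro sum.cong refl) (simp add: algebra_simps)
  have "evolves T (\<lambda>t. \<Sum>p\<in>?I. 1 * (?U (u t) p)\<^sup>2) (\<Sum>p\<in>?I. 1 * (?U u0 p)\<^sup>2)
      (\<lambda>t. \<Sum>p\<in>?I. 1 * (4 * pi * (?U (u t) p * ?G (u t) p)))"
    by (intro evolves_sum mode_identity k leray_axis_orthogonal) simp
  then show ?thesis
  proof (rule evolves_cong)
    show "AE t in lborel. t \<in> {0<..<T} \<longrightarrow> (\<Sum>p\<in>?I. 1 * (?U (u t) p)\<^sup>2) = (norm (vfourier (u t) k))\<^sup>2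
      \<and> (\<Sum>p\<in>?I. 1 * (4 * pi * (?U (u t) p * ?G (u t) p))) = 4 * pi * Im (mode_flux (u t) k)"
      using AE_H by eventually_elim (use energy flux in blast)
  qed (rule energy[OF u0])
qed

lemma truncated_energy_identity:
  "evolves T (\<lambda>t. truncated_energy N (u t)) (truncated_energy N u0) (\<lambda>t. 4 * pi * Im (energy_flux N (u t)))"
proof -
  have "evolves T (\<lambda>t. \<Sum>k\<in>cutoff_set N. cutoff N k * (norm (vfourier (u t) k))\<^sup>2)
      (\<Sum>k\<in>cutoff_set N. cutoff N k * (norm (vfourier u0 k))\<^sup>2)
      (\<lambda>t. \<Sum>k\<in>cutoff_set N. cutoff N k * (4 * pi * Im (mode_flux (u t) k)))"
    by (intro evolves_sum finite_cutoff_set mode_energy) (simp add: cutoff_set_def)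
  then show ?thesis
    by (rule evolves_cong) (simp_all add: truncated_energy_def energy_flux_def sum_distrib_left mult_ac)
qed

lemma energy_conservation:
  assumes s: "5 / 6 \<le> s" and reg: "u \<in> Lq_time (5 / (2 * s)) T (Hs s) (Hs_norm s)"
  shows "AE t in lborel. t \<in> {0<..<T} \<longrightarrow> L2_norm (u t) = L2_norm u0"
proof -
  let ?q = "5 / (2 * s)"
  obtain M where M: "M > 0" "AE t in lborel. t \<in> {0<..<T} \<longrightarrow> L2_norm (u t) \<le> M"
    using bounded_energy by blast
  have inHs: "AE t in lborel. t \<in> {0<..<T} \<longrightarrow> u t \<in> Hs s"
    and int: "integrable (lebesgue_on {0<..<T}) (\<lambda>t. Hs_norm s (u t) powr ?q)"
    using reg by (simp_all add: Lq_time_def AE_lebesgue_on_Ioo)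
  let ?n = "nat \<lfloor>s\<rfloor>"
  define D where "D t = (3 ^ ?n * 1536 * (Hs_norm s (u t))\<^sup>2) powr (5 / (6 * s)) * (M\<^sup>2) powr (1 - 5 / (6 * s))" for t
  define C where "C = 4 * pi * 743 * ((3 ^ ?n * 1536) powr (5 / (4 * s)) * (M\<^sup>2) powr (3 / 2 - 5 / (4 * s)))"
  have C0: "C \<ge> 0" by (simp add: C_def)
  have flux: "AE t in lborel. t \<in> {0<..<T} \<longrightarrow>
      (\<forall>N. \<bar>4 * pi * Im (energy_flux N (u t))\<bar> \<le> C * Hs_norm s (u t) powr ?q)
      \<and> (\<lambda>N. 4 * pi * Im (energy_flux N (u t))) \<longlonglongrightarrow> 0"
    using AE_H inHs M(2)
  proof eventually_elim
    case (elim t)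
    show ?case
    proof
      assume t: "t \<in> {0<..<T}"
      have uH: "u t \<in> H_space" using elim t by blast
      have Dt: "(\<Sum>k\<in>K. (norm k powr (5 / 6) * norm (vfourier (u t) k))\<^sup>2) \<le> D t" if "finite K" "K \<subseteq> int_lattice" for K
        unfolding D_def using elim t by (intro critical_sum_bound s M that) auto
      note b = energy_flux_bound_and_limit[OF uH Dt]
      have "\<bar>4 * pi * Im (energy_flux N (u t))\<bar> \<le> C * Hs_norm s (u t) powr ?q" for N
      proof -
        have "\<bar>4 * pi * Im (energy_flux N (u t))\<bar> = 4 * pi * \<bar>Im (energy_flux N (u t))\<bar>" by (simp add: abs_mult)
        also have "\<dots> \<le> 4 * pi * (743 * D t powr (3 / 2))" by (intro mult_left_mono b) auto
        also have "D t powr (3 / 2) = ((3 ^ ?n * 1536) powr (5 / (4 * s)) * (M\<^sup>2) powr (3 / 2 - 5 / (4 * s))) * Hs_norm s (u t) powr ?q"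
          unfolding D_def by (rule critical_cubed_bound[OF s])
        finally show ?thesis by (simp add: C_def mult.assoc)
      qed
      moreover have "(\<lambda>N. 4 * pi * Im (energy_flux N (u t))) \<longlonglongrightarrow> 4 * pi * 0"
        by (intro tendsto_intros b(2))
      ultimately show "(\<forall>N. \<bar>4 * pi * Im (energy_flux N (u t))\<bar> \<le> C * Hs_norm s (u t) powr ?q)
        \<and> (\<lambda>N. 4 * pi * Im (energy_flux N (u t))) \<longlonglongrightarrow> 0" by simp
    qed
  qed
  have "\<forall>N. \<exists>P. P \<in> borel_measurable borel \<and> (\<exists>B. \<forall>t. \<bar>P t\<bar> \<le> B * indicator {0<..<T} t)
    \<and> (AE s in lborel. s \<in> {0<..<T} \<longrightarrow> P s = 4 * pi * Im (energy_flux N (u s)))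
    \<and> (AE t in lborel. t \<in> {0<..<T} \<longrightarrow> truncated_energy N (u t)
         = truncated_energy N u0 + (LINT s|lborel. indicator {..<t} s * P s))"
    using truncated_energy_identity unfolding evolves_def by blast
  from choice[OF this] obtain P where P: "\<forall>N. P N \<in> borel_measurable borel \<and> (\<exists>B. \<forall>t. \<bar>P N t\<bar> \<le> B * indicator {0<..<T} t)
    \<and> (AE s in lborel. s \<in> {0<..<T} \<longrightarrow> P N s = 4 * pi * Im (energy_flux N (u s)))
    \<and> (AE t in lborel. t \<in> {0<..<T} \<longrightarrow> truncated_energy N (u t)
         = truncated_energy N u0 + (LINT s|lborel. indicator {..<t} s * P N s))" ..
  then have Pm: "\<And>N. P N \<in> borel_measurable borel"
    and Pf: "\<And>N. AE s in lborel. s \<in> {0<..<T} \<longrightarrow> P N s = 4 * pi * Im (energy_flux N (u s))"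
    and Pe: "\<And>N. AE t in lborel. t \<in> {0<..<T} \<longrightarrow> truncated_energy N (u t)
         = truncated_energy N u0 + (LINT s|lborel. indicator {..<t} s * P N s)"
    by blast+
  have P0: "P N t = 0" if "t \<notin> {0<..<T}" for N t
  proof -
    obtain B where "\<bar>P N t\<bar> \<le> B * indicator {0<..<T} t" using P by blast
    then show ?thesis using that by simp
  qed
  have PfA: "AE s in lborel. \<forall>N. s \<in> {0<..<T} \<longrightarrow> P N s = 4 * pi * Im (energy_flux N (u s))"
    unfolding AE_all_countable using Pf by blast
  have PeA: "AE t in lborel. \<forall>N. t \<in> {0<..<T} \<longrightarrow> truncated_energy N (u t)
         = truncated_energy N u0 + (LINT s|lborel. indicator {..<t} s * P N s)"
    unfolding AE_all_countable using Pe by blast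
  have lim: "(\<lambda>N. LINT s|lborel. indicator {..<t} s * P N s) \<longlonglongrightarrow> 0" for t
  proof -
    let ?w = "\<lambda>s'. indicator {0<..<T} s' *\<^sub>R (C * Hs_norm s (u s') powr ?q)"
    have b: "(\<lambda>s. indicator {..<t} s * P N s) \<in> borel_measurable borel" for N using Pm[of N] by simp
    have "(\<lambda>N. LINT s|lebesgue. indicator {..<t} s * P N s) \<longlonglongrightarrow> (LINT s|(lebesgue :: real measure). 0)"
    proof (rule integral_dominated_convergence[where w = ?w])
      show "integrable lebesgue ?w"
        using integrable_mult_right[OF int, of C] by (subst (asm) integrable_restrict_space) auto
      show "(\<lambda>s. indicator {..<t} s * P N s) \<in> borel_measurable lebesgue" for N
        using b by (intro measurable_completion) simp
      show "AE s in lebesgue. (\<lambda>N. indicator {..<t} s * P N s) \<longlonglongrightarrow> 0"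
        using AE_completion[OF PfA] AE_completion[OF flux]
      proof eventually_elim
        case (elim s')
        show ?case
        proof (cases "s' \<in> {0<..<T}")
          case True
          then have "(\<lambda>N. P N s') \<longlonglongrightarrow> 0" using elim by simp
          from tendsto_mult_left[OF this, of "indicator {..<t} s'"] show ?thesis by simp
        qed (simp add: P0)
      qed
      show "AE s in lebesgue. norm (indicator {..<t} s * P N s) \<le> ?w s" for N
        using AE_completion[OF PfA] AE_completion[OF flux]
      proof eventually_elim
        case (elim s')
        show ?case
        proof (cases "s' \<in> {0<..<T}")
          case True
          then have "\<bar>P N s'\<bar> \<le> C * Hs_norm s (u s') powr ?q" using elim by simp
          moreover have "norm (indicator {..<t} s' * P N s') \<le> \<bar>P N s'\<bar>" by (simp add: abs_mult indicator_def)
          ultimately have "norm (indicator {..<t} s' * P N s') \<le> C * Hs_norm s (u s') powr ?q" by linarith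
          then show ?thesis using True by simp
        qed (simp add: P0)
      qed
    qed simp
    moreover have "(LINT s|lebesgue. indicator {..<t} s * P N s) = (LINT s|lborel. indicator {..<t} s * P N s)" for N
      by (rule integral_completion) (use b in simp)
    ultimately show ?thesis by simp
  qed
  show ?thesis
    using PeA AE_H AE_L2
  proof eventually_elim
    case (elim t)
    show ?case
    proof
      assume t: "t \<in> {0<..<T}"
      have uH: "u t \<in> H_space" using elim t by blast
      have "(\<lambda>N. truncated_energy N u0 + (LINT s|lborel. indicator {..<t} s * P N s)) \<longlonglongrightarrow> (L2_norm u0)\<^sup>2 + 0"
        by (intro tendsto_add truncated_energy_tendsto u0 lim)
      moreover have "(\<lambda>N. truncated_energy N u0 + (LINT s|lborel. indicator {..<t} s * P N s)) = (\<lambda>N. truncated_energy N (u t))"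
        using elim t by (intro ext) simp
      ultimately have "(\<lambda>N. truncated_energy N (u t)) \<longlonglongrightarrow> (L2_norm u0)\<^sup>2" by simp
      with truncated_energy_tendsto[OF uH] have "(L2_norm (u t))\<^sup>2 = (L2_norm u0)\<^sup>2" by (rule LIMSEQ_unique)
      moreover have "0 \<le> L2_norm (u t)" "0 \<le> L2_norm u0"
        using uH u0 by (auto simp: H_space_def intro: L2_norm_nonneg)
      ultimately show "L2_norm (u t) = L2_norm u0" by (simp only: power2_eq_iff_nonneg)
    qed
  qed
qed

end

theorem theorem1p1:
  fixes T s :: real
    and u0 :: "real^3 \<Rightarrow> real^3"
    and u :: "real \<Rightarrow> real^3 \<Rightarrow> real^3"
  assumes "T > 0"
    and "u0 \<in> H_space"
    and "euler_weak_solution T u0 u"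
    and "5/6 \<le> s" and "s < 5/2"
    and "u \<in> Lq_time (5 / (2 * s)) T (Hs s) (Hs_norm s)"
  shows "AE t in lebesgue_on {0..T}. L2_norm (u t) = L2_norm u0"
proof -
  interpret euler_solution T u0 u
    using assms by unfold_locales
  have "AE t in lborel. t \<in> {0..T} \<longrightarrow> L2_norm (u t) = L2_norm u0"
    using energy_conservation[OF assms(4,6)] AE_lborel_singleton[of 0] AE_lborel_singleton[of T]
    by eventually_elim auto
  then show ?thesis
    by (subst AE_restrict_space_iff) (auto simp: AE_completion_iff)
qed

end
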